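(* Let $K$ be an infinite field, $n\geq 2$, $S=K[x_1,\ldots,x_n]$. If $I\subset S$ is an ideal of Borel type, then $$\operatorname{reg}(I)=\min\{e : e\geq \deg(I)\text{ and } I_{\geq e}\text{ is stable}\}.$$ The same conclusion holds if $I\subset S$ is a monomial ideal such that $\operatorname{Ass}(S/I)$ is totally ordered by inclusion.
   Context: A monomial ideal $I\subset S$ is of Borel type if $(I:x_j^\infty)=(I:(x_1,\ldots,x_j)^\infty)$ for all $j=1,\ldots,n$. $\operatorname{Ass}(S/I)$ is the set of associated primes of $S/I$. $\operatorname{reg}(I)=\max\{j-i:\beta_{ij}(I)\neq 0\}$ is the Castelnuovo-Mumford regularity, where $\beta_{ij}(I)$ are the graded Betti numbers of $I$. $\deg(I)$ is the maximal degree of a minimal monomial generator of $I$. $I_{\geq e}$ is the ideal generated by the monomials of degree $\geq e$ belonging to $I$. For a monomial $u\neq 1$, $m(u)$ is the largest index $i$ with $x_i\mid u$. A monomial ideal $L$ is stable if for every monomial $u\in L$ (with $u\neq 1$) and every $j<m(u)$ one has $x_ju/x_{m(u)}\in L$.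
   Formalization: I is taken nonzero, and for Ass(S/I) totally ordered the conclusion holds only after a suitable renumbering of the variables, with I_{≥e} replaced by that of the renumbered ideal; as stated it fails for I=(x_2) in K[x_1,x_2], where no I_{≥e} is stable. *)

theory Defs
  imports
    "HOL-Library.Poly_Mapping"
    "HOL-Library.Cardinality"
    "Jordan_Normal_Form.Matrix"
begin

text \<open>
  Polynomials over a field \<open>'k\<close> whose variables are indexed by the finite linear order \<open>'n\<close>.
  An index type with \<open>n\<close> elements models \<open>K[x_1, ..., x_n]\<close>, the order of the variables being
  the order of \<open>'n\<close>; multiplication is the convolution product of \<open>Poly_Mapping\<close>.
\<close>

type_synonym ('n, 'k) mpoly = "('n \<Rightarrow>\<^sub>0 nat) \<Rightarrow>\<^sub>0 'k"

global_interpretation idl: Modules.module "(*) :: 'a::comm_ring_1 \<Rightarrow> 'a \<Rightarrow> 'a"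
  by unfold_locales (simp_all add: algebra_simps)

text \<open>
  Now \<open>idl.subspace I\<close> says that \<open>I\<close> is an ideal of the ring \<open>'a\<close>, and \<open>idl.span B\<close> is the
  ideal generated by \<open>B\<close>.
\<close>

subsection \<open>Monomials and monomial ideals\<close>

definition mon :: "('n \<Rightarrow>\<^sub>0 nat) \<Rightarrow> ('n, 'k::field) mpoly" where
  "mon u = Poly_Mapping.single u 1"

definition X :: "'n \<Rightarrow> ('n, 'k::field) mpoly" where
  "X i = mon (Poly_Mapping.single i 1)"

definition mdeg :: "('n \<Rightarrow>\<^sub>0 nat) \<Rightarrow> nat" where
  "mdeg u = (\<Sum>i\<in>Poly_Mapping.keys u. Poly_Mapping.lookup u i)"

definition homogeneous :: "int \<Rightarrow> ('n, 'k::field) mpoly \<Rightarrow> bool" where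
  "homogeneous t p \<longleftrightarrow> (\<forall>u\<in>Poly_Mapping.keys p. int (mdeg u) = t)"

definition monomial_ideal :: "('n, 'k::field) mpoly set \<Rightarrow> bool" where
  "monomial_ideal I \<longleftrightarrow> (\<exists>G. I = idl.span (mon ` G))"

definition min_generators :: "('n, 'k::field) mpoly set \<Rightarrow> ('n \<Rightarrow>\<^sub>0 nat) set" where
  "min_generators I =
    (THE G. I = idl.span (mon ` G) \<and> (\<forall>G'. G' \<subset> G \<longrightarrow> I \<noteq> idl.span (mon ` G')))"

definition max_gen_degree :: "('n, 'k::field) mpoly set \<Rightarrow> nat" where
  "max_gen_degree I = Max (mdeg ` min_generators I)"

definition truncation :: "('n, 'k::field) mpoly set \<Rightarrow> nat \<Rightarrow> ('n, 'k) mpoly set" where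
  "truncation I e = idl.span (mon ` {u. mon u \<in> I \<and> e \<le> mdeg u})"

definition max_var :: "('n::linorder \<Rightarrow>\<^sub>0 nat) \<Rightarrow> 'n" where
  "max_var u = Max (Poly_Mapping.keys u)"

definition stable_ideal :: "('n::linorder, 'k::field) mpoly set \<Rightarrow> bool" where
  "stable_ideal L \<longleftrightarrow> monomial_ideal L \<and>
    (\<forall>u j. mon u \<in> L \<longrightarrow> u \<noteq> 0 \<longrightarrow> j < max_var u \<longrightarrow>
       mon (Poly_Mapping.single j 1 + (u - Poly_Mapping.single (max_var u) 1)) \<in> L)"

subsection \<open>Ideals of Borel type\<close>

fun ideal_power :: "'a::comm_ring_1 set \<Rightarrow> nat \<Rightarrow> 'a set" where
  "ideal_power J 0 = UNIV"
| "ideal_power J (Suc k) = idl.span {a * b | a b. a \<in> J \<and> b \<in> ideal_power J k}"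

definition colon :: "'a::comm_ring_1 set \<Rightarrow> 'a set \<Rightarrow> 'a set" where
  "colon I J = {f. \<forall>g\<in>J. f * g \<in> I}"

definition saturation :: "'a::comm_ring_1 set \<Rightarrow> 'a set \<Rightarrow> 'a set" where
  "saturation I J = (\<Union>k. colon I (ideal_power J k))"

definition borel_type :: "('n::linorder, 'k::field) mpoly set \<Rightarrow> bool" where
  "borel_type I \<longleftrightarrow> monomial_ideal I \<and>
    (\<forall>j. saturation I (idl.span {X j}) = saturation I (idl.span (X ` {..j})))"

subsection \<open>Associated primes\<close>

definition prime_ideal :: "'a::comm_ring_1 set \<Rightarrow> bool" where
  "prime_ideal P \<longleftrightarrow> idl.subspace P \<and> P \<noteq> UNIV \<and> (\<forall>a b. a * b \<in> P \<longrightarrow> a \<in> P \<or> b \<in> P)"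

text \<open>The annihilator of the class of \<open>f\<close> in \<open>S/I\<close> is \<open>{g. g * f \<in> I}\<close>.\<close>

definition associated_primes :: "'a::comm_ring_1 set \<Rightarrow> 'a set set" where
  "associated_primes I = {P. prime_ideal P \<and> (\<exists>f. P = {g. g * f \<in> I})}"

subsection \<open>Graded Betti numbers and regularity\<close>

text \<open>
  A minimal graded free resolution \<open>\<dots> \<rightarrow> F_1 \<rightarrow> F_0 \<rightarrow> I \<rightarrow> 0\<close> is given by matrices \<open>\<phi> i\<close> and
  degrees \<open>d i c\<close>. Here \<open>F_i\<close> is free of rank \<open>dim_col (\<phi> i)\<close> and its basis vector number \<open>c\<close> has
  degree \<open>d i c\<close>; \<open>\<phi> 0\<close> is the one-row matrix of the augmentation \<open>F_0 \<rightarrow> I \<subseteq> S\<close>, and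
  \<open>\<phi> (Suc i)\<close> is the matrix of \<open>F_{i+1} \<rightarrow> F_i\<close>. The homogeneity conditions say that all these
  maps have degree 0.
\<close>

definition mat_image :: "'a::comm_ring_1 mat \<Rightarrow> 'a vec set" where
  "mat_image A = {A *\<^sub>v v | v. v \<in> carrier_vec (dim_col A)}"

definition mat_ker :: "'a::comm_ring_1 mat \<Rightarrow> 'a vec set" where
  "mat_ker A = {v \<in> carrier_vec (dim_col A). A *\<^sub>v v = 0\<^sub>v (dim_row A)}"

definition minimal_graded_free_resolution ::
    "('n, 'k::field) mpoly set \<Rightarrow> (nat \<Rightarrow> ('n, 'k) mpoly mat) \<Rightarrow> (nat \<Rightarrow> nat \<Rightarrow> int) \<Rightarrow> bool" where
  "minimal_graded_free_resolution I \<phi> d \<longleftrightarrow>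
     dim_row (\<phi> 0) = 1 \<and>
     (\<forall>i. dim_row (\<phi> (Suc i)) = dim_col (\<phi> i)) \<and>
     (\<forall>c < dim_col (\<phi> 0). homogeneous (d 0 c) (\<phi> 0 $$ (0, c))) \<and>
     (\<forall>i. \<forall>r < dim_row (\<phi> (Suc i)). \<forall>c < dim_col (\<phi> (Suc i)).
        homogeneous (d (Suc i) c - d i r) (\<phi> (Suc i) $$ (r, c))) \<and>
     (\<lambda>v. v $ 0) ` mat_image (\<phi> 0) = I \<and>
     (\<forall>i. mat_image (\<phi> (Suc i)) = mat_ker (\<phi> i)) \<and>
     (\<forall>i. \<forall>r < dim_row (\<phi> (Suc i)). \<forall>c < dim_col (\<phi> (Suc i)).
        \<phi> (Suc i) $$ (r, c) \<in> idl.span (range X))"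

text \<open>
  Minimal graded free resolutions are unique up to isomorphism, so the choice made here is
  immaterial.
\<close>

definition betti :: "('n, 'k::field) mpoly set \<Rightarrow> nat \<Rightarrow> int \<Rightarrow> nat" where
  "betti I i j =
    (let (\<phi>, d) = (SOME (\<phi>, d). minimal_graded_free_resolution I \<phi> d)
     in card {c. c < dim_col (\<phi> i) \<and> d i c = j})"

definition regularity :: "('n, 'k::field) mpoly set \<Rightarrow> int" where
  "regularity I = Max {j - int i | i j. betti I i j \<noteq> 0}"

subsection \<open>Renumbering the variables\<close>

text \<open>
  An ideal whose associated primes form a chain is of Borel type only after a suitable renumbering
  of the variables, and stability depends on their order: for the ideal \<open>(y)\<close> of \<open>K[x, y]\<close> with
  \<open>x < y\<close> no truncation is stable. A renumbering \<open>\<sigma>\<close> acts by \<open>X i \<mapsto> X (\<sigma> i)\<close>.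
\<close>

definition rename_vars :: "('n \<Rightarrow> 'n) \<Rightarrow> ('n, 'k::field) mpoly \<Rightarrow> ('n, 'k) mpoly" where
  "rename_vars \<sigma> p = Poly_Mapping.map_key (Poly_Mapping.map_key \<sigma>) p"

lemma rename_vars_X:
  assumes "bij \<sigma>"
  shows "rename_vars \<sigma> (X i :: ('n, 'k::field) mpoly) = X (\<sigma> i)"
proof -
  have inj: "inj \<sigma>" and surj: "surj \<sigma>"
    using assms by (auto simp: bij_def)
  have "inj (Poly_Mapping.map_key \<sigma> :: ('n \<Rightarrow>\<^sub>0 nat) \<Rightarrow> _)"
  proof (rule injI)
    fix u v :: "'n \<Rightarrow>\<^sub>0 nat"
    assume "Poly_Mapping.map_key \<sigma> u = Poly_Mapping.map_key \<sigma> v"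
    then have "Poly_Mapping.lookup u (\<sigma> k) = Poly_Mapping.lookup v (\<sigma> k)" for k
      using inj by (metis map_key.rep_eq comp_apply)
    then show "u = v"
      using surj by (metis poly_mapping_eqI surjD)
  qed
  moreover have "Poly_Mapping.single i 1 =
      Poly_Mapping.map_key \<sigma> (Poly_Mapping.single (\<sigma> i) (1 :: nat))"
    using inj by (simp add: map_key_single)
  ultimately show ?thesis
    unfolding rename_vars_def X_def mon_def by (simp only: map_key_single)
qed

end

theory Submission
  imports Defs "HOL-Library.Function_Algebras"
begin

text \<open>
  Why the theorem holds. Write \<open>A\<close> for the set of exponents of the monomials in \<open>I\<close>, and let \<open>e\<close> be
  at least the degree of every minimal generator.

  The first point is purely combinatorial (\<open>stable_truncation_iff\<close>): the truncation of \<open>I\<close> at \<open>e\<close>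
  is stable iff \<open>I\<close> satisfies a criterion in the style of Bayer and Stillman, namely: if a monomial
  \<open>w\<close> of degree at least \<open>e\<close> involves only variables up to \<open>x_i\<close> and \<open>x_i w\<close> is in \<open>I\<close>, then \<open>w\<close>
  is in \<open>I\<close>.

  The second point is that Betti numbers are read off the Koszul homology of the variables with
  coefficients in \<open>I\<close>: the number \<open>betti I p t\<close> is nonzero iff \<open>H_p(x; I)\<close> is nonzero in degree \<open>t\<close>
  (\<open>betti_nonzero_iff\<close>). The Koszul complex of a free module is exact in positive homological
  degree, so an exact sequence \<open>0 \<rightarrow> Z \<rightarrow> F \<rightarrow> N \<rightarrow> 0\<close> with \<open>Z\<close> inside the irrelevant maximal ideal
  times \<open>F\<close> identifies \<open>H_{p+1}(x; N)\<close> with \<open>H_p(x; Z)\<close> (\<open>koszul_exact_shift\<close>), and \<open>H_0(x; N)\<close>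
  sees the degrees of the minimal generators (\<open>koszul_exact_0_iff_degree\<close>). Going along a minimal
  resolution reduces \<open>H_p\<close> of \<open>I\<close> to \<open>H_0\<close> of a syzygy module. Running the same shift forwards
  also produces the resolution: a bound on the degrees of the Koszul homology of \<open>I\<close> passes to
  the syzygies, and forces them to be finitely generated
  (\<open>minimal_graded_free_resolution_exists\<close>).

  Koszul homology of a monomial ideal splits over the exponents \<open>a\<close>, the part at \<open>a\<close> being the
  chain complex of the sets \<open>\<tau>\<close> of variables with \<open>x^a\<close> divided by the product of \<open>\<tau>\<close> in \<open>I\<close>.
  If the criterion holds at \<open>e\<close>, then for \<open>|a| > p + e\<close> every such \<open>\<tau>\<close> with \<open>p\<close> elements can be
  enlarged by the last variable of \<open>x^a\<close>; so the coning operator with that variable as apex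
  contracts the complex, and \<open>H_p(x; I)\<close> vanishes in degrees above \<open>p + e\<close>
  (\<open>bayer_stillman_koszul_exact\<close>). Conversely let \<open>I\<close> be of Borel type and let \<open>w\<close> violate the
  criterion at \<open>e\<close> for \<open>x_i\<close>. Some power of each of \<open>x_1, ..., x_i\<close> multiplies \<open>w\<close> into \<open>I\<close>, so
  \<open>w\<close> has a multiple \<open>v\<close> of maximal degree in these variables that is not in \<open>I\<close>. At the exponent
  of \<open>v x_1 ... x_i\<close> the complex is the boundary of a simplex, which yields a class in \<open>H_{i-1}\<close>
  of degree \<open>|v| + i > (i - 1) + e\<close> (\<open>not_bayer_stillman_not_koszul_exact\<close>). Hence the least
  admissible \<open>e\<close> is the regularity (\<open>regularity_bayer_stillman\<close>).

  If the associated primes form a chain, then the saturations \<open>(I : x_i^\<infinity>)\<close> are totally ordered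
  by inclusion: two incomparable ones give two associated primes, each containing exactly one
  of the two variables (\<open>associated_prime_separating\<close>). Sorting the variables accordingly makes
  the ideal of Borel type. For this reason the criterion and the Koszul argument are stated for the
  order of the variables given by an arbitrary renumbering \<open>\<sigma>\<close>.
\<close>

text \<open>This rule reassociates products and would clash with \<open>ac_simps\<close>.\<close>

declare idl.scale_scale [simp del]

section \<open>Exponents and monomial ideals\<close>

abbreviation lookup :: "('a \<Rightarrow>\<^sub>0 'b::zero) \<Rightarrow> 'a \<Rightarrow> 'b" where
  "lookup \<equiv> Poly_Mapping.lookup"

abbreviation keys :: "('a \<Rightarrow>\<^sub>0 'b::zero) \<Rightarrow> 'a set" where
  "keys \<equiv> Poly_Mapping.keys"

abbreviation single :: "'a \<Rightarrow> 'b \<Rightarrow> ('a \<Rightarrow>\<^sub>0 'b::zero)" where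
  "single \<equiv> Poly_Mapping.single"

text \<open>
  Divisibility of monomials, as a relation on exponents. The order \<open>\<le>\<close> of the library on finitely
  supported functions is lexicographic and not this one.
\<close>

definition exp_dvd :: "('n \<Rightarrow>\<^sub>0 nat) \<Rightarrow> ('n \<Rightarrow>\<^sub>0 nat) \<Rightarrow> bool" (infix \<open>\<preceq>\<close> 50) where
  "u \<preceq> v \<longleftrightarrow> (\<forall>i. lookup u i \<le> lookup v i)"

lemma exp_dvd_refl [simp]: "u \<preceq> u"
  by (simp add: exp_dvd_def)

lemma exp_dvd_trans: "u \<preceq> v \<Longrightarrow> v \<preceq> w \<Longrightarrow> u \<preceq> w"
  unfolding exp_dvd_def using order_trans by blast

lemma exp_dvd_add [simp]: "u \<preceq> u + v" "u \<preceq> v + u"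
  by (simp_all add: exp_dvd_def lookup_add)

lemma exp_dvd_add_diff:
  assumes "u \<preceq> v"
  shows "u + (v - u) = v" "(v - u) + u = v"
  using assms by (auto simp: exp_dvd_def lookup_add lookup_minus intro!: poly_mapping_eqI)

lemma single_exp_dvd_iff [simp]: "single i (Suc 0) \<preceq> u \<longleftrightarrow> i \<in> keys u"
  by (auto simp: exp_dvd_def lookup_single when_def in_keys_iff)

lemma mdeg_conv_sum: "mdeg u = (\<Sum>i\<in>UNIV. lookup u i)" for u :: "'n::finite \<Rightarrow>\<^sub>0 nat"
  unfolding mdeg_def by (rule sum.mono_neutral_left) (auto simp: in_keys_iff)

lemma mdeg_zero [simp]: "mdeg 0 = 0"
  by (simp add: mdeg_def)

lemma mdeg_add: "mdeg (u + v) = mdeg u + mdeg v" for u :: "'n::finite \<Rightarrow>\<^sub>0 nat"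
  by (simp add: mdeg_conv_sum lookup_add sum.distrib)

lemma mdeg_single [simp]: "mdeg (single i k) = k" for i :: "'n::finite"
  by (simp add: mdeg_conv_sum lookup_single when_def)

lemma mdeg_eq_0_iff [simp]: "mdeg u = 0 \<longleftrightarrow> u = 0" for u :: "'n::finite \<Rightarrow>\<^sub>0 nat"
  by (auto simp: mdeg_conv_sum intro!: poly_mapping_eqI)

lemma mdeg_mono: "u \<preceq> v \<Longrightarrow> mdeg u \<le> mdeg v" for u :: "'n::finite \<Rightarrow>\<^sub>0 nat"
  unfolding mdeg_conv_sum exp_dvd_def by (intro sum_mono) auto

lemma exp_dvd_mdeg_eq: "u \<preceq> v \<Longrightarrow> mdeg v \<le> mdeg u \<Longrightarrow> u = v" for u :: "'n::finite \<Rightarrow>\<^sub>0 nat"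
proof -
  assume uv: "u \<preceq> v" and "mdeg v \<le> mdeg u"
  moreover have "mdeg u + mdeg (v - u) = mdeg v"
    using exp_dvd_add_diff(1)[OF uv] mdeg_add by metis
  ultimately have "mdeg (v - u) = 0" by linarith
  then have "v - u = 0" by simp
  then show "u = v" using exp_dvd_add_diff(1)[OF uv] by simp
qed

lemma mdeg_Suc_diff_single:
  fixes u :: "'n::finite \<Rightarrow>\<^sub>0 nat"
  assumes "i \<in> keys u"
  shows "mdeg u = Suc (mdeg (u - single i 1))"
  using exp_dvd_add_diff(1)[of "single i 1" u] assms mdeg_add[of "single i 1" "u - single i 1"]
  by simp

lemma finite_mdeg_le: "finite {u :: 'n::finite \<Rightarrow>\<^sub>0 nat. mdeg u \<le> d}"
proof -
  have "lookup u i \<le> d" if "mdeg u \<le> d" for u :: "'n \<Rightarrow>\<^sub>0 nat" and i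
    using member_le_sum[of i UNIV "lookup u"] that by (simp add: mdeg_conv_sum)
  then have "lookup ` {u :: 'n \<Rightarrow>\<^sub>0 nat. mdeg u \<le> d} \<subseteq> (UNIV \<rightarrow>\<^sub>E {..d})"
    by auto
  moreover have "finite ((UNIV :: 'n set) \<rightarrow>\<^sub>E {..d})"
    by (intro finite_PiE) auto
  ultimately have "finite (lookup ` {u :: 'n \<Rightarrow>\<^sub>0 nat. mdeg u \<le> d})"
    by (rule finite_subset)
  then show ?thesis
    by (rule finite_imageD) (auto intro!: inj_onI poly_mapping_eqI)
qed

text \<open>
  The exponent of the squarefree monomial with support \<open>\<tau>\<close>.
\<close>

definition ind :: "'n::finite set \<Rightarrow> ('n \<Rightarrow>\<^sub>0 nat)" where
  "ind \<tau> = (\<Sum>i\<in>\<tau>. single i 1)"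

lemma lookup_ind: "lookup (ind \<tau>) i = (if i \<in> \<tau> then 1 else 0)"
  by (simp add: ind_def lookup_sum lookup_single when_def)

lemma keys_ind [simp]: "keys (ind \<tau>) = \<tau>"
  by (auto simp: in_keys_iff lookup_ind split: if_splits)

lemma mdeg_ind [simp]: "mdeg (ind \<tau>) = card \<tau>"
  by (simp add: mdeg_conv_sum lookup_ind sum.If_cases)

lemma ind_empty [simp]: "ind {} = 0"
  by (simp add: ind_def)

lemma ind_insert: "i \<notin> \<tau> \<Longrightarrow> ind (insert i \<tau>) = single i 1 + ind \<tau>"
  by (simp add: ind_def)

lemma ind_exp_dvd_iff: "ind \<tau> \<preceq> u \<longleftrightarrow> \<tau> \<subseteq> keys u"
  by (auto simp: exp_dvd_def lookup_ind in_keys_iff Suc_le_eq subset_eq)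

lemma lookup_single_times:
  fixes p :: "('n, 'k::field) mpoly"
  shows "lookup (single w c * p) u = (if w \<preceq> u then c * lookup p (u - w) else 0)"
proof -
  have "lookup (single w c * p) u = c * (\<Sum>q. lookup p q when u = w + q)"
    by (simp add: lookup_mult lookup_single when_mult Sum_any_when_equal)
  also have "\<dots> = (if w \<preceq> u then c * lookup p (u - w) else 0)"
  proof (cases "w \<preceq> u")
    case True
    then have "u = w + q \<longleftrightarrow> q = u - w" for q
      using exp_dvd_add_diff(1) by (metis add_diff_cancel_left')
    then show ?thesis using True by (simp add: Sum_any_when_equal)
  next
    case False
    then have "u \<noteq> w + q" for q by auto
    then show ?thesis using False by simp
  qed
  finally show ?thesis .
qed

lemma mpoly_eq_sum_single: "p = (\<Sum>u\<in>keys p. single u (lookup p u))" for p :: "'a \<Rightarrow>\<^sub>0 'b::comm_monoid_add"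
proof (rule poly_mapping_eqI)
  fix u
  have "lookup (\<Sum>u\<in>keys p. single u (lookup p u)) u = (\<Sum>v\<in>keys p. if v = u then lookup p v else 0)"
    by (simp add: lookup_sum lookup_single when_def)
  also have "\<dots> = lookup p u"
    by (auto simp: in_keys_iff)
  finally show "lookup p u = lookup (\<Sum>u\<in>keys p. single u (lookup p u)) u" by simp
qed

text \<open>
  A polynomial lies in the ideal generated by the monomials with exponents in \<open>G\<close> iff each of its
  monomials is divisible by one of them.
\<close>

lemma span_mon_conv:
  "idl.span (mon ` G :: ('n, 'k::field) mpoly set) = {p. \<forall>u\<in>keys p. \<exists>g\<in>G. g \<preceq> u}"
  (is "_ = ?R")
proof
  have "idl.subspace ?R"
  proof (rule idl.subspaceI)
    fix c p :: "('n, 'k) mpoly"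
    assume p: "p \<in> ?R"
    show "c * p \<in> ?R"
    proof safe
      fix u assume "u \<in> keys (c * p)"
      then obtain a b where "u = a + b" "b \<in> keys p"
        using keys_mult[of c p] by auto
      then show "\<exists>g\<in>G. g \<preceq> u"
        using p exp_dvd_trans exp_dvd_add(2) by (smt (verit) mem_Collect_eq)
    qed
  next
    fix p q :: "('n, 'k) mpoly"
    assume "p \<in> ?R" "q \<in> ?R"
    then show "p + q \<in> ?R" using keys_add[of p q] by blast
  qed auto
  moreover have "mon ` G \<subseteq> ?R"
    by (auto simp: mon_def intro: exp_dvd_refl)
  ultimately show "idl.span (mon ` G) \<subseteq> ?R"
    by (rule idl.span_minimal[rotated])
next
  show "?R \<subseteq> idl.span (mon ` G)"
  proof
    fix p :: "('n, 'k) mpoly" assume p: "p \<in> ?R"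
    have "single u (lookup p u) \<in> idl.span (mon ` G)" if u: "u \<in> keys p" for u
    proof -
      obtain g where g: "g \<in> G" "g \<preceq> u" using p u by auto
      have "single u (lookup p u) = single (u - g) (lookup p u) * mon g"
        using exp_dvd_add_diff[OF g(2)] by (simp add: mon_def mult_single)
      then show ?thesis
        using g(1) by (metis idl.span_base idl.span_scale imageI)
    qed
    then show "p \<in> idl.span (mon ` G)"
      by (subst mpoly_eq_sum_single) (rule idl.span_sum)
  qed
qed

lemma mon_in_span_mon_iff: "mon u \<in> idl.span (mon ` G :: ('n, 'k::field) mpoly set) \<longleftrightarrow> (\<exists>g\<in>G. g \<preceq> u)"
  unfolding span_mon_conv by (simp add: mon_def)

text \<open>
  The exponents of the monomials in \<open>I\<close>. For a monomial ideal they form an up-closed set, which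
  determines the ideal.
\<close>

definition exps :: "('n, 'k::field) mpoly set \<Rightarrow> ('n \<Rightarrow>\<^sub>0 nat) set" where
  "exps I = {u. mon u \<in> I}"

definition up_closed :: "('n \<Rightarrow>\<^sub>0 nat) set \<Rightarrow> bool" where
  "up_closed A \<longleftrightarrow> (\<forall>u v. u \<in> A \<longrightarrow> u \<preceq> v \<longrightarrow> v \<in> A)"

lemma up_closedD: "up_closed A \<Longrightarrow> u \<in> A \<Longrightarrow> u \<preceq> v \<Longrightarrow> v \<in> A"
  unfolding up_closed_def by blast

lemma exps_span_mon: "exps (idl.span (mon ` G :: ('n, 'k::field) mpoly set)) = {u. \<exists>g\<in>G. g \<preceq> u}"
  by (simp add: exps_def mon_in_span_mon_iff)

lemma up_closed_exps: "monomial_ideal I \<Longrightarrow> up_closed (exps I)"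
  unfolding monomial_ideal_def up_closed_def by (auto simp: exps_span_mon) (meson exp_dvd_trans)

lemma in_monomial_ideal_iff: "monomial_ideal I \<Longrightarrow> p \<in> I \<longleftrightarrow> keys p \<subseteq> exps I"
  unfolding monomial_ideal_def by (auto simp: exps_span_mon) (auto simp: span_mon_conv)

lemma span_range_X: "idl.span (range X) = {p :: ('n, 'k::field) mpoly. lookup p 0 = 0}"
proof -
  have X: "range (X :: 'n \<Rightarrow> ('n, 'k) mpoly) = mon ` range (\<lambda>i. single i 1)"
    by (auto simp: X_def)
  have "(\<exists>g\<in>range (\<lambda>i. single i 1). g \<preceq> u) \<longleftrightarrow> u \<noteq> 0" for u :: "'n \<Rightarrow>\<^sub>0 nat"
    using poly_mapping_eqI[of u 0] by (fastforce simp: in_keys_iff)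
  then show ?thesis
    unfolding X span_mon_conv by (auto simp: in_keys_iff)
qed

lemma lookup_X_times:
  fixes p :: "('n, 'k::field) mpoly"
  shows "lookup (X i * p) u = (if i \<in> keys u then lookup p (u - single i 1) else 0)"
  by (simp add: X_def mon_def lookup_single_times)

text \<open>The part of a polynomial supported on a given set of exponents.\<close>

lift_definition restr :: "('a \<Rightarrow> bool) \<Rightarrow> ('a \<Rightarrow>\<^sub>0 'b::zero) \<Rightarrow> ('a \<Rightarrow>\<^sub>0 'b)" is
  "\<lambda>P f u. if P u then f u else 0"
  by (rule finite_subset[rotated]) auto

lemma lookup_restr: "lookup (restr P p) u = (if P u then lookup p u else 0)"
  by transfer simp

lemma keys_restr: "keys (restr P p) = {u \<in> keys p. P u}"
  by (auto simp: in_keys_iff lookup_restr split: if_splits)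

section \<open>The Koszul complex of the variables\<close>

text \<open>
  The Koszul complex has one basis element \<open>e_\<tau>\<close> for each set \<open>\<tau>\<close> of variables; \<open>ksgn i \<tau>\<close> is the
  sign with which \<open>e_i\<close> is moved to its place in \<open>e_\<tau>\<close>. Membership of \<open>i\<close> in \<open>\<tau>\<close> does not matter.
\<close>

definition ksgn :: "'n::linorder \<Rightarrow> 'n set \<Rightarrow> 'a::comm_ring_1" where
  "ksgn i \<tau> = (-1) ^ card {k \<in> \<tau>. k < i}"

lemma ksgn_cases: "ksgn i \<tau> = 1 \<or> ksgn i \<tau> = -1"
  unfolding ksgn_def using minus_one_power_iff by metis

lemma ksgn_square [simp]: "ksgn i \<tau> * ksgn i \<tau> = 1"
  by (simp add: ksgn_def flip: power_add mult_2)

lemma ksgn_insert: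
  fixes \<tau> :: "'n::{finite,linorder} set"
  assumes "i \<notin> \<tau>"
  shows "ksgn m (insert i \<tau>) = (if i < m then - ksgn m \<tau> else ksgn m \<tau>)"
proof (cases "i < m")
  case True
  then have "{k \<in> insert i \<tau>. k < m} = insert i {k \<in> \<tau>. k < m}" by auto
  then show ?thesis using True assms by (simp add: ksgn_def)
next
  case False
  then have "{k \<in> insert i \<tau>. k < m} = {k \<in> \<tau>. k < m}" by auto
  then show ?thesis using False by (simp add: ksgn_def)
qed

lemma ksgn_insert_same: "ksgn m (insert m \<tau>) = ksgn m \<tau>"
  unfolding ksgn_def by (rule arg_cong[where f="\<lambda>A. (-1) ^ card A"]) auto

lemma lookup_ksgn_times: "lookup (ksgn i \<tau> * p) u = ksgn i \<tau> * lookup p u"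
  for p :: "'a::comm_monoid_add \<Rightarrow>\<^sub>0 'b::comm_ring_1"
proof -
  have "ksgn i \<tau> = (1 :: 'a \<Rightarrow>\<^sub>0 'b) \<and> ksgn i \<tau> = (1 :: 'b) \<or>
      ksgn i \<tau> = (-1 :: 'a \<Rightarrow>\<^sub>0 'b) \<and> ksgn i \<tau> = (-1 :: 'b)"
    unfolding ksgn_def by (cases "even (card {k \<in> \<tau>. k < i})") auto
  then show ?thesis by auto
qed

text \<open>
  The Koszul complex at a fixed exponent: \<open>\<gamma> \<tau>\<close> is the scalar coefficient of \<open>e_\<tau>\<close>. The map \<open>kdiff\<close> is
  the simplicial boundary and \<open>kcone m\<close> is the cone with apex \<open>m\<close>. By \<open>kdiff_kcone\<close> the cone
  is a contracting homotopy for every \<open>m\<close>, whatever the place of \<open>m\<close> in the order that fixes the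
  signs.
\<close>

definition kdiff :: "('n::{finite,linorder} set \<Rightarrow> 'a::comm_ring_1) \<Rightarrow> 'n set \<Rightarrow> 'a" where
  "kdiff \<gamma> \<sigma> = (\<Sum>i\<in>-\<sigma>. ksgn i \<sigma> * \<gamma> (insert i \<sigma>))"

definition kcone :: "'n \<Rightarrow> ('n::{finite,linorder} set \<Rightarrow> 'a::comm_ring_1) \<Rightarrow> 'n set \<Rightarrow> 'a" where
  "kcone m \<gamma> \<tau> = (if m \<in> \<tau> then ksgn m \<tau> * \<gamma> (\<tau> - {m}) else 0)"

lemma kdiff_kcone: "kdiff (kcone m \<gamma>) \<sigma> + kcone m (kdiff \<gamma>) \<sigma> = \<gamma> \<sigma>"
proof (cases "m \<in> \<sigma>")
  case False
  have "kdiff (kcone m \<gamma>) \<sigma> = (\<Sum>i\<in>-\<sigma>. if i = m then \<gamma> \<sigma> else 0)"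
    unfolding kdiff_def
  proof (rule sum.cong)
    fix i assume i: "i \<in> -\<sigma>"
    show "ksgn i \<sigma> * kcone m \<gamma> (insert i \<sigma>) = (if i = m then \<gamma> \<sigma> else 0)"
    proof (cases "i = m")
      case True
      have "ksgn m \<sigma> * (ksgn m \<sigma> * \<gamma> \<sigma>) = \<gamma> \<sigma>"
        by (simp flip: mult.assoc)
      then show ?thesis using True False by (simp add: kcone_def ksgn_insert_same)
    qed (use False in \<open>simp add: kcone_def\<close>)
  qed simp
  then show ?thesis using False by (simp add: kcone_def)
next
  case True
  define \<rho> where "\<rho> = \<sigma> - {m}"
  have \<sigma>: "\<sigma> = insert m \<rho>" "m \<notin> \<rho>" using True by (auto simp: \<rho>_def)
  have "kdiff (kcone m \<gamma>) \<sigma> = (\<Sum>i\<in>-\<sigma>. - (ksgn m \<sigma> * (ksgn i \<rho> * \<gamma> (insert i \<rho>))))"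
    unfolding kdiff_def
  proof (rule sum.cong)
    fix i assume i: "i \<in> -\<sigma>"
    then have im: "i \<noteq> m" and "i \<notin> \<rho>" using \<sigma> by auto
    then have "insert i \<sigma> - {m} = insert i \<rho>" using \<sigma> by auto
    moreover have "ksgn i \<sigma> * ksgn m (insert i \<sigma>) = - (ksgn m \<sigma> * ksgn i \<rho> :: 'a)"
    proof -
      have "ksgn m (insert i \<sigma>) = (if i < m then - ksgn m \<sigma> else ksgn m \<sigma> :: 'a)"
        using i by (intro ksgn_insert) auto
      moreover have "ksgn i \<sigma> = (if m < i then - ksgn i \<rho> else ksgn i \<rho> :: 'a)"
        unfolding \<sigma>(1) using \<sigma>(2) by (rule ksgn_insert)
      ultimately show ?thesis using im by auto
    qed
    ultimately show "ksgn i \<sigma> * kcone m \<gamma> (insert i \<sigma>) = - (ksgn m \<sigma> * (ksgn i \<rho> * \<gamma> (insert i \<rho>)))"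
      using True by (simp add: kcone_def flip: mult.assoc)
  qed simp
  moreover have "kcone m (kdiff \<gamma>) \<sigma> = \<gamma> \<sigma> + (\<Sum>i\<in>-\<sigma>. ksgn m \<sigma> * (ksgn i \<rho> * \<gamma> (insert i \<rho>)))"
  proof -
    have "-\<rho> = insert m (-\<sigma>)" "m \<notin> -\<sigma>" using \<sigma> by auto
    then have "kdiff \<gamma> \<rho> = ksgn m \<rho> * \<gamma> (insert m \<rho>) + (\<Sum>i\<in>-\<sigma>. ksgn i \<rho> * \<gamma> (insert i \<rho>))"
      unfolding kdiff_def by simp
    then have "kcone m (kdiff \<gamma>) \<sigma> = ksgn m \<sigma> * (ksgn m \<rho> * \<gamma> \<sigma> + (\<Sum>i\<in>-\<sigma>. ksgn i \<rho> * \<gamma> (insert i \<rho>)))"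
      using True unfolding kcone_def \<rho>_def[symmetric] \<sigma>(1)[symmetric] by simp
    moreover have "ksgn m \<sigma> = (ksgn m \<rho> :: 'a)"
      using \<sigma> by (simp add: ksgn_insert_same)
    ultimately show ?thesis
      by (simp only: distrib_left sum_distrib_left mult.assoc[symmetric] ksgn_square mult_1_left)
  qed
  ultimately show ?thesis by (simp add: sum_negf)
qed

text \<open>
  Cancellation in pairs; the proof does not divide by two, so that it covers all characteristics.
\<close>

lemma sum_antisymmetric_eq_0:
  fixes g :: "'n \<Rightarrow> 'n \<Rightarrow> 'a::ab_group_add"
  assumes "finite A" and "\<And>i j. i \<in> A \<Longrightarrow> j \<in> A \<Longrightarrow> i \<noteq> j \<Longrightarrow> g j i = - g i j"
  shows "(\<Sum>i\<in>A. \<Sum>j\<in>A - {i}. g i j) = 0"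
  using assms
proof (induction A rule: finite_induct)
  case (insert a A)
  have "(\<Sum>j\<in>insert a A - {i}. g i j) = g i a + (\<Sum>j\<in>A - {i}. g i j)" if "i \<in> A" for i
  proof -
    have "insert a A - {i} = insert a (A - {i})" using that insert.hyps by auto
    then show ?thesis using insert.hyps by simp
  qed
  then have "(\<Sum>i\<in>A. \<Sum>j\<in>insert a A - {i}. g i j) =
      (\<Sum>i\<in>A. g i a) + (\<Sum>i\<in>A. \<Sum>j\<in>A - {i}. g i j)"
    unfolding sum.distrib[symmetric] by (rule sum.cong[OF refl])
  also have "(\<Sum>i\<in>A. \<Sum>j\<in>A - {i}. g i j) = 0"
    using insert.IH insert.prems by blast
  also have "(\<Sum>i\<in>A. g i a) = (\<Sum>i\<in>A. - g a i)"
  proof (rule sum.cong)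
    fix i assume "i \<in> A"
    then show "g i a = - g a i" using insert.hyps insert.prems[of a i] by auto
  qed simp
  finally have "(\<Sum>i\<in>A. \<Sum>j\<in>insert a A - {i}. g i j) = - (\<Sum>j\<in>A. g a j)"
    by (simp add: sum_negf)
  then show ?case
    using insert.hyps by simp
qed simp

lemma kdiff_zero [simp]: "kdiff (\<lambda>_. 0) = (\<lambda>_. 0)"
  by (auto simp: kdiff_def)

lemma kdiff_kdiff [simp]:
  fixes \<gamma> :: "'n::{finite,linorder} set \<Rightarrow> 'a::comm_ring_1"
  shows "kdiff (kdiff \<gamma>) = (\<lambda>_. 0)"
proof
  fix \<sigma> :: "'n set"
  define g where "g i j = (ksgn i \<sigma> * ksgn j (insert i \<sigma>)) * \<gamma> (insert j (insert i \<sigma>))" for i j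
  have "kdiff (kdiff \<gamma>) \<sigma> = (\<Sum>i\<in>-\<sigma>. \<Sum>j\<in>-\<sigma> - {i}. g i j)"
    unfolding kdiff_def g_def sum_distrib_left mult.assoc
  proof (intro sum.cong refl)
    fix i
    show "- insert i \<sigma> = - \<sigma> - {i}" by auto
  qed
  also have "\<dots> = 0"
  proof (rule sum_antisymmetric_eq_0)
    fix i j assume ij: "i \<in> -\<sigma>" "j \<in> -\<sigma>" "i \<noteq> j"
    have "ksgn j (insert i \<sigma>) = (if i < j then - ksgn j \<sigma> else ksgn j \<sigma> :: 'a)"
      using ij by (intro ksgn_insert) auto
    moreover have "ksgn i (insert j \<sigma>) = (if j < i then - ksgn i \<sigma> else ksgn i \<sigma> :: 'a)"
      using ij by (intro ksgn_insert) auto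
    ultimately have "ksgn j \<sigma> * ksgn i (insert j \<sigma>) = - (ksgn i \<sigma> * ksgn j (insert i \<sigma>) :: 'a)"
      using ij(3) by (cases "i < j") (simp_all add: not_less mult.commute[of "ksgn i \<sigma>"])
    then show "g j i = - g i j"
      unfolding g_def insert_commute[of i j \<sigma>] by (metis minus_mult_left)
  qed simp
  finally show "kdiff (kdiff \<gamma>) \<sigma> = 0" .
qed

text \<open>
  A Koszul chain with polynomial coefficients is a function \<open>c\<close> on sets of variables, \<open>c \<tau>\<close> being the
  coefficient of \<open>e_\<tau>\<close>; \<open>bd\<close> is the Koszul differential.
\<close>

definition bd :: "('n::{finite,linorder} set \<Rightarrow> ('n, 'k::field) mpoly) \<Rightarrow> 'n set \<Rightarrow> ('n, 'k) mpoly" where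
  "bd c \<sigma> = (\<Sum>i\<in>-\<sigma>. ksgn i \<sigma> * (X i * c (insert i \<sigma>)))"

text \<open>
  The part of a chain at the exponent \<open>a\<close>, where \<open>x^u e_\<tau>\<close> has exponent \<open>u + ind \<tau>\<close>. Its
  coefficient at \<open>\<tau>\<close> is that of \<open>x^(a - ind \<tau>)\<close> in \<open>c \<tau>\<close>, provided that \<open>\<tau>\<close> is contained in the support
  of \<open>a\<close>.
\<close>

definition slice :: "('n \<Rightarrow>\<^sub>0 nat) \<Rightarrow> ('n::{finite,linorder} set \<Rightarrow> ('n, 'k::field) mpoly) \<Rightarrow> 'n set \<Rightarrow> 'k" where
  "slice a c \<tau> = (if \<tau> \<subseteq> keys a then lookup (c \<tau>) (a - ind \<tau>) else 0)"

lemma lookup_conv_slice: "lookup (c \<tau>) u = slice (u + ind \<tau>) c \<tau>"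
  by (auto simp: slice_def in_keys_iff lookup_add lookup_ind)

lemma chain_eqI:
  assumes "\<And>a. slice a c = slice a c'"
  shows "c = c'"
  by (intro ext poly_mapping_eqI) (simp add: lookup_conv_slice assms)

lemma slice_bd: "slice a (bd c) = kdiff (slice a c)"
proof
  fix \<sigma>
  show "slice a (bd c) \<sigma> = kdiff (slice a c) \<sigma>"
  proof (cases "\<sigma> \<subseteq> keys a")
    case True
    have "ksgn i \<sigma> * lookup (X i * c (insert i \<sigma>)) (a - ind \<sigma>) = ksgn i \<sigma> * slice a c (insert i \<sigma>)"
      if "i \<in> -\<sigma>" for i
    proof -
      have "i \<in> keys (a - ind \<sigma>) \<longleftrightarrow> insert i \<sigma> \<subseteq> keys a"
        using that True by (auto simp: in_keys_iff lookup_minus lookup_ind)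
      moreover have "a - ind \<sigma> - single i 1 = a - ind (insert i \<sigma>)"
        using that by (simp add: ind_insert diff_diff_add add.commute)
      ultimately show ?thesis by (simp add: lookup_X_times slice_def)
    qed
    then show ?thesis
      using True by (auto simp: slice_def[of _ _ \<sigma>] bd_def kdiff_def lookup_sum lookup_ksgn_times intro!: sum.cong)
  qed (simp add: slice_def kdiff_def)
qed

lemma slice_zero [simp]: "slice a (\<lambda>_. 0) = (\<lambda>_. 0)"
  by (auto simp: slice_def)

lemma bd_bd: "bd (bd c) = (\<lambda>_. 0)"
  by (rule chain_eqI) (simp add: slice_bd)

lemma bd_zero [simp]: "bd (\<lambda>_. 0) = (\<lambda>_. 0)"
  by (auto simp: bd_def)

lemma bd_diff: "bd (\<lambda>\<tau>. c \<tau> - c' \<tau>) = (\<lambda>\<tau>. bd c \<tau> - bd c' \<tau>)"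
  unfolding bd_def right_diff_distrib sum_subtractf ..

lemma bd_sum: "bd (\<lambda>\<tau>. \<Sum>l\<in>L. s l * c l \<tau>) = (\<lambda>\<tau>. \<Sum>l\<in>L. s l * bd (c l) \<tau>)"
proof
  fix \<tau>
  have "bd (\<lambda>\<tau>. \<Sum>l\<in>L. s l * c l \<tau>) \<tau> = (\<Sum>i\<in>-\<tau>. \<Sum>l\<in>L. s l * (ksgn i \<tau> * (X i * c l (insert i \<tau>))))"
    unfolding bd_def by (intro sum.cong) (simp_all only: sum_distrib_left mult.left_commute)
  also have "\<dots> = (\<Sum>l\<in>L. s l * bd (c l) \<tau>)"
    unfolding bd_def sum_distrib_left by (rule sum.swap)
  finally show "bd (\<lambda>\<tau>. \<Sum>l\<in>L. s l * c l \<tau>) \<tau> = (\<Sum>l\<in>L. s l * bd (c l) \<tau>)" .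
qed

text \<open>
  The operator on polynomial chains that acts on the slice at each nonzero exponent \<open>a\<close> as the cone
  with apex \<open>M a\<close>, and as zero on the slice at the exponent zero.
\<close>

definition khomot :: "(('n \<Rightarrow>\<^sub>0 nat) \<Rightarrow> 'n) \<Rightarrow> ('n::{finite,linorder} set \<Rightarrow> ('n, 'k::field) mpoly) \<Rightarrow>
    'n set \<Rightarrow> ('n, 'k) mpoly" where
  "khomot M c \<tau> = Abs_poly_mapping (\<lambda>u. if u + ind \<tau> = 0 then 0
     else kcone (M (u + ind \<tau>)) (slice (u + ind \<tau>) c) \<tau>)"

lemma khomot_support:
  assumes "kcone (M (u + ind \<tau>)) (slice (u + ind \<tau>) c) \<tau> \<noteq> 0"
  shows "M (u + ind \<tau>) \<in> \<tau>" "u + single (M (u + ind \<tau>)) 1 \<in> keys (c (\<tau> - {M (u + ind \<tau>)}))"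
proof -
  let ?m = "M (u + ind \<tau>)"
  show m: "?m \<in> \<tau>" using assms by (auto simp: kcone_def split: if_splits)
  have "u + ind \<tau> - ind (\<tau> - {m}) = u + single m 1" if "m \<in> \<tau>" for m
  proof -
    have "ind \<tau> = single m 1 + ind (\<tau> - {m})"
      using ind_insert[of m "\<tau> - {m}"] that by (simp add: insert_absorb)
    then show ?thesis by (simp flip: add.assoc)
  qed
  from this[OF m] have "u + ind \<tau> - ind (\<tau> - {?m}) = u + single ?m 1" .
  moreover have "slice (u + ind \<tau>) c (\<tau> - {?m}) \<noteq> 0"
    using assms m by (auto simp: kcone_def)
  ultimately show "u + single ?m 1 \<in> keys (c (\<tau> - {?m}))"
    by (auto simp: slice_def in_keys_iff split: if_splits)
qed

lemma lookup_khomot: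
  "lookup (khomot M c \<tau>) u = (if u + ind \<tau> = 0 then 0
     else kcone (M (u + ind \<tau>)) (slice (u + ind \<tau>) c) \<tau>)"
  unfolding khomot_def
proof (subst lookup_Abs_poly_mapping)
  let ?f = "\<lambda>u. if u + ind \<tau> = 0 then 0 else kcone (M (u + ind \<tau>)) (slice (u + ind \<tau>) c) \<tau>"
  have "{u. ?f u \<noteq> 0} \<subseteq> (\<Union>m\<in>\<tau>. (\<lambda>v. v - single m 1) ` keys (c (\<tau> - {m})))"
  proof
    fix u assume "u \<in> {u. ?f u \<noteq> 0}"
    then have "kcone (M (u + ind \<tau>)) (slice (u + ind \<tau>) c) \<tau> \<noteq> 0"
      by (auto split: if_splits)
    from khomot_support(1)[of M u \<tau> c, OF this] khomot_support(2)[of M u \<tau> c, OF this]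
    show "u \<in> (\<Union>m\<in>\<tau>. (\<lambda>v. v - single m 1) ` keys (c (\<tau> - {m})))"
      by (metis (no_types, lifting) UN_iff add_diff_cancel_right' imageI)
  qed
  then show "finite {u. ?f u \<noteq> 0}"
    by (rule finite_subset) auto
qed simp

text \<open>
  Each monomial of \<open>khomot M c\<close> comes from a monomial of \<open>c\<close> that is larger by one variable. All
  statements about degrees and about membership in an ideal are derived from this.
\<close>

lemma keys_khomotD:
  assumes "u \<in> keys (khomot M c \<tau>)"
  shows "u + ind \<tau> \<noteq> 0" "M (u + ind \<tau>) \<in> \<tau>"
    "u + single (M (u + ind \<tau>)) 1 \<in> keys (c (\<tau> - {M (u + ind \<tau>)}))"
  using assms khomot_support[of M u \<tau> c] by (auto simp: in_keys_iff lookup_khomot split: if_splits)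

text \<open>
  A cycle is a boundary as soon as it has no part at the exponent zero. In positive homological
  degree this last condition is automatic, so this contains the exactness of the Koszul complex
  of the polynomial ring.
\<close>

lemma bd_khomot:
  assumes cyc: "bd c = (\<lambda>_. 0)" and M: "\<And>a. a \<noteq> 0 \<Longrightarrow> M a \<in> keys a" and c0: "lookup (c {}) 0 = 0"
  shows "bd (khomot M c) = c"
proof (rule chain_eqI)
  fix a
  show "slice a (bd (khomot M c)) = slice a c"
  proof (cases "a = 0")
    case True
    have "slice 0 (khomot M c) = (\<lambda>_. 0)"
      by (auto simp: slice_def lookup_khomot)
    moreover have "slice 0 c = (\<lambda>_. 0)"
      using c0 by (auto simp: slice_def)
    ultimately show ?thesis using True by (simp add: slice_bd)
  next
    case False
    have "slice a (khomot M c) = kcone (M a) (slice a c)"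
    proof
      fix \<tau>
      show "slice a (khomot M c) \<tau> = kcone (M a) (slice a c) \<tau>"
      proof (cases "\<tau> \<subseteq> keys a")
        case True
        then show ?thesis
          using False exp_dvd_add_diff[of "ind \<tau>" a] by (simp add: slice_def[of a "khomot M c"] lookup_khomot ind_exp_dvd_iff)
      next
        case no: False
        then have "\<not> \<tau> - {M a} \<subseteq> keys a" using M[OF False] by auto
        then show ?thesis using no by (simp add: slice_def kcone_def)
      qed
    qed
    moreover have "kdiff (slice a c) = (\<lambda>_. 0)"
      using cyc by (simp flip: slice_bd)
    moreover have "kcone (M a) (\<lambda>_. 0) = (\<lambda>_. 0 :: 'b)"
      by (auto simp: kcone_def)
    ultimately show ?thesis
      using kdiff_kcone[of "M a" "slice a c"] by (simp add: slice_bd) auto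
  qed
qed

section \<open>Koszul homology of graded submodules of free modules\<close>

lemma sum_fun_apply: "(\<Sum>i\<in>A. f i) x = (\<Sum>i\<in>A. f i x)"
  for f :: "'i \<Rightarrow> 'a \<Rightarrow> 'b::comm_monoid_add"
  by (induction A rule: infinite_finite_induct) auto

text \<open>
  Vectors are functions on the natural numbers, with pointwise addition; \<open>free_mod r\<close> is the free
  module of rank \<open>r\<close>, consisting of the functions that vanish from \<open>r\<close> on.
\<close>

definition smul :: "'a::comm_ring_1 \<Rightarrow> (nat \<Rightarrow> 'a) \<Rightarrow> nat \<Rightarrow> 'a" where
  "smul s v = (\<lambda>k. s * v k)"

global_interpretation vecs: Modules.module "smul :: 'a::comm_ring_1 \<Rightarrow> (nat \<Rightarrow> 'a) \<Rightarrow> nat \<Rightarrow> 'a"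
  by unfold_locales (auto simp: smul_def algebra_simps)

definition free_mod :: "nat \<Rightarrow> (nat \<Rightarrow> 'a::comm_ring_1) set" where
  "free_mod r = {v. \<forall>k\<ge>r. v k = 0}"

lemma subspace_free_mod: "vecs.subspace (free_mod r)"
  by (auto simp: vecs.subspace_def free_mod_def smul_def)

subsection \<open>Homogeneous components\<close>

text \<open>
  The homogeneous component of degree \<open>t\<close>; the degree is an integer and may be negative.
\<close>

definition hcomp :: "int \<Rightarrow> ('n, 'k::field) mpoly \<Rightarrow> ('n, 'k) mpoly" where
  "hcomp t = restr (\<lambda>u. int (mdeg u) = t)"

lemma lookup_hcomp: "lookup (hcomp t p) u = (if int (mdeg u) = t then lookup p u else 0)"
  by (simp add: hcomp_def lookup_restr)

lemma homogeneous_hcomp: "homogeneous t (hcomp t p)"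
  by (simp add: homogeneous_def hcomp_def keys_restr)

lemma hcomp_homogeneous: "homogeneous t p \<Longrightarrow> hcomp t p = p"
  by (rule poly_mapping_eqI) (auto simp: homogeneous_def lookup_hcomp in_keys_iff)

lemma homogeneous_zero [simp]: "homogeneous t 0"
  by (simp add: homogeneous_def)

lemma homogeneous_add: "homogeneous t p \<Longrightarrow> homogeneous t q \<Longrightarrow> homogeneous t (p + q)"
  unfolding homogeneous_def using keys_add[of p q] by blast

lemma homogeneous_uminus: "homogeneous t p \<Longrightarrow> homogeneous t (- p)"
  by (simp add: homogeneous_def in_keys_iff)

lemma homogeneous_diff: "homogeneous t p \<Longrightarrow> homogeneous t q \<Longrightarrow> homogeneous t (p - q)"
  using homogeneous_add[of t p "- q"] homogeneous_uminus[of t q] by simp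

lemma homogeneous_sum: "(\<And>i. i \<in> A \<Longrightarrow> homogeneous t (f i)) \<Longrightarrow> homogeneous t (\<Sum>i\<in>A. f i)"
  by (induction A rule: infinite_finite_induct) (auto intro: homogeneous_add)

lemma homogeneous_mult:
  fixes p q :: "('n::finite, 'k::field) mpoly"
  assumes "homogeneous s p" "homogeneous t q"
  shows "homogeneous (s + t) (p * q)"
  unfolding homogeneous_def
proof
  fix u assume "u \<in> keys (p * q)"
  then obtain a b where "u = a + b" "a \<in> keys p" "b \<in> keys q"
    using keys_mult[of p q] by auto
  then show "int (mdeg u) = s + t"
    using assms by (auto simp: homogeneous_def mdeg_add)
qed

lemma homogeneous_single: "int (mdeg u) = t \<Longrightarrow> homogeneous t (single u c)"
  by (simp add: homogeneous_def)

lemma homogeneous_X_mult: "homogeneous t p \<Longrightarrow> homogeneous (1 + t) (X i * p)"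
  for p :: "('n::finite, 'k::field) mpoly"
  by (rule homogeneous_mult) (simp_all add: X_def mon_def homogeneous_single)

lemma homogeneous_ksgn_mult: "homogeneous t p \<Longrightarrow> homogeneous t (ksgn i \<tau> * p)"
  for p :: "('n::finite, 'k::field) mpoly"
proof -
  assume "homogeneous t p"
  moreover have "ksgn i \<tau> * p = p \<or> ksgn i \<tau> * p = - p"
  proof -
    have "ksgn i \<tau> = (1 :: ('n, 'k) mpoly) \<or> ksgn i \<tau> = (- 1 :: ('n, 'k) mpoly)"
      by (rule ksgn_cases)
    then show ?thesis by auto
  qed
  ultimately show ?thesis using homogeneous_uminus by metis
qed

lemma hcomp_add: "hcomp t (p + q) = hcomp t p + hcomp t q"
  by (rule poly_mapping_eqI) (simp add: lookup_hcomp lookup_add)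

lemma hcomp_zero [simp]: "hcomp t 0 = 0"
  by (rule poly_mapping_eqI) (simp add: lookup_hcomp)

lemma hcomp_sum: "hcomp t (\<Sum>i\<in>A. f i) = (\<Sum>i\<in>A. hcomp t (f i))"
  by (induction A rule: infinite_finite_induct) (auto simp: hcomp_add)

lemma hcomp_mult:
  fixes p q :: "('n::finite, 'k::field) mpoly"
  assumes p: "homogeneous s p"
  shows "hcomp t (p * q) = p * hcomp (t - s) q"
proof -
  have q: "q = hcomp (t - s) q + (q - hcomp (t - s) q)" by simp
  have "hcomp t (p * (q - hcomp (t - s) q)) = 0"
  proof (rule poly_mapping_eqI)
    fix u
    have "u \<notin> keys (p * (q - hcomp (t - s) q))" if "int (mdeg u) = t"
    proof
      assume "u \<in> keys (p * (q - hcomp (t - s) q))"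
      then obtain a b where "u = a + b" "a \<in> keys p" "b \<in> keys (q - hcomp (t - s) q)"
        using keys_mult[of p "q - hcomp (t - s) q"] by auto
      then show False
        using p that by (auto simp: homogeneous_def mdeg_add in_keys_iff lookup_minus lookup_hcomp)
    qed
    then show "lookup (hcomp t (p * (q - hcomp (t - s) q))) u = lookup 0 u"
      by (auto simp: lookup_hcomp in_keys_iff)
  qed
  moreover have "hcomp t (p * hcomp (t - s) q) = p * hcomp (t - s) q"
    using homogeneous_mult[OF p homogeneous_hcomp[of "t - s" q]] by (intro hcomp_homogeneous) simp
  moreover have "p * q = p * hcomp (t - s) q + p * (q - hcomp (t - s) q)"
    by (simp add: right_diff_distrib)
  ultimately show ?thesis by (metis hcomp_add add.right_neutral)
qed

text \<open>
  Homogeneous components and homogeneity of vectors, when the basis vector number \<open>k\<close> has degree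
  \<open>d k\<close>.
\<close>

definition vcomp :: "(nat \<Rightarrow> int) \<Rightarrow> int \<Rightarrow> (nat \<Rightarrow> ('n, 'k::field) mpoly) \<Rightarrow> nat \<Rightarrow> ('n, 'k) mpoly" where
  "vcomp d t v = (\<lambda>k. hcomp (t - d k) (v k))"

definition vhom :: "(nat \<Rightarrow> int) \<Rightarrow> int \<Rightarrow> (nat \<Rightarrow> ('n, 'k::field) mpoly) \<Rightarrow> bool" where
  "vhom d t v \<longleftrightarrow> (\<forall>k. homogeneous (t - d k) (v k))"

lemma vhom_vcomp: "vhom d t (vcomp d t v)"
  by (simp add: vhom_def vcomp_def homogeneous_hcomp)

lemma vcomp_vhom: "vhom d t v \<Longrightarrow> vcomp d t v = v"
  by (simp add: vhom_def vcomp_def hcomp_homogeneous)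

lemma vcomp_free_mod: "v \<in> free_mod r \<Longrightarrow> vcomp d t v \<in> free_mod r"
  by (simp add: vcomp_def free_mod_def)

subsection \<open>Linear maps given by matrices\<close>

text \<open>
  The linear map with matrix \<open>A\<close>, which has \<open>r\<close> columns and any number of rows.
\<close>

definition lin :: "(nat \<Rightarrow> nat \<Rightarrow> 'a::comm_ring_1) \<Rightarrow> nat \<Rightarrow> (nat \<Rightarrow> 'a) \<Rightarrow> nat \<Rightarrow> 'a" where
  "lin A r v = (\<lambda>k. \<Sum>l<r. A k l * v l)"

lemma lin_diff: "lin A r (\<lambda>l. v l - w l) = (\<lambda>k. lin A r v k - lin A r w k)"
  by (simp add: lin_def right_diff_distrib sum_subtractf)

lemma lin_zero [simp]: "lin A r (\<lambda>_. 0) = (\<lambda>_. 0)"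
  by (simp add: lin_def)

text \<open>
  The matrix \<open>A\<close> defines a map of degree zero from the free module with degrees \<open>d'\<close>, of rank \<open>r\<close>, to
  one with degrees \<open>d\<close>.
\<close>

definition hom_matrix :: "(nat \<Rightarrow> int) \<Rightarrow> nat \<Rightarrow> (nat \<Rightarrow> int) \<Rightarrow> (nat \<Rightarrow> nat \<Rightarrow> ('n, 'k::field) mpoly) \<Rightarrow> bool" where
  "hom_matrix d r d' A \<longleftrightarrow> (\<forall>k. \<forall>l<r. homogeneous (d' l - d k) (A k l))"

lemma vcomp_lin:
  fixes A :: "nat \<Rightarrow> nat \<Rightarrow> ('n::finite, 'k::field) mpoly"
  assumes "hom_matrix d r d' A"
  shows "vcomp d t (lin A r v) = lin A r (vcomp d' t v)"
proof
  fix k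
  have "hcomp (t - d k) (A k l * v l) = A k l * hcomp (t - d' l) (v l)" if "l < r" for l
  proof -
    have "homogeneous (d' l - d k) (A k l)" using assms that by (simp add: hom_matrix_def)
    from hcomp_mult[OF this, of "t - d k" "v l"] show ?thesis by simp
  qed
  then show "vcomp d t (lin A r v) k = lin A r (vcomp d' t v) k"
    by (simp add: vcomp_def lin_def hcomp_sum)
qed

lemma vhom_lin:
  fixes A :: "nat \<Rightarrow> nat \<Rightarrow> ('n::finite, 'k::field) mpoly"
  assumes "hom_matrix d r d' A" "vhom d' t v"
  shows "vhom d t (lin A r v)"
  using vcomp_lin[OF assms(1), of t v] assms(2) vhom_vcomp[of d t "lin A r v"] by (simp add: vcomp_vhom)

subsection \<open>Koszul chains\<close>

text \<open>
  A Koszul \<open>p\<close>-chain with coefficients in a module \<open>N\<close> of vectors: \<open>c k \<tau>\<close> is the \<open>k\<close>-th entry of the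
  coefficient of \<open>e_\<tau>\<close>.
\<close>

definition kchain :: "nat \<Rightarrow> (nat \<Rightarrow> ('n, 'k::field) mpoly) set \<Rightarrow> (nat \<Rightarrow> 'n set \<Rightarrow> ('n, 'k) mpoly) \<Rightarrow> bool" where
  "kchain p N c \<longleftrightarrow> (\<forall>\<tau>. (\<lambda>k. c k \<tau>) \<in> N) \<and> (\<forall>k \<tau>. card \<tau> \<noteq> p \<longrightarrow> c k \<tau> = 0)"

text \<open>
  The coefficients of the chain are homogeneous of degree \<open>t\<close>.
\<close>

definition khom :: "(nat \<Rightarrow> int) \<Rightarrow> int \<Rightarrow> (nat \<Rightarrow> 'n set \<Rightarrow> ('n, 'k::field) mpoly) \<Rightarrow> bool" where
  "khom d t c \<longleftrightarrow> (\<forall>\<tau>. vhom d t (\<lambda>k. c k \<tau>))"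

text \<open>
  Vanishing of the Koszul homology \<open>H_p(x; N)\<close> in degree \<open>t\<close>. Since \<open>e_\<tau>\<close> has degree \<open>p\<close>, the coefficients of
  the cycles have degree \<open>t - p\<close>. The bounding chain is not required to be homogeneous.
\<close>

definition koszul_exact :: "(nat \<Rightarrow> int) \<Rightarrow> nat \<Rightarrow> int \<Rightarrow> (nat \<Rightarrow> ('n::{finite,linorder}, 'k::field) mpoly) set \<Rightarrow> bool" where
  "koszul_exact d p t N \<longleftrightarrow> (\<forall>c. kchain p N c \<longrightarrow> khom d (t - int p) c \<longrightarrow> (\<forall>k. bd (c k) = (\<lambda>_. 0)) \<longrightarrow>
     (\<exists>b. kchain (Suc p) N b \<and> (\<forall>k. bd (b k) = c k)))"

lemma kchain_bd:
  assumes N: "vecs.subspace N" and c: "kchain (Suc p) N c"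
  shows "kchain p N (\<lambda>k. bd (c k))"
  unfolding kchain_def
proof (intro conjI allI impI)
  fix \<tau>
  have "(\<lambda>k. bd (c k) \<tau>) = (\<Sum>i\<in>-\<tau>. smul (ksgn i \<tau> * X i) (\<lambda>k. c k (insert i \<tau>)))"
    by (rule ext) (simp add: bd_def smul_def sum_fun_apply mult.assoc)
  also have "\<dots> \<in> N"
    using c by (intro vecs.subspace_sum[OF N] vecs.subspace_scale[OF N]) (simp add: kchain_def)
  finally show "(\<lambda>k. bd (c k) \<tau>) \<in> N" .
next
  fix k and \<tau> :: "'a set" assume "card \<tau> \<noteq> p"
  then show "bd (c k) \<tau> = 0"
    using c by (auto simp: bd_def kchain_def intro!: sum.neutral)
qed

lemma khom_bd: "khom d t c \<Longrightarrow> khom d (t + 1) (\<lambda>k. bd (c k))"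
  unfolding khom_def vhom_def bd_def
  by (intro allI homogeneous_sum homogeneous_ksgn_mult)
     (use homogeneous_X_mult in \<open>force simp: algebra_simps\<close>)

lemma kchain_khomot:
  fixes c :: "nat \<Rightarrow> 'n::{finite,linorder} set \<Rightarrow> ('n, 'k::field) mpoly"
  assumes "kchain p (free_mod r) c"
  shows "kchain (Suc p) (free_mod r) (\<lambda>k. khomot M (c k))"
proof -
  have "khomot M (c k) \<tau> = 0" if "\<And>m. m \<in> \<tau> \<Longrightarrow> c k (\<tau> - {m}) = 0" for k \<tau>
  proof (rule ccontr)
    assume "khomot M (c k) \<tau> \<noteq> 0"
    then obtain u where "u \<in> keys (khomot M (c k) \<tau>)"
      by (metis ex_in_conv keys_eq_empty)
    from keys_khomotD[OF this] that show False by auto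
  qed
  moreover have "card (\<tau> - {m}) \<noteq> p" if "card \<tau> \<noteq> Suc p" "m \<in> \<tau>" for \<tau> :: "'n set" and m
    using that by (metis card_Suc_Diff1 finite)
  ultimately show ?thesis
    using assms unfolding kchain_def free_mod_def by auto
qed

lemma khom_khomot:
  fixes c :: "nat \<Rightarrow> 'n::{finite,linorder} set \<Rightarrow> ('n, 'k::field) mpoly"
  assumes "khom d t c"
  shows "khom d (t - 1) (\<lambda>k. khomot M (c k))"
  unfolding khom_def vhom_def homogeneous_def
proof (intro allI ballI)
  fix \<tau> k u assume "u \<in> keys (khomot M (c k) \<tau>)"
  from keys_khomotD(3)[OF this] obtain m where "u + single m 1 \<in> keys (c k (\<tau> - {m}))" by metis
  then have "int (mdeg (u + single m 1)) = t - d k"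
    using assms unfolding khom_def vhom_def homogeneous_def by blast
  then show "int (mdeg u) = t - 1 - d k" by (simp add: mdeg_add)
qed

lemma bd_lin: "bd (\<lambda>\<tau>. lin A r (\<lambda>l. c l \<tau>) k) \<sigma> = lin A r (\<lambda>l. bd (c l) \<sigma>) k"
  unfolding lin_def by (simp add: bd_sum)

lemma kchain_diff:
  assumes "vecs.subspace N" "kchain p N c" "kchain p N c'"
  shows "kchain p N (\<lambda>k \<tau>. c k \<tau> - c' k \<tau>)"
  using assms vecs.subspace_diff[OF assms(1)] by (auto simp: kchain_def fun_diff_def)

subsection \<open>Dimension shift\<close>

text \<open>
  An exact sequence \<open>0 \<rightarrow> Z \<rightarrow> F \<rightarrow> N \<rightarrow> 0\<close> in which \<open>F\<close> is free of rank \<open>r\<close> with degrees \<open>d'\<close>, the map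
  to \<open>N\<close> is given by the matrix \<open>A\<close>, and the vectors of \<open>Z\<close> have entries without constant term.
\<close>

locale minimal_presentation =
  fixes d d' :: "nat \<Rightarrow> int" and r :: nat and A :: "nat \<Rightarrow> nat \<Rightarrow> ('n::{finite,linorder}, 'k::field) mpoly"
    and N Z :: "(nat \<Rightarrow> ('n, 'k) mpoly) set"
  assumes hom: "hom_matrix d r d' A"
    and image: "lin A r ` free_mod r = N"
    and kernel: "Z = {v \<in> free_mod r. lin A r v = (\<lambda>_. 0)}"
    and minimal: "v \<in> Z \<Longrightarrow> lookup (v l) 0 = 0"
begin

lemma subspace_kernel: "vecs.subspace Z"
proof -
  have "lin A r (\<lambda>l. v l + w l) k = lin A r v k + lin A r w k" for v w k
    by (simp add: lin_def distrib_left sum.distrib)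
  moreover have "lin A r (\<lambda>l. s * v l) k = s * lin A r v k" for s v k
    by (simp add: lin_def sum_distrib_left mult.left_commute)
  ultimately show ?thesis
    unfolding kernel vecs.subspace_def free_mod_def smul_def
    by (auto simp: plus_fun_def zero_fun_def)
qed

lemma subspace_image: "vecs.subspace N"
proof -
  have "lin A r v + lin A r w = lin A r (v + w)" for v w
    by (auto simp: lin_def distrib_left sum.distrib)
  moreover have "smul s (lin A r v) = lin A r (smul s v)" for s v
    by (auto simp: lin_def smul_def sum_distrib_left mult.left_commute)
  moreover have "0 = lin A r 0"
    by (simp add: zero_fun_def)
  ultimately show ?thesis
    unfolding image[symmetric] vecs.subspace_def
    using subspace_free_mod[of r] unfolding vecs.subspace_def by (smt (verit) imageE imageI)
qed

lemma lift_chain: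
  assumes c: "kchain p N c"
  obtains c' where "kchain p (free_mod r) c'" "khom d t c \<longrightarrow> khom d' t c'"
    "\<And>k \<tau>. lin A r (\<lambda>l. c' l \<tau>) k = c k \<tau>"
proof -
  have "\<exists>w\<in>free_mod r. (khom d t c \<longrightarrow> vhom d' t w) \<and> lin A r w = (\<lambda>k. c k \<tau>) \<and>
      (card \<tau> \<noteq> p \<longrightarrow> w = (\<lambda>_. 0))" for \<tau>
  proof (cases "card \<tau> = p")
    case True
    have "(\<lambda>k. c k \<tau>) \<in> lin A r ` free_mod r"
      using c unfolding kchain_def image by blast
    then obtain w where w: "w \<in> free_mod r" "lin A r w = (\<lambda>k. c k \<tau>)" by auto
    show ?thesis
    proof (cases "khom d t c")
      case homog: True
      have "lin A r (vcomp d' t w) = vcomp d t (\<lambda>k. c k \<tau>)"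
        using vcomp_lin[OF hom, of t w] w(2) by simp
      also have "\<dots> = (\<lambda>k. c k \<tau>)"
        using homog by (intro vcomp_vhom) (simp add: khom_def)
      finally show ?thesis
        using True w(1) vcomp_free_mod vhom_vcomp by blast
    qed (use True w in blast)
  next
    case False
    then have "(\<lambda>k. c k \<tau>) = (\<lambda>_. 0)" using c by (auto simp: kchain_def)
    then show ?thesis by (intro bexI[of _ "\<lambda>_. 0"]) (auto simp: vhom_def free_mod_def)
  qed
  then obtain w where w: "\<And>\<tau>. w \<tau> \<in> free_mod r" "\<And>\<tau>. khom d t c \<Longrightarrow> vhom d' t (w \<tau>)"
    "\<And>\<tau>. lin A r (w \<tau>) = (\<lambda>k. c k \<tau>)" "\<And>\<tau>. card \<tau> \<noteq> p \<Longrightarrow> w \<tau> = (\<lambda>_. 0)"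
    by metis
  show thesis
    by (rule that[of "\<lambda>l \<tau>. w \<tau> l"]) (use w in \<open>auto simp: kchain_def khom_def\<close>)
qed

lemma kchain_lin: "kchain p (free_mod r) c \<Longrightarrow> kchain p N (\<lambda>k \<tau>. lin A r (\<lambda>l. c l \<tau>) k)"
  unfolding kchain_def image[symmetric] by auto

abbreviation pick :: "('n \<Rightarrow>\<^sub>0 nat) \<Rightarrow> 'n" where
  "pick a \<equiv> Max (keys a)"

lemma pick: "a \<noteq> 0 \<Longrightarrow> pick a \<in> keys a"
  by simp

text \<open>
  The reason is that the connecting homomorphism from \<open>H_{p+1}(x; N)\<close> to \<open>H_p(x; Z)\<close> is bijective.
  Minimality of the presentation is used for its surjectivity when \<open>p = 0\<close>.
\<close>

theorem koszul_exact_shift: "koszul_exact d (Suc p) t N \<longleftrightarrow> koszul_exact d' p t Z"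
proof
  assume N: "koszul_exact d (Suc p) t N"
  show "koszul_exact d' p t Z"
    unfolding koszul_exact_def
  proof (intro allI impI)
    fix z assume z: "kchain p Z z" "khom d' (t - int p) z" "\<forall>k. bd (z k) = (\<lambda>_. 0)"
    \<comment> \<open>A cycle of \<open>Z\<close> bounds in \<open>F\<close>; the image of the bounding chain in \<open>N\<close> is a cycle.\<close>
    define f where "f k = khomot pick (z k)" for k
    have zf: "kchain p (free_mod r) z"
      using z(1) by (auto simp: kchain_def kernel)
    have bdf: "bd (f k) = z k" for k
      unfolding f_def
    proof (rule bd_khomot)
      have "(\<lambda>k. z k {}) \<in> Z" using z(1) by (simp add: kchain_def)
      from minimal[OF this] show "lookup (z k {}) 0 = 0" .
    qed (use z(3) pick in auto)
    have f: "kchain (Suc p) (free_mod r) f" "khom d' (t - int (Suc p)) f"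
      using kchain_khomot[OF zf, of pick] khom_khomot[OF z(2), of pick]
      by (simp_all add: f_def[abs_def] algebra_simps)
    define y where "y k \<tau> = lin A r (\<lambda>l. f l \<tau>) k" for k \<tau>
    have "kchain (Suc p) N y"
      unfolding y_def[abs_def] by (rule kchain_lin[OF f(1)])
    moreover have "khom d (t - int (Suc p)) y"
      using vhom_lin[OF hom] f(2) unfolding khom_def y_def by simp
    moreover have "bd (y k) = (\<lambda>_. 0)" for k
    proof
      fix \<tau>
      have "(\<lambda>l. z l \<tau>) \<in> Z" using z(1) by (simp add: kchain_def)
      then show "bd (y k) \<tau> = 0"
        using bd_lin[of A r f k \<tau>] by (simp add: y_def[abs_def] bdf kernel)
    qed
    ultimately obtain g where g: "kchain (Suc (Suc p)) N g" "\<And>k. bd (g k) = y k"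
      using N unfolding koszul_exact_def by blast
    obtain g' where g': "kchain (Suc (Suc p)) (free_mod r) g'" "\<And>k \<tau>. lin A r (\<lambda>l. g' l \<tau>) k = g k \<tau>"
      using lift_chain[OF g(1)] by blast
    \<comment> \<open>Correct the bounding chain by a boundary so that it comes to lie in \<open>Z\<close>.\<close>
    define h where "h k \<tau> = f k \<tau> - bd (g' k) \<tau>" for k \<tau>
    have "kchain (Suc p) (free_mod r) h"
      unfolding h_def[abs_def] using f(1) kchain_bd[OF subspace_free_mod g'(1)]
      by (intro kchain_diff subspace_free_mod)
    moreover have "lin A r (\<lambda>l. h l \<tau>) = (\<lambda>_. 0)" for \<tau>
    proof
      fix k
      have "lin A r (\<lambda>l. bd (g' l) \<tau>) k = bd (\<lambda>\<tau>. lin A r (\<lambda>l. g' l \<tau>) k) \<tau>"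
        by (simp only: bd_lin)
      also have "\<dots> = y k \<tau>"
        by (simp add: g'(2) g(2))
      finally show "lin A r (\<lambda>l. h l \<tau>) k = 0"
        by (simp add: h_def lin_diff y_def)
    qed
    ultimately have "kchain (Suc p) Z h"
      by (auto simp: kchain_def kernel)
    moreover have "bd (h k) = z k" for k
      by (simp add: h_def[abs_def] bd_diff bd_bd bdf)
    ultimately show "\<exists>b. kchain (Suc p) Z b \<and> (\<forall>k. bd (b k) = z k)" by blast
  qed
next
  assume Z: "koszul_exact d' p t Z"
  show "koszul_exact d (Suc p) t N"
    unfolding koszul_exact_def
  proof (intro allI impI)
    fix c assume c: "kchain (Suc p) N c" "khom d (t - int (Suc p)) c" "\<forall>k. bd (c k) = (\<lambda>_. 0)"
    obtain c' where c': "kchain (Suc p) (free_mod r) c'" "khom d' (t - int (Suc p)) c'"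
      "\<And>k \<tau>. lin A r (\<lambda>l. c' l \<tau>) k = c k \<tau>"
      using lift_chain[OF c(1)] c(2) by blast
    have "kchain p (free_mod r) (\<lambda>k. bd (c' k))"
      by (rule kchain_bd[OF subspace_free_mod c'(1)])
    moreover have "lin A r (\<lambda>l. bd (c' l) \<tau>) = (\<lambda>_. 0)" for \<tau>
    proof
      fix k
      have "lin A r (\<lambda>l. bd (c' l) \<tau>) k = bd (\<lambda>\<tau>. lin A r (\<lambda>l. c' l \<tau>) k) \<tau>"
        by (simp only: bd_lin)
      then show "lin A r (\<lambda>l. bd (c' l) \<tau>) k = 0"
        using c(3) by (simp add: c'(3))
    qed
    ultimately have "kchain p Z (\<lambda>k. bd (c' k))"
      by (auto simp: kchain_def kernel)
    moreover have "khom d' (t - int p) (\<lambda>k. bd (c' k))"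
      using khom_bd[OF c'(2)] by (simp add: algebra_simps)
    ultimately obtain b where b: "kchain (Suc p) Z b" "\<And>k. bd (b k) = bd (c' k)"
      using Z unfolding koszul_exact_def by (metis bd_bd)
    \<comment> \<open>The corrected lift is a cycle of \<open>F\<close>, hence a boundary, and still maps to \<open>c\<close>.\<close>
    define f where "f k \<tau> = c' k \<tau> - b k \<tau>" for k \<tau>
    have "kchain (Suc p) (free_mod r) b"
      using b(1) by (auto simp: kchain_def kernel)
    then have f: "kchain (Suc p) (free_mod r) f"
      unfolding f_def[abs_def] using c'(1) by (intro kchain_diff subspace_free_mod)
    define g where "g k = khomot pick (f k)" for k
    have g: "kchain (Suc (Suc p)) (free_mod r) g"
      unfolding g_def[abs_def] by (rule kchain_khomot[OF f])
    have bdg: "bd (g k) = f k" for k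
      unfolding g_def
    proof (rule bd_khomot)
      show "lookup (f k {}) 0 = 0" using f by (simp add: kchain_def)
      show "bd (f k) = (\<lambda>_. 0)" by (simp add: f_def[abs_def] bd_diff b(2))
    qed (rule pick)
    have "bd (\<lambda>\<tau>. lin A r (\<lambda>l. g l \<tau>) k) \<tau> = c k \<tau>" for k \<tau>
    proof -
      have "(\<lambda>l. b l \<tau>) \<in> Z" using b(1) by (simp add: kchain_def)
      then show ?thesis
        by (simp add: bd_lin bdg f_def lin_diff c'(3) kernel)
    qed
    then show "\<exists>b. kchain (Suc (Suc p)) N b \<and> (\<forall>k. bd (b k) = c k)"
      using kchain_lin[OF g] by blast
  qed
qed

end

section \<open>Betti numbers and Koszul homology\<close>

lemma X_eq_iff: "(X i :: ('n, 'k::field) mpoly) = X j \<longleftrightarrow> i = j"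
proof
  assume "(X i :: ('n, 'k) mpoly) = X j"
  then have "keys (X i :: ('n, 'k) mpoly) = keys (X j :: ('n, 'k) mpoly)" by simp
  then have "single i (1 :: nat) = single j 1" by (simp add: X_def mon_def)
  then have "keys (single i (1 :: nat)) = keys (single j (1 :: nat))" by simp
  then show "i = j" by simp
qed simp

lemma lookup_0_eq_0_decomp:
  fixes p :: "('n::finite, 'k::field) mpoly"
  assumes "lookup p 0 = 0"
  obtains q where "p = (\<Sum>i\<in>UNIV. X i * q i)"
proof -
  have "p \<in> idl.span (range X)" using assms by (simp add: span_range_X)
  then obtain f where "p = (\<Sum>x\<in>range X. f x * x)"
    by (auto simp: idl.span_finite)
  also have "\<dots> = (\<Sum>i\<in>UNIV. f (X i) * X i)"
    by (subst sum.reindex) (auto simp: inj_on_def X_eq_iff)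
  finally show thesis
    by (intro that[of "\<lambda>i. f (X i)"]) (simp add: mult.commute)
qed

lemma lookup_0_sum_X: "lookup (\<Sum>i\<in>L. X i * q i) 0 = 0" for q :: "'n \<Rightarrow> ('n, 'k::field) mpoly"
  by (simp add: lookup_sum lookup_X_times)

lemma lookup_0_homogeneous: "homogeneous t p \<Longrightarrow> t \<noteq> 0 \<Longrightarrow> lookup p 0 = 0"
  by (force simp: homogeneous_def in_keys_iff)

text \<open>
  \<open>H_0(x; N)\<close> vanishes in degree \<open>t\<close> iff every homogeneous element of \<open>N\<close> of degree \<open>t\<close> is a
  combination of elements of \<open>N\<close> with the variables as coefficients.
\<close>

lemma koszul_exact_0_iff:
  fixes N :: "(nat \<Rightarrow> ('n::{finite,linorder}, 'k::field) mpoly) set"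
  assumes N: "vecs.subspace N"
  shows "koszul_exact d 0 t N \<longleftrightarrow>
    (\<forall>v\<in>N. vhom d t v \<longrightarrow> (\<exists>w. (\<forall>i. w i \<in> N) \<and> v = (\<lambda>k. \<Sum>i\<in>UNIV. X i * w i k)))" (is "_ \<longleftrightarrow> ?R")
proof
  assume L: "koszul_exact d 0 t N"
  show ?R
  proof (intro ballI impI)
    fix v assume v: "v \<in> N" "vhom d t v"
    define c where "c k \<tau> = (if \<tau> = {} then v k else 0)" for k and \<tau> :: "'n set"
    have 0: "(\<lambda>_. 0) \<in> N" using vecs.subspace_0[OF N] by (simp add: zero_fun_def)
    have "(\<lambda>k. c k \<tau>) \<in> N" for \<tau>
      using v(1) 0 by (cases "\<tau> = {}") (simp_all add: c_def)
    then have "kchain 0 N c"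
      by (auto simp: kchain_def c_def)
    moreover have "khom d (t - int 0) c"
      using v(2) by (auto simp: khom_def c_def vhom_def)
    moreover have "bd (c k) = (\<lambda>_. 0)" for k
      by (auto simp: bd_def c_def)
    ultimately obtain b where b: "kchain (Suc 0) N b" "\<And>k. bd (b k) = c k"
      using L unfolding koszul_exact_def by blast
    have "v k = (\<Sum>i\<in>UNIV. X i * b k {i})" for k
    proof -
      have "v k = bd (b k) {}" by (simp add: b(2) c_def)
      then show ?thesis by (simp add: bd_def ksgn_def)
    qed
    then show "\<exists>w. (\<forall>i. w i \<in> N) \<and> v = (\<lambda>k. \<Sum>i\<in>UNIV. X i * w i k)"
      using b(1) by (intro exI[of _ "\<lambda>i k. b k {i}"]) (auto simp: kchain_def)
  qed
next
  assume R: ?R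
  show "koszul_exact d 0 t N"
    unfolding koszul_exact_def
  proof (intro allI impI)
    fix c assume c: "kchain 0 N c" "khom d (t - int 0) c"
    have "(\<lambda>k. c k {}) \<in> N" "vhom d t (\<lambda>k. c k {})"
      using c by (auto simp: kchain_def khom_def)
    then obtain w where w: "\<And>i. w i \<in> N" and "(\<lambda>k. c k {}) = (\<lambda>k. \<Sum>i\<in>UNIV. X i * w i k)"
      using R by blast
    then have cw: "c k {} = (\<Sum>i\<in>UNIV. X i * w i k)" for k
      by (rule_tac fun_cong)
    define b where "b k \<tau> = (if card \<tau> = Suc 0 then w (the_elem \<tau>) k else 0)" for k \<tau>
    have 0: "(\<lambda>_. 0) \<in> N" using vecs.subspace_0[OF N] by (simp add: zero_fun_def)
    have "(\<lambda>k. b k \<tau>) \<in> N" for \<tau>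
      using w 0 by (cases "card \<tau> = Suc 0") (simp_all add: b_def)
    then have "kchain (Suc 0) N b"
      by (auto simp: kchain_def b_def)
    moreover have "bd (b k) \<sigma> = c k \<sigma>" for k \<sigma>
    proof (cases "\<sigma> = {}")
      case True
      then show ?thesis by (simp add: bd_def ksgn_def b_def cw)
    next
      case False
      then have "c k \<sigma> = 0" using c(1) by (simp add: kchain_def)
      moreover have "b k (insert i \<sigma>) = 0" if "i \<in> -\<sigma>" for i
        using that False by (simp add: b_def)
      ultimately show ?thesis by (simp add: bd_def)
    qed
    ultimately show "\<exists>b. kchain (Suc 0) N b \<and> (\<forall>k. bd (b k) = c k)" by blast
  qed
qed

lemma lin_sum_X:
  fixes q :: "'n::finite \<Rightarrow> nat \<Rightarrow> ('n, 'k::field) mpoly"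
  shows "lin A r (\<lambda>l. \<Sum>i\<in>UNIV. X i * q i l) k = (\<Sum>i\<in>UNIV. X i * lin A r (q i) k)"
proof -
  have "lin A r (\<lambda>l. \<Sum>i\<in>UNIV. X i * q i l) k = (\<Sum>l<r. \<Sum>i\<in>UNIV. X i * (A k l * q i l))"
    by (simp add: lin_def sum_distrib_left mult.left_commute)
  also have "\<dots> = (\<Sum>i\<in>UNIV. X i * lin A r (q i) k)"
    unfolding lin_def sum_distrib_left by (rule sum.swap)
  finally show ?thesis .
qed

context minimal_presentation
begin

text \<open>
  Graded Nakayama lemma for the columns of a minimal presentation.
\<close>

theorem koszul_exact_0_iff_degree: "koszul_exact d 0 t N \<longleftrightarrow> (\<forall>l<r. d' l \<noteq> t)"
proof
  assume ex: "koszul_exact d 0 t N"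
  show "\<forall>l<r. d' l \<noteq> t"
  proof (intro allI impI notI)
    fix l assume l: "l < r" "d' l = t"
    define e where "e k = (if k = l then 1 else 0 :: ('n, 'k) mpoly)" for k
    have "e \<in> free_mod r" using l by (auto simp: free_mod_def e_def)
    then have "lin A r e \<in> N" using image by auto
    moreover have "vhom d' t e"
      using l by (auto simp: vhom_def e_def homogeneous_def)
    then have "vhom d t (lin A r e)" by (rule vhom_lin[OF hom])
    ultimately obtain w where w: "\<And>i. w i \<in> N" "lin A r e = (\<lambda>k. \<Sum>i\<in>UNIV. X i * w i k)"
      using ex unfolding koszul_exact_0_iff[OF subspace_image] by blast
    have "\<exists>f. f \<in> free_mod r \<and> w i = lin A r f" for i
      using w(1)[of i] image by auto
    then obtain f where f: "\<And>i. f i \<in> free_mod r" "\<And>i. w i = lin A r (f i)"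
      by metis
    define z where "z k = e k - (\<Sum>i\<in>UNIV. X i * f i k)" for k
    have "z \<in> Z"
      unfolding kernel
    proof (intro CollectI conjI)
      show "z \<in> free_mod r"
        using \<open>e \<in> free_mod r\<close> f(1) by (auto simp: free_mod_def z_def)
      show "lin A r z = (\<lambda>_. 0)"
        unfolding z_def lin_diff lin_sum_X w(2) f(2) by simp
    qed
    from minimal[OF this, of l] show False
      by (simp add: z_def e_def lookup_minus lookup_0_sum_X)
  qed
next
  assume deg: "\<forall>l<r. d' l \<noteq> t"
  show "koszul_exact d 0 t N"
    unfolding koszul_exact_0_iff[OF subspace_image]
  proof (intro ballI impI)
    fix v assume v: "v \<in> N" "vhom d t v"
    obtain w where w: "w \<in> free_mod r" "v = lin A r w"
      using v(1) image by auto
    define w' where "w' = vcomp d' t w"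
    have v_eq: "v = lin A r w'"
      using vcomp_lin[OF hom, of t w] v(2) by (simp add: w'_def vcomp_vhom flip: w(2))
    have "\<exists>q. w' l = (\<Sum>i\<in>UNIV. X i * q i)" if "l < r" for l
    proof -
      have "lookup (w' l) 0 = 0"
        using deg that by (intro lookup_0_homogeneous[of "t - d' l"]) (auto simp: w'_def vcomp_def homogeneous_hcomp)
      then show ?thesis using lookup_0_eq_0_decomp by metis
    qed
    then obtain q where q: "\<And>l. l < r \<Longrightarrow> w' l = (\<Sum>i\<in>UNIV. X i * q l i)" by metis
    define f where "f i l = (if l < r then q l i else 0)" for i l
    have "v k = (\<Sum>i\<in>UNIV. X i * lin A r (f i) k)" for k
    proof -
      have "v k = lin A r (\<lambda>l. \<Sum>i\<in>UNIV. X i * f i l) k"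
        unfolding v_eq by (simp add: lin_def f_def q)
      then show ?thesis by (simp add: lin_sum_X)
    qed
    moreover have "lin A r (f i) \<in> N" for i
      using image by (auto simp: f_def free_mod_def)
    ultimately show "\<exists>w. (\<forall>i. w i \<in> N) \<and> v = (\<lambda>k. \<Sum>i\<in>UNIV. X i * w i k)"
      by (intro exI[of _ "\<lambda>i. lin A r (f i)"]) auto
  qed
qed

end

subsection \<open>Vectors as finitely supported functions\<close>

text \<open>
  Conversion of vectors and matrices with explicit dimensions, extended by zero.
\<close>

definition vec_fun :: "'a::comm_ring_1 vec \<Rightarrow> nat \<Rightarrow> 'a" where
  "vec_fun v k = (if k < dim_vec v then v $ k else 0)"

definition mat_fun :: "'a::comm_ring_1 mat \<Rightarrow> nat \<Rightarrow> nat \<Rightarrow> 'a" where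
  "mat_fun \<phi> k l = (if k < dim_row \<phi> \<and> l < dim_col \<phi> then \<phi> $$ (k, l) else 0)"

lemma vec_fun_image: "vec_fun ` carrier_vec n = (free_mod n :: (nat \<Rightarrow> 'a::comm_ring_1) set)"
proof (intro equalityI subsetI)
  fix v :: "nat \<Rightarrow> 'a" assume "v \<in> free_mod n"
  then have "v = vec_fun (vec n v)" by (auto simp: vec_fun_def free_mod_def)
  then show "v \<in> vec_fun ` carrier_vec n" by (metis imageI vec_carrier)
qed (auto simp: vec_fun_def free_mod_def)

lemma vec_fun_inj: "v \<in> carrier_vec n \<Longrightarrow> w \<in> carrier_vec n \<Longrightarrow> vec_fun v = vec_fun w \<longleftrightarrow> v = w"
proof (intro iffI eq_vecI)
  fix k assume v: "v \<in> carrier_vec n" "w \<in> carrier_vec n" "vec_fun v = vec_fun w" "k < dim_vec w"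
  then have "vec_fun v k = vec_fun w k" by simp
  moreover have "dim_vec v = n" "dim_vec w = n" using v by auto
  ultimately show "v $ k = w $ k" using v(4) by (simp add: vec_fun_def)
qed auto

lemma vec_fun_mult:
  assumes "v \<in> carrier_vec (dim_col \<phi>)"
  shows "vec_fun (\<phi> *\<^sub>v v) = lin (mat_fun \<phi>) (dim_col \<phi>) (vec_fun v)"
proof
  fix k
  show "vec_fun (\<phi> *\<^sub>v v) k = lin (mat_fun \<phi>) (dim_col \<phi>) (vec_fun v) k"
    using assms by (auto simp: vec_fun_def mat_fun_def lin_def scalar_prod_def lessThan_atLeast0)
qed

lemma vec_fun_mat_image: "vec_fun ` mat_image \<phi> = lin (mat_fun \<phi>) (dim_col \<phi>) ` free_mod (dim_col \<phi>)"
proof -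
  have "mat_image \<phi> = (\<lambda>v. \<phi> *\<^sub>v v) ` carrier_vec (dim_col \<phi>)" by (auto simp: mat_image_def)
  then have "vec_fun ` mat_image \<phi> = (\<lambda>v. vec_fun (\<phi> *\<^sub>v v)) ` carrier_vec (dim_col \<phi>)"
    by (simp add: image_image)
  also have "\<dots> = (\<lambda>v. lin (mat_fun \<phi>) (dim_col \<phi>) (vec_fun v)) ` carrier_vec (dim_col \<phi>)"
    by (intro image_cong) (simp_all add: vec_fun_mult)
  finally show ?thesis by (simp flip: vec_fun_image add: image_image)
qed

lemma vec_fun_mat_ker:
  "vec_fun ` mat_ker \<phi> = {v \<in> free_mod (dim_col \<phi>). lin (mat_fun \<phi>) (dim_col \<phi>) v = (\<lambda>_. 0)}"
proof -
  have "\<phi> *\<^sub>v v = 0\<^sub>v (dim_row \<phi>) \<longleftrightarrow> lin (mat_fun \<phi>) (dim_col \<phi>) (vec_fun v) = (\<lambda>_. 0)"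
    if v: "v \<in> carrier_vec (dim_col \<phi>)" for v
  proof -
    have "vec_fun (0\<^sub>v (dim_row \<phi>)) = (\<lambda>_. 0 :: 'a)" by (auto simp: vec_fun_def)
    moreover have "\<phi> *\<^sub>v v \<in> carrier_vec (dim_row \<phi>)"
      by (intro carrier_vecI) simp
    ultimately show ?thesis
      using vec_fun_inj[of "\<phi> *\<^sub>v v" "dim_row \<phi>" "0\<^sub>v (dim_row \<phi>)"] vec_fun_mult[OF v] by auto
  qed
  then show ?thesis
    unfolding mat_ker_def by (auto simp flip: vec_fun_image)
qed

text \<open>An ideal as a submodule of the free module of rank one.\<close>

definition ideal_vecs :: "'a::comm_ring_1 set \<Rightarrow> (nat \<Rightarrow> 'a) set" where
  "ideal_vecs I = {v \<in> free_mod 1. v 0 \<in> I}"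

text \<open>
  The modules resolved by the tails of a resolution: \<open>syzygies I \<phi> 0\<close> is \<open>I\<close>, and
  \<open>syzygies I \<phi> (Suc j)\<close> is the kernel of \<open>\<phi> j\<close>. The degrees \<open>syz_deg d i\<close> are those of the free module
  that contains \<open>syzygies I \<phi> i\<close>.
\<close>

definition syzygies :: "'a::comm_ring_1 set \<Rightarrow> (nat \<Rightarrow> 'a mat) \<Rightarrow> nat \<Rightarrow> (nat \<Rightarrow> 'a) set" where
  "syzygies I \<phi> i = (case i of 0 \<Rightarrow> ideal_vecs I
    | Suc j \<Rightarrow> {v \<in> free_mod (dim_col (\<phi> j)). lin (mat_fun (\<phi> j)) (dim_col (\<phi> j)) v = (\<lambda>_. 0)})"

definition syz_deg :: "(nat \<Rightarrow> nat \<Rightarrow> int) \<Rightarrow> nat \<Rightarrow> nat \<Rightarrow> int" where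
  "syz_deg d i = (case i of 0 \<Rightarrow> (\<lambda>_. 0) | Suc j \<Rightarrow> d j)"

lemma resolution_minimal_presentation:
  fixes I :: "('n::{finite,linorder}, 'k::field) mpoly set"
  assumes res: "minimal_graded_free_resolution I \<phi> d"
  shows "minimal_presentation (syz_deg d i) (d i) (dim_col (\<phi> i)) (mat_fun (\<phi> i))
    (syzygies I \<phi> i) (syzygies I \<phi> (Suc i))"
proof
  have row0: "dim_row (\<phi> 0) = 1" and rowS: "\<And>i. dim_row (\<phi> (Suc i)) = dim_col (\<phi> i)"
    and hom0: "\<And>c. c < dim_col (\<phi> 0) \<Longrightarrow> homogeneous (d 0 c) (\<phi> 0 $$ (0, c))"
    and homS: "\<And>i r c. r < dim_row (\<phi> (Suc i)) \<Longrightarrow> c < dim_col (\<phi> (Suc i)) \<Longrightarrow>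
      homogeneous (d (Suc i) c - d i r) (\<phi> (Suc i) $$ (r, c))"
    and im0: "(\<lambda>v. v $ 0) ` mat_image (\<phi> 0) = I"
    and imS: "\<And>i. mat_image (\<phi> (Suc i)) = mat_ker (\<phi> i)"
    and min: "\<And>i r c. r < dim_row (\<phi> (Suc i)) \<Longrightarrow> c < dim_col (\<phi> (Suc i)) \<Longrightarrow>
      \<phi> (Suc i) $$ (r, c) \<in> idl.span (range X)"
    using res unfolding minimal_graded_free_resolution_def by blast+
  show "hom_matrix (syz_deg d i) (dim_col (\<phi> i)) (d i) (mat_fun (\<phi> i))"
    using hom0 homS row0 by (cases i) (auto simp: hom_matrix_def syz_deg_def mat_fun_def)
  have imageS: "lin (mat_fun (\<phi> (Suc j))) (dim_col (\<phi> (Suc j))) ` free_mod (dim_col (\<phi> (Suc j))) =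
      syzygies I \<phi> (Suc j)" for j
    unfolding syzygies_def vec_fun_mat_image[symmetric] imS vec_fun_mat_ker by simp
  show "lin (mat_fun (\<phi> i)) (dim_col (\<phi> i)) ` free_mod (dim_col (\<phi> i)) = syzygies I \<phi> i"
  proof (cases i)
    case 0
    have dim: "v \<in> carrier_vec 1" if "v \<in> mat_image (\<phi> 0)" for v
      using that row0 by (auto simp: mat_image_def intro!: carrier_vecI)
    have "vec_fun ` mat_image (\<phi> 0) = ideal_vecs I"
    proof (intro equalityI subsetI)
      fix v assume "v \<in> vec_fun ` mat_image (\<phi> 0)"
      then obtain x where x: "x \<in> mat_image (\<phi> 0)" "v = vec_fun x" by blast
      have "v \<in> free_mod 1" using dim[OF x(1)] x(2) vec_fun_image by blast
      moreover have "v 0 \<in> I" using dim[OF x(1)] x im0 by (auto simp: vec_fun_def)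
      ultimately show "v \<in> ideal_vecs I" by (simp add: ideal_vecs_def)
    next
      fix v assume "v \<in> ideal_vecs I"
      then have v: "v \<in> free_mod 1" "v 0 \<in> I" by (auto simp: ideal_vecs_def)
      then obtain x where x: "x \<in> mat_image (\<phi> 0)" "v 0 = x $ 0" using im0 by blast
      have "v = vec_fun x"
        using dim[OF x(1)] v(1) x(2) by (auto simp: vec_fun_def free_mod_def)
      then show "v \<in> vec_fun ` mat_image (\<phi> 0)" using x(1) by blast
    qed
    then show ?thesis
      using 0 by (simp add: syzygies_def vec_fun_mat_image)
  next
    case (Suc j)
    then show ?thesis using imageS by simp
  qed
  show "syzygies I \<phi> (Suc i) = {v \<in> free_mod (dim_col (\<phi> i)). lin (mat_fun (\<phi> i)) (dim_col (\<phi> i)) v = (\<lambda>_. 0)}"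
    by (simp add: syzygies_def)
  fix v l assume "v \<in> syzygies I \<phi> (Suc i)"
  then obtain w where w: "v = lin (mat_fun (\<phi> (Suc i))) (dim_col (\<phi> (Suc i))) w"
    using imageS by blast
  have "mat_fun (\<phi> (Suc i)) l m \<in> idl.span (range X)" for m
    using min[of l i m] idl.span_zero by (auto simp: mat_fun_def)
  then have "w m * mat_fun (\<phi> (Suc i)) l m \<in> idl.span (range X)" for m
    by (intro idl.span_scale)
  then have "v l \<in> idl.span (range X)"
    unfolding w lin_def by (intro idl.span_sum) (simp add: mult.commute)
  then show "lookup (v l) 0 = 0" by (simp add: span_range_X)
qed

lemma koszul_exact_iff_degree:
  fixes I :: "('n::{finite,linorder}, 'k::field) mpoly set"
  assumes res: "minimal_graded_free_resolution I \<phi> d"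
  shows "koszul_exact (\<lambda>_. 0) p t (ideal_vecs I) \<longleftrightarrow> (\<forall>l<dim_col (\<phi> p). d p l \<noteq> t)"
proof -
  note pres = resolution_minimal_presentation[OF res]
  have "koszul_exact (syz_deg d i) p t (syzygies I \<phi> i) \<longleftrightarrow>
      koszul_exact (syz_deg d (i + p)) 0 t (syzygies I \<phi> (i + p))" for i
  proof (induction p arbitrary: i)
    case (Suc p)
    have "koszul_exact (syz_deg d i) (Suc p) t (syzygies I \<phi> i) \<longleftrightarrow>
        koszul_exact (syz_deg d (Suc i)) p t (syzygies I \<phi> (Suc i))"
      using minimal_presentation.koszul_exact_shift[OF pres] by (simp add: syz_deg_def)
    then show ?case using Suc[of "Suc i"] by simp
  qed simp
  from this[of 0] minimal_presentation.koszul_exact_0_iff_degree[OF pres, of p t] show ?thesis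
    by (simp add: syz_deg_def[of _ 0] syzygies_def[of _ _ 0])
qed

text \<open>
  Only the vanishing of Betti numbers is needed below. As the criterion does not mention a resolution,
  it holds for whichever one the definition of \<open>betti\<close> selects.
\<close>

theorem betti_nonzero_iff:
  fixes I :: "('n::{finite,linorder}, 'k::field) mpoly set"
  assumes "\<exists>\<phi> d. minimal_graded_free_resolution I \<phi> d"
  shows "betti I p t \<noteq> 0 \<longleftrightarrow> \<not> koszul_exact (\<lambda>_. 0) p t (ideal_vecs I)"
proof -
  obtain \<phi> d where \<phi>d: "(SOME (\<phi>, d). minimal_graded_free_resolution I \<phi> d) = (\<phi>, d)"
    by (meson surj_pair)
  obtain \<phi>' d' where "minimal_graded_free_resolution I \<phi>' d'" using assms by blast
  then have "case (\<phi>', d') of (\<phi>, d) \<Rightarrow> minimal_graded_free_resolution I \<phi> d" by simp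
  from someI[of "\<lambda>(\<phi>, d). minimal_graded_free_resolution I \<phi> d", OF this]
  have res: "minimal_graded_free_resolution I \<phi> d"
    unfolding \<phi>d by simp
  have "betti I p t = card {c. c < dim_col (\<phi> p) \<and> d p c = t}"
    by (simp add: betti_def \<phi>d)
  then show ?thesis
    unfolding koszul_exact_iff_degree[OF res] by auto
qed

section \<open>Existence of minimal graded free resolutions\<close>

text \<open>
  A graded submodule of the free module of rank \<open>n\<close> with degrees \<open>d\<close>, that is, one closed under taking
  homogeneous components.
\<close>

definition graded_submodule :: "(nat \<Rightarrow> int) \<Rightarrow> nat \<Rightarrow> (nat \<Rightarrow> ('n, 'k::field) mpoly) set \<Rightarrow> bool" where
  "graded_submodule d n N \<longleftrightarrow> vecs.subspace N \<and> N \<subseteq> free_mod n \<and> (\<forall>v\<in>N. \<forall>t. vcomp d t v \<in> N)"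

lemma sum_hcomp:
  fixes p :: "('n, 'k::field) mpoly"
  assumes "finite T" "(\<lambda>u. int (mdeg u)) ` keys p \<subseteq> T"
  shows "p = (\<Sum>t\<in>T. hcomp t p)"
proof (rule poly_mapping_eqI)
  fix u
  have "lookup (\<Sum>t\<in>T. hcomp t p) u = (\<Sum>t\<in>T. if t = int (mdeg u) then lookup p u else 0)"
    by (simp add: lookup_sum lookup_hcomp eq_commute)
  also have "\<dots> = lookup p u"
  proof -
    have "u \<notin> keys p" if "int (mdeg u) \<notin> T" using assms(2) that by blast
    then show ?thesis using assms(1) by (auto simp: in_keys_iff)
  qed
  finally show "lookup p u = lookup (\<Sum>t\<in>T. hcomp t p) u" by simp
qed

lemma free_mod_sum_vcomp:
  fixes v :: "nat \<Rightarrow> ('n, 'k::field) mpoly"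
  assumes v: "v \<in> free_mod n"
  obtains T where "finite T" "v = (\<Sum>t\<in>T. vcomp d t v)"
proof -
  define T where "T = (\<Union>k<n. (\<lambda>u. int (mdeg u) + d k) ` keys (v k))"
  have T: "finite T" by (simp add: T_def)
  have "v k = (\<Sum>t\<in>T. hcomp (t - d k) (v k))" for k
  proof (cases "k < n")
    case True
    have "(\<lambda>u. int (mdeg u)) ` keys (v k) \<subseteq> (\<lambda>t. t - d k) ` T"
    proof
      fix x assume "x \<in> (\<lambda>u. int (mdeg u)) ` keys (v k)"
      then have "x + d k \<in> T" using True by (auto simp: T_def)
      then show "x \<in> (\<lambda>t. t - d k) ` T" by (metis add_diff_cancel_right' imageI)
    qed
    then have "v k = (\<Sum>t\<in>(\<lambda>t. t - d k) ` T. hcomp t (v k))"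
      using T by (intro sum_hcomp) auto
    also have "\<dots> = (\<Sum>t\<in>T. hcomp (t - d k) (v k))"
      by (subst sum.reindex) (auto simp: inj_on_def)
    finally show ?thesis .
  next
    case False
    then show ?thesis using v by (simp add: free_mod_def)
  qed
  then have "v = (\<Sum>t\<in>T. vcomp d t v)"
    by (intro ext) (simp add: sum_fun_apply vcomp_def)
  with T show thesis by (rule that)
qed

lemma vcomp_sum_X:
  fixes w :: "'n::finite \<Rightarrow> nat \<Rightarrow> ('n, 'k::field) mpoly"
  shows "vcomp d t (\<lambda>k. \<Sum>i\<in>UNIV. X i * w i k) = (\<lambda>k. \<Sum>i\<in>UNIV. X i * vcomp d (t - 1) (w i) k)"
proof
  fix k
  have "hcomp (t - d k) (X i * w i k) = X i * hcomp (t - 1 - d k) (w i k)" for i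
    using hcomp_mult[of 1 "X i" "t - d k" "w i k"]
    by (simp add: X_def mon_def homogeneous_single algebra_simps)
  then show "vcomp d t (\<lambda>k. \<Sum>i\<in>UNIV. X i * w i k) k = (\<Sum>i\<in>UNIV. X i * vcomp d (t - 1) (w i) k)"
    by (simp add: vcomp_def hcomp_sum)
qed

text \<open>
  If \<open>H_0(x; N)\<close> vanishes in all degrees above \<open>E\<close>, then \<open>N\<close> is generated in degrees up to \<open>E\<close>.
\<close>

lemma span_low_degree:
  fixes N :: "(nat \<Rightarrow> ('n::{finite,linorder}, 'k::field) mpoly) set"
  assumes N: "graded_submodule d n N" and ex: "\<And>t. t > E \<Longrightarrow> koszul_exact d 0 t N"
  shows "N \<subseteq> vecs.span {v \<in> N. \<exists>t\<le>E. vhom d t v}" (is "_ \<subseteq> vecs.span ?B")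
proof -
  have sub: "vecs.subspace N" using N by (simp add: graded_submodule_def)
  have hom: "v \<in> vecs.span ?B" if "v \<in> N" "vhom d t v" "t \<le> E + int m" for v t m
    using that
  proof (induction m arbitrary: v t)
    case 0
    then show ?case by (intro vecs.span_base) auto
  next
    case (Suc m)
    show ?case
    proof (cases "t \<le> E")
      case True
      then show ?thesis using Suc.prems by (intro vecs.span_base) auto
    next
      case False
      then obtain w where w: "\<And>i. w i \<in> N" "v = (\<lambda>k. \<Sum>i\<in>UNIV. X i * w i k)"
        using ex[of t] Suc.prems unfolding koszul_exact_0_iff[OF sub] by force
      have w': "vcomp d (t - 1) (w i) \<in> vecs.span ?B" for i
        using w(1) N Suc.prems(3) by (intro Suc.IH[of _ "t - 1"]) (auto simp: graded_submodule_def vhom_vcomp)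
      have "v = vcomp d t v" using Suc.prems(2) by (simp add: vcomp_vhom)
      also have "\<dots> = (\<lambda>k. \<Sum>i\<in>UNIV. X i * vcomp d (t - 1) (w i) k)"
        unfolding w(2) by (rule vcomp_sum_X)
      also have "\<dots> = (\<Sum>i\<in>UNIV. smul (X i) (vcomp d (t - 1) (w i)))"
        by (rule ext) (simp add: sum_fun_apply smul_def)
      also have "\<dots> \<in> vecs.span ?B"
        by (intro vecs.span_sum vecs.span_scale w')
      finally show ?thesis .
    qed
  qed
  show ?thesis
  proof
    fix v assume v: "v \<in> N"
    then obtain T where T: "finite T" "v = (\<Sum>t\<in>T. vcomp d t v)"
      using free_mod_sum_vcomp[of v n] N by (auto simp: graded_submodule_def)
    have "vcomp d t v \<in> vecs.span ?B" for t
      using N v by (intro hom[of _ t "nat (t - E)"]) (auto simp: graded_submodule_def vhom_vcomp)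
    then show "v \<in> vecs.span ?B"
      by (subst T(2)) (rule vecs.span_sum)
  qed
qed

lemma vhom_diff_smul_const:
  fixes v w :: "nat \<Rightarrow> ('n::finite, 'k::field) mpoly"
  assumes "vhom d t v" "vhom d t w"
  shows "vhom d t (v - smul (single 0 c) w)"
proof -
  have "homogeneous (t - d k) (single 0 c * w k)" for k
    using homogeneous_mult[of 0 "single 0 c" "t - d k" "w k"] assms(2)
    by (simp add: homogeneous_single vhom_def)
  then show ?thesis
    using assms(1) by (simp add: vhom_def smul_def homogeneous_diff)
qed

text \<open>
  Gaussian elimination in a single degree, where a vector has only finitely many possible
  coefficients: the statement is proved for vectors with coefficients in a finite set \<open>\<Omega>\<close> of positions,
  by induction on \<open>\<Omega>\<close>.
\<close>

lemma finite_generation_degree: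
  fixes N :: "(nat \<Rightarrow> ('n::{finite,linorder}, 'k::field) mpoly) set"
  assumes N: "graded_submodule d n N"
  shows "\<exists>B. finite B \<and> B \<subseteq> {v \<in> N. vhom d t v} \<and> {v \<in> N. vhom d t v} \<subseteq> vecs.span B"
proof -
  have sub: "vecs.subspace N" and free: "N \<subseteq> free_mod n" using N by (auto simp: graded_submodule_def)
  have elim: "\<exists>B. finite B \<and> B \<subseteq> {v \<in> N. vhom d t v} \<and>
      (\<forall>v\<in>N. vhom d t v \<longrightarrow> (\<forall>k u. lookup (v k) u \<noteq> 0 \<longrightarrow> (k, u) \<in> \<Omega>) \<longrightarrow> v \<in> vecs.span B)"
    if "finite \<Omega>" for \<Omega> :: "(nat \<times> ('n \<Rightarrow>\<^sub>0 nat)) set"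
    using that
  proof (induction \<Omega> rule: finite_induct)
    case empty
    have "v = 0" if "\<forall>k u. lookup (v k) u = 0" for v :: "nat \<Rightarrow> ('n, 'k) mpoly"
      using that by (intro ext poly_mapping_eqI) simp
    then show ?case by (intro exI[of _ "{}"]) auto
  next
    case (insert x \<Omega>)
    obtain k0 u0 where x: "x = (k0, u0)" by force
    obtain B where B: "finite B" "B \<subseteq> {v \<in> N. vhom d t v}"
      "\<forall>v\<in>N. vhom d t v \<longrightarrow> (\<forall>k u. lookup (v k) u \<noteq> 0 \<longrightarrow> (k, u) \<in> \<Omega>) \<longrightarrow> v \<in> vecs.span B"
      using insert.IH by (elim exE conjE)
    show ?case
    proof (cases "\<exists>w\<in>N. vhom d t w \<and> (\<forall>k u. lookup (w k) u \<noteq> 0 \<longrightarrow> (k, u) \<in> insert x \<Omega>) \<and>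
        lookup (w k0) u0 \<noteq> 0")
      case False
      have "v \<in> vecs.span B" if v: "v \<in> N" "vhom d t v"
        "\<forall>k u. lookup (v k) u \<noteq> 0 \<longrightarrow> (k, u) \<in> insert x \<Omega>" for v
      proof (rule B(3)[rule_format, OF v(1,2)])
        fix k u assume ku: "lookup (v k) u \<noteq> 0"
        have "(k, u) \<noteq> x"
        proof
          assume "(k, u) = x"
          then have "lookup (v k0) u0 \<noteq> 0" using ku x by simp
          with v have "vhom d t v \<and> (\<forall>k u. lookup (v k) u \<noteq> 0 \<longrightarrow> (k, u) \<in> insert x \<Omega>) \<and>
              lookup (v k0) u0 \<noteq> 0" by simp
          then have "\<exists>w\<in>N. vhom d t w \<and> (\<forall>k u. lookup (w k) u \<noteq> 0 \<longrightarrow> (k, u) \<in> insert x \<Omega>) \<and>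
              lookup (w k0) u0 \<noteq> 0" by (rule bexI[where x = v]) (rule v(1))
          with False show False by (rule notE)
        qed
        moreover have "(k, u) \<in> insert x \<Omega>" using v(3)[rule_format, OF ku] .
        ultimately show "(k, u) \<in> \<Omega>" by simp
      qed
      with B(1,2) show ?thesis by (intro exI[of _ B]) simp
    next
      case True
      then obtain w where w: "w \<in> N" "vhom d t w"
        "\<And>k u. lookup (w k) u \<noteq> 0 \<Longrightarrow> (k, u) \<in> insert x \<Omega>" "lookup (w k0) u0 \<noteq> 0"
        by (elim bexE conjE) simp
      have "v \<in> vecs.span (insert w B)" if v: "v \<in> N" "vhom d t v"
        "\<forall>k u. lookup (v k) u \<noteq> 0 \<longrightarrow> (k, u) \<in> insert x \<Omega>" for v
      proof -
        define c where "c = lookup (v k0) u0 / lookup (w k0) u0"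
        define v' where "v' = v - smul (single 0 c) w"
        have lookup_v': "lookup (v' k) u = lookup (v k) u - c * lookup (w k) u" for k u
          by (simp add: v'_def smul_def lookup_minus lookup_single_times exp_dvd_def)
        have "v' \<in> N"
          unfolding v'_def using sub v(1) w(1) by (intro vecs.subspace_diff vecs.subspace_scale)
        moreover have "vhom d t v'"
          unfolding v'_def using v(2) w(2) by (rule vhom_diff_smul_const)
        moreover have "(k, u) \<in> \<Omega>" if "lookup (v' k) u \<noteq> 0" for k u
        proof -
          have "(k, u) \<in> insert x \<Omega>"
          proof (cases "lookup (v k) u = 0")
            case True
            then have "lookup (w k) u \<noteq> 0" using that by (auto simp: lookup_v')
            then show ?thesis by (rule w(3))
          qed (rule v(3)[rule_format])
          moreover have "(k, u) \<noteq> x"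
            using that w(4) by (auto simp: x lookup_v' c_def)
          ultimately show ?thesis by blast
        qed
        ultimately have "v' \<in> vecs.span B" by (rule B(3)[rule_format])
        then have "v' \<in> vecs.span (insert w B)"
          using vecs.span_mono[of B "insert w B"] by blast
        moreover have "smul (single 0 c) w \<in> vecs.span (insert w B)"
          by (intro vecs.span_scale vecs.span_base) simp
        moreover have "v = v' + smul (single 0 c) w" by (simp add: v'_def)
        ultimately show ?thesis by (simp add: vecs.span_add)
      qed
      then show ?thesis
        using B(1,2) w(1,2) by (intro exI[of _ "insert w B"]) auto
    qed
  qed
  define \<Omega> where "\<Omega> = (SIGMA k:{..<n}. {u :: 'n \<Rightarrow>\<^sub>0 nat. mdeg u \<le> nat (t - d k)})"
  have "finite \<Omega>" by (simp add: \<Omega>_def finite_mdeg_le)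
  from elim[OF this] obtain B where B: "finite B" "B \<subseteq> {v \<in> N. vhom d t v}"
    "\<forall>v\<in>N. vhom d t v \<longrightarrow> (\<forall>k u. lookup (v k) u \<noteq> 0 \<longrightarrow> (k, u) \<in> \<Omega>) \<longrightarrow> v \<in> vecs.span B"
    by (elim exE conjE)
  have "(k, u) \<in> \<Omega>" if v: "v \<in> N" "vhom d t v" and ku: "lookup (v k) u \<noteq> 0" for v k u
  proof -
    have "k < n"
    proof (rule ccontr)
      assume "\<not> k < n"
      then have "v k = 0" using v(1) free by (auto simp: free_mod_def)
      then show False using ku by simp
    qed
    moreover have "int (mdeg u) = t - d k"
      using v(2) ku by (auto simp: vhom_def homogeneous_def in_keys_iff)
    ultimately show ?thesis by (auto simp: \<Omega>_def)
  qed
  then have "{v \<in> N. vhom d t v} \<subseteq> vecs.span B" by (auto intro: B(3)[rule_format])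
  with B(1,2) show ?thesis by blast
qed

lemma finite_generation:
  fixes N :: "(nat \<Rightarrow> ('n::{finite,linorder}, 'k::field) mpoly) set"
  assumes N: "graded_submodule d n N" and ex: "\<And>t. t > E \<Longrightarrow> koszul_exact d 0 t N"
  shows "\<exists>B. finite B \<and> B \<subseteq> {v \<in> N. \<exists>t. vhom d t v} \<and> N = vecs.span B"
proof -
  have sub: "vecs.subspace N" and free: "N \<subseteq> free_mod n" using N by (auto simp: graded_submodule_def)
  have "\<exists>B. \<forall>t. finite (B t) \<and> B t \<subseteq> {v \<in> N. vhom d t v} \<and> {v \<in> N. vhom d t v} \<subseteq> vecs.span (B t)"
    by (intro choice allI finite_generation_degree[OF N])
  then obtain B where B: "\<And>t. finite (B t)" "\<And>t. B t \<subseteq> {v \<in> N. vhom d t v}"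
    "\<And>t. {v \<in> N. vhom d t v} \<subseteq> vecs.span (B t)"
    by auto
  \<comment> \<open>There are no nonzero homogeneous vectors of degree below \<open>L\<close>.\<close>
  define L where "L = Min (insert 0 (d ` {..<n}))"
  define C where "C = (\<Union>t\<in>{L..E}. B t)"
  have "v \<in> vecs.span C" if v: "v \<in> N" "vhom d t v" "t \<le> E" for v t
  proof (cases "t \<ge> L")
    case True
    then have "vecs.span (B t) \<subseteq> vecs.span C"
      using v(3) by (intro vecs.span_mono) (auto simp: C_def)
    then show ?thesis using B(3) v by blast
  next
    case False
    have "v k = 0" for k
    proof (cases "k < n")
      case True
      then have "L \<le> d k" by (simp add: L_def)
      then have "t - d k < 0" using False by simp
      then show ?thesis
        using v(2) unfolding vhom_def homogeneous_def
        by (metis all_not_in_conv int_nat_eq keys_eq_empty linorder_not_less of_nat_0_le_iff)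
    next
      case False
      then show ?thesis using v(1) free by (auto simp: free_mod_def)
    qed
    then have "v = 0" by auto
    then show ?thesis by (simp add: vecs.span_zero)
  qed
  then have "vecs.span {v \<in> N. \<exists>t\<le>E. vhom d t v} \<subseteq> vecs.span C"
    by (intro vecs.span_minimal vecs.subspace_span) auto
  then have "N \<subseteq> vecs.span C"
    using span_low_degree[OF N ex] by blast
  moreover have "C \<subseteq> N" using B(2) by (auto simp: C_def)
  then have "vecs.span C \<subseteq> N" using sub by (rule vecs.span_minimal)
  moreover have "finite C" using B(1) by (simp add: C_def)
  moreover have "C \<subseteq> {v \<in> N. \<exists>t. vhom d t v}" using B(2) by (auto simp: C_def)
  ultimately show ?thesis by blast
qed

lemma lin_conv_sum: "lin (\<lambda>k l. b l k) r v = (\<Sum>l<r. smul (v l) (b l))"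
  by (rule ext) (simp add: lin_def sum_fun_apply smul_def mult.commute)

text \<open>
  A homogeneous generating set of least cardinality gives a minimal presentation: a relation with a
  nonzero constant term, taken in the right degree, would make a generator redundant.
\<close>

lemma resolution_step:
  fixes N :: "(nat \<Rightarrow> ('n::{finite,linorder}, 'k::field) mpoly) set"
  assumes N: "graded_submodule d n N" and ex: "\<And>t. t > E \<Longrightarrow> koszul_exact d 0 t N"
  obtains r d' A Z where "minimal_presentation d d' r A N Z" "graded_submodule d' r Z"
    "\<And>k l. k \<ge> n \<Longrightarrow> l < r \<Longrightarrow> A k l = 0"
proof -
  define P where "P B \<longleftrightarrow> finite B \<and> B \<subseteq> {v \<in> N. \<exists>t. vhom d t v} \<and> N = vecs.span B" for B
  have "\<exists>B. P B" unfolding P_def by (rule finite_generation[OF N ex])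
  then obtain B0 where "P B0" ..
  then obtain B where B: "P B" and Bmin: "\<And>B'. P B' \<Longrightarrow> card B \<le> card B'"
    using ex_has_least_nat[of P B0 card] by blast
  have fin: "finite B" and sub: "B \<subseteq> N" and gen: "N = vecs.span B" using B by (auto simp: P_def)
  define r where "r = card B"
  obtain b where b: "bij_betw b {..<r} B"
    using ex_bij_betw_nat_finite[OF fin] by (auto simp: r_def lessThan_atLeast0)
  have bB: "b l \<in> B" if "l < r" for l using b that by (auto simp: bij_betw_def)
  have "\<exists>t. l < r \<longrightarrow> vhom d t (b l)" for l
    using bB[of l] B unfolding P_def by auto
  then obtain d' where d': "\<And>l. l < r \<Longrightarrow> vhom d (d' l) (b l)" by metis
  define A where "A k l = b l k" for k l
  define Z where "Z = {v \<in> free_mod r. lin A r v = (\<lambda>_. 0)}"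
  have hom: "hom_matrix d r d' A"
    using d' by (auto simp: hom_matrix_def A_def vhom_def)
  have pres: "minimal_presentation d d' r A N Z"
  proof
    have Bim: "B = b ` {..<r}" using b by (simp add: bij_betw_def)
    show "lin A r ` free_mod r = N"
    proof (intro equalityI subsetI)
      fix x assume "x \<in> lin A r ` free_mod r"
      then obtain v where "x = lin A r v" by auto
      then have "x = (\<Sum>l<r. smul (v l) (b l))" by (simp add: A_def[abs_def] lin_conv_sum)
      then show "x \<in> N"
        unfolding gen by (auto intro!: vecs.span_sum vecs.span_scale intro: vecs.span_base bB)
    next
      fix x assume "x \<in> N"
      then obtain f where "x = (\<Sum>y\<in>B. smul (f y) y)"
        using vecs.span_finite[OF fin] gen by auto
      also have "\<dots> = (\<Sum>l<r. smul (f (b l)) (b l))"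
        using b by (intro sum.reindex_bij_betw[symmetric]) auto
      also have "\<dots> = (\<Sum>l<r. smul ((\<lambda>l. if l < r then f (b l) else 0) l) (b l))"
        by (intro sum.cong) auto
      also have "\<dots> = lin A r (\<lambda>l. if l < r then f (b l) else 0)"
        by (simp only: A_def[abs_def] lin_conv_sum)
      finally show "x \<in> lin A r ` free_mod r"
        by (auto simp: free_mod_def)
    qed
    fix v l0 assume v: "v \<in> Z"
    show "lookup (v l0) 0 = 0"
    proof (rule ccontr)
      assume c: "lookup (v l0) 0 \<noteq> 0"
      have l0: "l0 < r"
      proof (rule ccontr)
        assume "\<not> l0 < r"
        then have "v l0 = 0" using v by (auto simp: Z_def free_mod_def)
        then show False using c by simp
      qed
      define w where "w = vcomp d' (d' l0) v"
      have "lin A r w = (\<lambda>_. 0)"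
        using vcomp_lin[OF hom, of "d' l0" v] v by (simp add: Z_def w_def vcomp_def)
      then have "(\<Sum>l<r. smul (w l) (b l)) = 0"
        by (simp add: A_def[abs_def] lin_conv_sum zero_fun_def)
      moreover have "(\<Sum>l<r. smul (w l) (b l)) = smul (w l0) (b l0) + (\<Sum>l\<in>{..<r} - {l0}. smul (w l) (b l))"
        using l0 by (intro sum.remove) auto
      ultimately have eq: "smul (w l0) (b l0) = - (\<Sum>l\<in>{..<r} - {l0}. smul (w l) (b l))"
        by (simp add: eq_neg_iff_add_eq_0)
      have wl0: "w l0 = single 0 (lookup (v l0) 0)"
        by (rule poly_mapping_eqI) (auto simp: w_def vcomp_def lookup_hcomp lookup_single when_def)
      have inB: "(\<Sum>l\<in>{..<r} - {l0}. smul (w l) (b l)) \<in> vecs.span (B - {b l0})"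
      proof (intro vecs.span_sum vecs.span_scale vecs.span_base)
        fix l assume l: "l \<in> {..<r} - {l0}"
        then have "b l \<noteq> b l0" using b l0 by (auto simp: bij_betw_def inj_on_def)
        then show "b l \<in> B - {b l0}" using bB l by auto
      qed
      have "b l0 = smul (single 0 (inverse (lookup (v l0) 0))) (smul (w l0) (b l0))"
        using c by (auto simp: smul_def wl0 mult.assoc[symmetric] mult_single simp flip: single_one)
      also have "\<dots> \<in> vecs.span (B - {b l0})"
        unfolding eq using inB by (intro vecs.span_scale vecs.span_neg)
      finally have "b l0 \<in> vecs.span (B - {b l0})" .
      then have "B \<subseteq> vecs.span (B - {b l0})"
        by (auto intro: vecs.span_base)
      then have "N \<subseteq> vecs.span (B - {b l0})"
        unfolding gen by (intro vecs.span_minimal vecs.subspace_span)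
      moreover have "vecs.span (B - {b l0}) \<subseteq> N"
        unfolding gen by (intro vecs.span_mono) auto
      ultimately have "P (B - {b l0})" using B by (auto simp: P_def)
      from Bmin[OF this] show False
        using bB[OF l0] fin card_Diff1_less[of B "b l0"] by linarith
    qed
  qed (use hom in \<open>simp_all add: Z_def\<close>)
  moreover have "graded_submodule d' r Z"
    unfolding graded_submodule_def
  proof (intro conjI ballI allI)
    show "vecs.subspace Z" using pres by (rule minimal_presentation.subspace_kernel)
    show "Z \<subseteq> free_mod r" by (auto simp: Z_def)
    fix v t assume "v \<in> Z"
    then show "vcomp d' t v \<in> Z"
      using vcomp_lin[OF hom, of t v] vcomp_free_mod[of v r d' t] by (simp add: Z_def vcomp_def)
  qed
  moreover have "A k l = 0" if "k \<ge> n" "l < r" for k l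
    using bB[OF that(2)] that(1) sub N by (auto simp: A_def graded_submodule_def free_mod_def)
  ultimately show thesis by (rule that)
qed

text \<open>
  Minimal presentations of successive syzygy modules splice to a minimal resolution.
\<close>

lemma resolution_from_presentations:
  fixes I :: "('n::{finite,linorder}, 'k::field) mpoly set"
  assumes pres: "\<And>i. minimal_presentation (d i) (d (Suc i)) (n (Suc i)) (A i) (N i) (N (Suc i))"
    and zero: "\<And>i k l. k \<ge> n i \<Longrightarrow> l < n (Suc i) \<Longrightarrow> A i k l = 0"
    and start: "n 0 = 1" "d 0 = (\<lambda>_. 0)" "N 0 = ideal_vecs I"
  shows "minimal_graded_free_resolution I (\<lambda>i. mat (n i) (n (Suc i)) (\<lambda>(k, l). A i k l)) (\<lambda>i. d (Suc i))"
    (is "minimal_graded_free_resolution I ?\<phi> _")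
proof -
  have lin: "lin (mat_fun (?\<phi> i)) (n (Suc i)) = lin (A i) (n (Suc i))" for i
    using zero by (intro ext) (auto simp: lin_def mat_fun_def intro!: sum.cong)
  have image: "vec_fun ` mat_image (?\<phi> i) = N i" for i
    unfolding vec_fun_mat_image using minimal_presentation.image[OF pres[of i]] by (simp add: lin)
  have kernel: "vec_fun ` mat_ker (?\<phi> i) = N (Suc i)" for i
    unfolding vec_fun_mat_ker using minimal_presentation.kernel[OF pres[of i]] by (simp add: lin)
  have hom: "homogeneous (d (Suc i) c - d i r) (A i r c)" if "c < n (Suc i)" for i r c
    using minimal_presentation.hom[OF pres[of i]] that by (simp add: hom_matrix_def)
  have "(\<lambda>v. v $ 0) ` mat_image (?\<phi> 0) = (\<lambda>v. v 0) ` vec_fun ` mat_image (?\<phi> 0)"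
    unfolding image_image
  proof (rule image_cong[OF refl])
    fix v assume "v \<in> mat_image (?\<phi> 0)"
    then have "dim_vec v = 1" by (auto simp: mat_image_def start)
    then show "v $ 0 = vec_fun v 0" by (simp add: vec_fun_def)
  qed
  also have "\<dots> = I"
  proof -
    have "f \<in> (\<lambda>v. v 0) ` ideal_vecs I" if "f \<in> I" for f
      using that by (intro image_eqI[of _ _ "\<lambda>k. if k = 0 then f else 0"]) (auto simp: ideal_vecs_def free_mod_def)
    then show ?thesis unfolding image start(3) by (auto simp: ideal_vecs_def)
  qed
  finally have image0: "(\<lambda>v. v $ 0) ` mat_image (?\<phi> 0) = I" .
  have exact: "mat_image (?\<phi> (Suc i)) = mat_ker (?\<phi> i)" for i
  proof -
    have "mat_image (?\<phi> (Suc i)) \<subseteq> carrier_vec (n (Suc i))" "mat_ker (?\<phi> i) \<subseteq> carrier_vec (n (Suc i))"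
      by (auto simp: mat_image_def mat_ker_def intro!: carrier_vecI)
    moreover have "inj_on (vec_fun :: ('n, 'k) mpoly vec \<Rightarrow> _) (carrier_vec (n (Suc i)))"
      by (auto simp: inj_on_def vec_fun_inj)
    ultimately show ?thesis
      using image[of "Suc i"] kernel[of i] by (metis inj_on_image_eq_iff)
  qed
  have min: "A (Suc i) r c \<in> idl.span (range X)" if "c < n (Suc (Suc i))" for i r c
  proof -
    define e where "e k = (if k = c then 1 else 0 :: ('n, 'k) mpoly)" for k
    have "e \<in> free_mod (n (Suc (Suc i)))" using that by (auto simp: free_mod_def e_def)
    then have "lin (A (Suc i)) (n (Suc (Suc i))) e \<in> N (Suc i)"
      using minimal_presentation.image[OF pres[of "Suc i"]] by blast
    from minimal_presentation.minimal[OF pres this, of r]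
    have "lookup (lin (A (Suc i)) (n (Suc (Suc i))) e r) 0 = 0" .
    moreover have "lin (A (Suc i)) (n (Suc (Suc i))) e r = A (Suc i) r c"
      using that by (simp add: lin_def e_def if_distrib cong: if_cong)
    ultimately show ?thesis by (simp add: span_range_X)
  qed
  show ?thesis
    unfolding minimal_graded_free_resolution_def
    using image0 exact hom hom[of _ 0 0] min by (simp add: start)
qed

text \<open>
  The bound on the degrees of the Koszul homology grows by one with each syzygy module. It keeps
  every syzygy module finitely generated, so no appeal to the noetherian property is needed.
\<close>

theorem minimal_graded_free_resolution_exists:
  fixes I :: "('n::{finite,linorder}, 'k::field) mpoly set"
  assumes I: "graded_submodule (\<lambda>_. 0) 1 (ideal_vecs I)"
    and reg: "\<And>p t. t > int p + E \<Longrightarrow> koszul_exact (\<lambda>_. 0) p t (ideal_vecs I)"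
  shows "\<exists>\<phi> d. minimal_graded_free_resolution I \<phi> d"
proof -
  define good :: "nat \<Rightarrow> nat \<times> (nat \<Rightarrow> int) \<times> (nat \<Rightarrow> ('n, 'k) mpoly) set \<Rightarrow> bool" where
    "good i = (\<lambda>(n, d, N). graded_submodule d n N \<and>
      (\<forall>p t. t > int p + (E + int i) \<longrightarrow> koszul_exact d p t N) \<and>
      (i = 0 \<longrightarrow> (n, d, N) = (1, (\<lambda>_. 0), ideal_vecs I)))" for i
  define step :: "nat \<Rightarrow> nat \<times> (nat \<Rightarrow> int) \<times> (nat \<Rightarrow> ('n, 'k) mpoly) set \<Rightarrow>
      nat \<times> (nat \<Rightarrow> int) \<times> (nat \<Rightarrow> ('n, 'k) mpoly) set \<Rightarrow> bool" where
    "step i = (\<lambda>(n, d, N) (n', d', N'). \<exists>A. minimal_presentation d d' n' A N N' \<and>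
      (\<forall>k l. k \<ge> n \<longrightarrow> l < n' \<longrightarrow> A k l = 0))" for i
  have "\<exists>x. good 0 x" using I reg by (auto simp: good_def)
  moreover have "\<exists>y. good (Suc i) y \<and> step i x y" if x: "good i x" for x i
  proof -
    obtain n d N where [simp]: "x = (n, d, N)" by (cases x)
    have N: "graded_submodule d n N" and ex: "\<And>p t. t > int p + (E + int i) \<Longrightarrow> koszul_exact d p t N"
      using x by (auto simp: good_def)
    obtain n' d' A N' where *: "minimal_presentation d d' n' A N N'" "graded_submodule d' n' N'"
      "\<And>k l. k \<ge> n \<Longrightarrow> l < n' \<Longrightarrow> A k l = 0"
    proof (rule resolution_step[OF N])
      show "koszul_exact d 0 t N" if "t > E + int i" for t
        using that ex[of 0 t] by simp
    qed (rule that)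
    have "koszul_exact d' p t N'" if "t > int p + (E + int (Suc i))" for p t
      using ex[of "Suc p" t] that minimal_presentation.koszul_exact_shift[OF *(1)] by simp
    then have "good (Suc i) (n', d', N')" using *(2) by (simp add: good_def)
    moreover have "step i x (n', d', N')" using *(1,3) by (auto simp: step_def)
    ultimately show ?thesis by blast
  qed
  ultimately obtain f where f: "\<And>i. good i (f i)" "\<And>i. step i (f i) (f (Suc i))"
    using dependent_nat_choice[of good step] by blast
  define n where "n i = fst (f i)" for i
  define d where "d i = fst (snd (f i))" for i
  define N where "N i = snd (snd (f i))" for i
  have f_eq: "f i = (n i, d i, N i)" for i by (simp add: n_def d_def N_def)
  have "\<exists>A. minimal_presentation (d i) (d (Suc i)) (n (Suc i)) A (N i) (N (Suc i)) \<and>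
      (\<forall>k l. k \<ge> n i \<longrightarrow> l < n (Suc i) \<longrightarrow> A k l = 0)" for i
    using f(2)[of i] by (simp add: f_eq step_def)
  then obtain A where A: "\<And>i. minimal_presentation (d i) (d (Suc i)) (n (Suc i)) (A i) (N i) (N (Suc i))"
    "\<And>i k l. k \<ge> n i \<Longrightarrow> l < n (Suc i) \<Longrightarrow> A i k l = 0"
    by metis
  have "n 0 = 1" "d 0 = (\<lambda>_. 0)" "N 0 = ideal_vecs I"
    using f(1)[of 0] by (simp_all add: f_eq good_def)
  from resolution_from_presentations[OF A this] show ?thesis by blast
qed

section \<open>Minimal generators of monomial ideals\<close>

lemma subspace_monomial_ideal: "monomial_ideal I \<Longrightarrow> idl.subspace I"
  unfolding monomial_ideal_def by (auto intro: idl.subspace_span)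

text \<open>Dickson's lemma: in every sequence of exponents some term divides a later one.\<close>

lemma dickson:
  fixes f :: "nat \<Rightarrow> ('n::finite \<Rightarrow>\<^sub>0 nat)"
  obtains i j where "i < j" "f i \<preceq> f j"
proof -
  have "\<exists>g. strict_mono (g :: nat \<Rightarrow> nat) \<and> (\<forall>l\<in>L. \<forall>a b. a \<le> b \<longrightarrow> lookup (f (g a)) l \<le> lookup (f (g b)) l)"
    if "finite L" for L :: "'n set"
    using that
  proof (induction L rule: finite_induct)
    case empty
    then show ?case by (intro exI[of _ id]) (auto simp: strict_mono_def)
  next
    case (insert l L)
    from insert.IH obtain g :: "nat \<Rightarrow> nat" where g: "strict_mono g"
      "\<forall>l\<in>L. \<forall>a b. a \<le> b \<longrightarrow> lookup (f (g a)) l \<le> lookup (f (g b)) l" by (elim exE conjE)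
    define s where "s a = lookup (f (g a)) l" for a
    \<comment> \<open>A sequence of naturals has a nondecreasing subsequence: visit the minimal values of its tails.\<close>
    have "\<exists>h. \<forall>n. (\<forall>m\<ge>h n. s (h n) \<le> s m) \<and> h n < h (Suc n)"
    proof (intro dependent_nat_choice)
      have ex: "\<exists>x. x \<ge> N \<and> (\<forall>m\<ge>x. s x \<le> s m)" for N
      proof -
        obtain x where "x \<ge> N" "\<And>y. y \<ge> N \<Longrightarrow> s x \<le> s y"
          using ex_has_least_nat[of "\<lambda>x. x \<ge> N" N s] by auto
        then show ?thesis by (intro exI[of _ x]) auto
      qed
      show "\<exists>x. \<forall>m\<ge>x. s x \<le> s m" using ex[of 0] by blast
      show "\<exists>y. (\<forall>m\<ge>y. s y \<le> s m) \<and> x < y" for x using ex[of "Suc x"] by (auto simp: Suc_le_eq)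
    qed
    then obtain h where h: "\<And>n m. m \<ge> h n \<Longrightarrow> s (h n) \<le> s m" "\<And>n. h n < h (Suc n)" by blast
    have hm: "strict_mono h" using h(2) by (simp add: strict_mono_Suc_iff)
    have "h a \<le> h b" if "a \<le> b" for a b using hm that by (simp add: strict_mono_less_eq)
    then show ?case
      using g h(1) hm by (intro exI[of _ "g \<circ> h"]) (auto simp: s_def strict_mono_def)
  qed
  from this[of UNIV] obtain g :: "nat \<Rightarrow> nat" where g: "strict_mono g"
    "\<And>l a b. a \<le> b \<Longrightarrow> lookup (f (g a)) l \<le> lookup (f (g b)) l" by auto
  show thesis
    using g(2)[of 0 1] g(1) by (intro that[of "g 0" "g 1"]) (auto simp: exp_dvd_def strict_mono_def)
qed

text \<open>The elements of \<open>A\<close> that are minimal with respect to divisibility.\<close>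

definition min_exps :: "('n \<Rightarrow>\<^sub>0 nat) set \<Rightarrow> ('n \<Rightarrow>\<^sub>0 nat) set" where
  "min_exps A = {u \<in> A. \<forall>v\<in>A. v \<preceq> u \<longrightarrow> v = u}"

lemma finite_min_exps: "finite (min_exps A)" for A :: "('n::finite \<Rightarrow>\<^sub>0 nat) set"
proof (rule ccontr)
  assume "infinite (min_exps A)"
  then obtain f :: "nat \<Rightarrow> _" where f: "inj f" "range f \<subseteq> min_exps A"
    by (meson infinite_countable_subset)
  obtain i j where "i < j" "f i \<preceq> f j" by (rule dickson)
  moreover have "f i \<in> A" "f j \<in> min_exps A" using f(2) by (auto simp: min_exps_def)
  ultimately have "f i = f j" by (simp add: min_exps_def)
  then show False using f(1) \<open>i < j\<close> by (auto dest: injD)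
qed

lemma min_exps_below:
  fixes A :: "('n::finite \<Rightarrow>\<^sub>0 nat) set"
  assumes "u \<in> A"
  obtains g where "g \<in> min_exps A" "g \<preceq> u"
proof -
  obtain g where g: "g \<in> A \<and> g \<preceq> u" "\<And>v. v \<in> A \<and> v \<preceq> u \<Longrightarrow> mdeg g \<le> mdeg v"
    using ex_has_least_nat[of "\<lambda>v. v \<in> A \<and> v \<preceq> u" u mdeg] assms by auto
  have "g \<in> min_exps A"
    using g exp_dvd_trans exp_dvd_mdeg_eq unfolding min_exps_def by blast
  then show thesis using g(1) that by blast
qed

lemma min_generators_eq:
  fixes I :: "('n::finite, 'k::field) mpoly set"
  assumes I: "monomial_ideal I"
  shows "min_generators I = min_exps (exps I)"
proof -
  have gen_iff: "I = idl.span (mon ` G) \<longleftrightarrow> exps I = {u. \<exists>g\<in>G. g \<preceq> u}" for G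
  proof
    assume "exps I = {u. \<exists>g\<in>G. g \<preceq> u}"
    then show "I = idl.span (mon ` G)"
      using in_monomial_ideal_iff[OF I] unfolding span_mon_conv by blast
  qed (simp add: exps_span_mon)
  have up: "up_closed (exps I)" using I by (rule up_closed_exps)
  have gen: "exps I = {u. \<exists>g\<in>min_exps (exps I). g \<preceq> u}"
  proof
    show "exps I \<subseteq> {u. \<exists>g\<in>min_exps (exps I). g \<preceq> u}"
      by (auto elim: min_exps_below)
    show "{u. \<exists>g\<in>min_exps (exps I). g \<preceq> u} \<subseteq> exps I"
      using up_closedD[OF up] by (auto simp: min_exps_def)
  qed
  have sub: "min_exps (exps I) \<subseteq> G" if G: "exps I = {u. \<exists>g\<in>G. g \<preceq> u}" for G
  proof
    fix u assume u: "u \<in> min_exps (exps I)"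
    then have "u \<in> exps I" by (simp add: min_exps_def)
    then obtain g where g: "g \<in> G" "g \<preceq> u" using G by auto
    then have "g \<in> exps I" using G exp_dvd_refl by blast
    then have "g = u" using u g(2) by (auto simp: min_exps_def)
    then show "u \<in> G" using g(1) by simp
  qed
  show ?thesis
    unfolding min_generators_def gen_iff
  proof (rule the_equality)
    show "exps I = {u. \<exists>g\<in>min_exps (exps I). g \<preceq> u} \<and>
      (\<forall>G'\<subset>min_exps (exps I). exps I \<noteq> {u. \<exists>g\<in>G'. g \<preceq> u})"
      using gen sub by blast
    fix G assume "exps I = {u. \<exists>g\<in>G. g \<preceq> u} \<and> (\<forall>G'\<subset>G. exps I \<noteq> {u. \<exists>g\<in>G'. g \<preceq> u})"
    then show "G = min_exps (exps I)"
      using gen sub[of G] by blast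
  qed
qed

lemma exps_nonempty:
  assumes "monomial_ideal I" "I \<noteq> {0}"
  shows "exps I \<noteq> {}"
  using in_monomial_ideal_iff[OF assms(1)] assms(2) idl.subspace_0[OF subspace_monomial_ideal[OF assms(1)]]
  by fastforce

lemma mdeg_le_max_gen_degree:
  fixes I :: "('n::finite, 'k::field) mpoly set"
  assumes "monomial_ideal I" "g \<in> min_exps (exps I)"
  shows "mdeg g \<le> max_gen_degree I"
  unfolding max_gen_degree_def min_generators_eq[OF assms(1)]
  using assms(2) finite_min_exps by (intro Max_ge) auto

lemma max_gen_degree_attained:
  fixes I :: "('n::finite, 'k::field) mpoly set"
  assumes "monomial_ideal I" "I \<noteq> {0}"
  obtains g where "g \<in> min_exps (exps I)" "mdeg g = max_gen_degree I"
proof -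
  have "min_exps (exps I) \<noteq> {}"
    using exps_nonempty[OF assms] min_exps_below by blast
  then have "max_gen_degree I \<in> mdeg ` min_exps (exps I)"
    unfolding max_gen_degree_def min_generators_eq[OF assms(1)]
    using finite_min_exps by (intro Max_in) auto
  then show thesis using that by auto
qed

section \<open>Stable truncations and the Koszul homology of a monomial ideal\<close>

text \<open>
  The criterion to which stability of the truncation at \<open>e\<close> is equivalent, for the order of the
  variables pulled back along \<open>\<sigma>\<close>. It says that \<open>x_i\<close> is a nonzerodivisor in degrees at least \<open>e\<close>
  modulo \<open>I\<close> and the variables after \<open>x_i\<close>.
\<close>

definition bayer_stillman :: "('n \<Rightarrow> 'n::linorder) \<Rightarrow> ('n \<Rightarrow>\<^sub>0 nat) set \<Rightarrow> nat \<Rightarrow> bool" where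
  "bayer_stillman \<sigma> A e \<longleftrightarrow> (\<forall>i w. (\<forall>k\<in>keys w. \<sigma> k \<le> \<sigma> i) \<longrightarrow> e \<le> mdeg w \<longrightarrow>
     w + single i 1 \<in> A \<longrightarrow> w \<in> A)"

text \<open>
  Borel type, on exponents and for the order of the variables pulled back along \<open>\<sigma>\<close>: the
  saturation of \<open>I\<close> by \<open>x_i\<close> is contained in its saturation by each earlier variable \<open>x_j\<close>.
\<close>

definition borel_exps :: "('n \<Rightarrow> 'n::linorder) \<Rightarrow> ('n \<Rightarrow>\<^sub>0 nat) set \<Rightarrow> bool" where
  "borel_exps \<sigma> A \<longleftrightarrow> (\<forall>i j w k. \<sigma> j \<le> \<sigma> i \<longrightarrow> w + single i k \<in> A \<longrightarrow> (\<exists>l. w + single j l \<in> A))"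

lemma in_max_var: "u \<noteq> 0 \<Longrightarrow> max_var u \<in> keys u" and le_max_var: "k \<in> keys u \<Longrightarrow> k \<le> max_var u"
  by (auto simp: max_var_def)

lemma exps_truncation: "monomial_ideal J \<Longrightarrow> exps (truncation J e) = {u \<in> exps J. e \<le> mdeg u}"
  for J :: "('n::finite, 'k::field) mpoly set"
  unfolding truncation_def exps_span_mon
  using up_closedD[OF up_closed_exps[of J]] by (auto simp: exps_def intro: le_trans mdeg_mono)

theorem stable_truncation_iff:
  fixes J :: "('n::{finite,linorder}, 'k::field) mpoly set"
  assumes J: "monomial_ideal J" and gen: "\<And>g. g \<in> min_exps (exps J) \<Longrightarrow> mdeg g \<le> e"
  shows "stable_ideal (truncation J e) \<longleftrightarrow> bayer_stillman id (exps J) e"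
proof -
  note up = up_closedD[OF up_closed_exps[OF J]]
  have mem: "mon u \<in> truncation J e \<longleftrightarrow> u \<in> exps J \<and> e \<le> mdeg u" for u
    using exps_truncation[OF J, of e] by (auto simp: exps_def)
  have "monomial_ideal (truncation J e)"
    by (auto simp: monomial_ideal_def truncation_def)
  then have stable: "stable_ideal (truncation J e) \<longleftrightarrow> (\<forall>u j. u \<in> exps J \<longrightarrow> e \<le> mdeg u \<longrightarrow> u \<noteq> 0 \<longrightarrow>
      j < max_var u \<longrightarrow> single j 1 + (u - single (max_var u) 1) \<in> exps J \<and>
      e \<le> mdeg (single j 1 + (u - single (max_var u) 1)))"
    unfolding stable_ideal_def mem by auto
  show ?thesis
  proof
    assume st: "stable_ideal (truncation J e)"
    show "bayer_stillman id (exps J) e"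
      unfolding bayer_stillman_def id_apply
    proof (intro allI impI)
      fix i :: 'n and w
      assume w: "\<forall>k\<in>keys w. k \<le> i" "e \<le> mdeg w" "w + single i 1 \<in> exps J"
      obtain g where g: "g \<in> min_exps (exps J)" "g \<preceq> w + single i 1"
        using w(3) by (rule min_exps_below)
      \<comment> \<open>As \<open>x_i w\<close> has degree above \<open>e\<close>, it is not a minimal generator and has a divisor \<open>u\<close> in \<open>J\<close> of degree one less.\<close>
      have "g \<noteq> w + single i 1"
        using gen[OF g(1)] w(2) by (auto simp: mdeg_add)
      then obtain k where "lookup g k \<noteq> lookup (w + single i 1) k"
        by (metis poly_mapping_eqI)
      then have k: "lookup g k < lookup (w + single i 1) k"
        using g(2) by (simp add: exp_dvd_def order_less_le)
      define u where "u = w + single i 1 - single k 1"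
      have k_keys: "k \<in> keys (w + single i 1)" using k by (simp add: in_keys_iff)
      then have u_add: "single k 1 + u = w + single i 1"
        unfolding u_def by (intro exp_dvd_add_diff) simp
      have "lookup g l \<le> lookup u l" for l
        using g(2) k by (cases "l = k") (auto simp: u_def exp_dvd_def lookup_minus lookup_single)
      then have "g \<preceq> u" by (simp add: exp_dvd_def)
      then have u: "u \<in> exps J" using up g(1) by (auto simp: min_exps_def)
      show "w \<in> exps J"
      proof (cases "k = i")
        case True
        then show ?thesis using u by (simp add: u_def)
      next
        case False
        then have ki: "k < i"
        proof -
          have "k \<in> keys w" using k_keys False by (simp add: in_keys_iff lookup_add lookup_single)
          then show ?thesis using w(1) False by (simp add: order_less_le)
        qed
        have mdu: "mdeg u = mdeg w"
          using arg_cong[OF u_add, of mdeg] by (simp add: mdeg_add)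
        have iu: "i \<in> keys u"
          using False by (simp add: u_def in_keys_iff lookup_add lookup_minus lookup_single)
        moreover have "l \<le> i" if "l \<in> keys u" for l
          using that w(1) by (auto simp: u_def in_keys_iff lookup_add lookup_minus lookup_single when_def split: if_splits)
        ultimately have "max_var u = i"
          unfolding max_var_def by (intro Max_eqI) auto
        moreover have "u \<noteq> 0" using iu by auto
        ultimately have "single k 1 + (u - single i 1) \<in> exps J"
          using st u w(2) ki mdu unfolding stable by auto
        moreover have "single k 1 + (u - single i 1) = w"
        proof -
          have "single i 1 + (u - single i 1) = u" using iu by (intro exp_dvd_add_diff) simp
          then have "single i 1 + (single k 1 + (u - single i 1)) = single i 1 + w"
            using u_add by (metis add.left_commute add.commute)
          then show ?thesis by simp
        qed
        ultimately show ?thesis by simp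
      qed
    qed
  next
    assume bs: "bayer_stillman id (exps J) e"
    show "stable_ideal (truncation J e)"
      unfolding stable
    proof (intro allI impI)
      fix u j assume u: "u \<in> exps J" "e \<le> mdeg u" "u \<noteq> 0" "j < max_var u"
      define w where "w = single j 1 + (u - single (max_var u) 1)"
      have md: "mdeg w = mdeg u"
        unfolding w_def using mdeg_Suc_diff_single[OF in_max_var[OF u(3)]] by (simp add: mdeg_add)
      have "\<forall>k\<in>keys w. k \<le> max_var u"
        using u(4) le_max_var[of _ u]
        by (auto simp: w_def in_keys_iff lookup_add lookup_minus lookup_single when_def split: if_splits)
      moreover have "w + single (max_var u) 1 = single j 1 + u"
        using exp_dvd_add_diff(2)[of "single (max_var u) 1" u] in_max_var[OF u(3)]
        by (simp add: w_def add.assoc)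
      then have "w + single (max_var u) 1 \<in> exps J"
        using up[OF u(1)] by simp
      ultimately have "w \<in> exps J"
        using bs u(2) md unfolding bayer_stillman_def by auto
      then show "single j 1 + (u - single (max_var u) 1) \<in> exps J \<and>
          e \<le> mdeg (single j 1 + (u - single (max_var u) 1))"
        using md u(2) by (simp add: w_def)
    qed
  qed
qed

text \<open>
  Exponents beyond the degrees of the minimal generators do not influence membership.
\<close>

lemma in_exps_of_large_exponent:
  fixes I :: "('n::finite, 'k::field) mpoly set"
  assumes I: "monomial_ideal I" and A: "w + single j k \<in> exps I" and D: "max_gen_degree I \<le> lookup w j"
  shows "w \<in> exps I"
proof -
  obtain g where g: "g \<in> min_exps (exps I)" "g \<preceq> w + single j k"
    using A by (rule min_exps_below)
  have "lookup g l \<le> lookup w l" for l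
  proof (cases "l = j")
    case True
    have "lookup g j \<le> mdeg g"
      unfolding mdeg_conv_sum by (intro member_le_sum) auto
    also have "\<dots> \<le> lookup w j" using mdeg_le_max_gen_degree[OF I g(1)] D by simp
    finally show ?thesis using True by simp
  next
    case False
    then show ?thesis using g(2) by (auto simp: exp_dvd_def lookup_add lookup_single when_def dest: spec[of _ l])
  qed
  then have "g \<preceq> w" by (simp add: exp_dvd_def)
  then show ?thesis using up_closedD[OF up_closed_exps[OF I]] g(1) by (auto simp: min_exps_def)
qed

text \<open>
  In a violation \<open>w\<close> of the criterion every exponent is at most the largest degree \<open>D\<close> of a minimal
  generator, so the degree of \<open>w\<close> is bounded by \<open>n D\<close>.
\<close>

lemma borel_exps_bayer_stillman:
  fixes I :: "('n::{finite,linorder}, 'k::field) mpoly set"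
  assumes I: "monomial_ideal I" and borel: "borel_exps \<sigma> (exps I)"
  shows "\<exists>e\<ge>max_gen_degree I. bayer_stillman \<sigma> (exps I) e"
proof -
  let ?D = "max_gen_degree I"
  have "bayer_stillman \<sigma> (exps I) (Suc (CARD('n) * ?D) + ?D)"
    unfolding bayer_stillman_def
  proof (intro allI impI)
    fix i w
    assume w: "\<forall>k\<in>keys w. \<sigma> k \<le> \<sigma> i" "Suc (CARD('n) * ?D) + ?D \<le> mdeg w" "w + single i 1 \<in> exps I"
    show "w \<in> exps I"
    proof (rule ccontr)
      assume no: "w \<notin> exps I"
      have "lookup w j \<le> ?D" for j
      proof (cases "j \<in> keys w")
        case True
        then obtain l where "w + single j l \<in> exps I"
          using borel w(1,3) unfolding borel_exps_def by blast
        then show ?thesis using in_exps_of_large_exponent[OF I] no by (meson nat_le_linear)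
      qed (simp add: in_keys_iff)
      then have "mdeg w \<le> CARD('n) * ?D"
        unfolding mdeg_conv_sum using sum_bounded_above[of UNIV "lookup w" ?D] by simp
      then show False using w(2) by simp
    qed
  qed
  then show ?thesis by (intro exI[of _ "Suc (CARD('n) * ?D) + ?D"]) simp
qed

text \<open>
  The contracting homotopy whose apex at \<open>a\<close> is the last variable dividing \<open>x^a\<close> preserves chains with
  coefficients in \<open>I\<close>, by the criterion.
\<close>

theorem bayer_stillman_koszul_exact:
  fixes I :: "('n::{finite,linorder}, 'k::field) mpoly set"
  assumes I: "monomial_ideal I" and bs: "bayer_stillman \<sigma> (exps I) e" and t: "t > int p + int e"
  shows "koszul_exact (\<lambda>_. 0) p t (ideal_vecs I)"
  unfolding koszul_exact_def
proof (intro allI impI)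
  fix c assume c: "kchain p (ideal_vecs I) c" "khom (\<lambda>_. 0) (t - int p) c" "\<forall>k. bd (c k) = (\<lambda>_. 0)"
  have "\<exists>m. m \<in> keys a \<and> (\<forall>k\<in>keys a. \<sigma> k \<le> \<sigma> m)" if "a \<noteq> 0" for a :: "'n \<Rightarrow>\<^sub>0 nat"
  proof -
    have "Max (\<sigma> ` keys a) \<in> \<sigma> ` keys a" using that by (intro Max_in) auto
    then obtain m where "m \<in> keys a" "\<sigma> m = Max (\<sigma> ` keys a)" by auto
    then show ?thesis by (intro exI[of _ m]) auto
  qed
  note ex = this
  define M where "M a = (SOME m. m \<in> keys a \<and> (\<forall>k\<in>keys a. \<sigma> k \<le> \<sigma> m))" for a :: "'n \<Rightarrow>\<^sub>0 nat"
  have M: "M a \<in> keys a" "\<And>k. k \<in> keys a \<Longrightarrow> \<sigma> k \<le> \<sigma> (M a)" if "a \<noteq> 0" for a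
    using someI_ex[OF ex[OF that]] unfolding M_def by simp_all
  define b where "b k = khomot M (c k)" for k
  have "bd (b k) = c k" for k
    unfolding b_def
  proof (rule bd_khomot)
    have "homogeneous (t - int p) (c k {})" using c(2) by (simp add: khom_def vhom_def)
    then show "lookup (c k {}) 0 = 0" using t by (auto intro: lookup_0_homogeneous)
  qed (use c(3) M(1) in auto)
  moreover have "kchain (Suc p) (ideal_vecs I) b"
  proof -
    have "kchain p (free_mod 1) c" using c(1) by (auto simp: kchain_def ideal_vecs_def)
    from kchain_khomot[OF this] have free: "kchain (Suc p) (free_mod 1) b" by (simp add: b_def[abs_def])
    have "b 0 \<tau> \<in> I" for \<tau>
      unfolding in_monomial_ideal_iff[OF I]
    proof
      fix u assume "u \<in> keys (b 0 \<tau>)"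
      then have u: "u \<in> keys (khomot M (c 0) \<tau>)" by (simp add: b_def)
      define m where "m = M (u + ind \<tau>)"
      have um: "u + single m 1 \<in> keys (c 0 (\<tau> - {m}))"
        using keys_khomotD(3)[OF u] by (simp add: m_def)
      have "c 0 (\<tau> - {m}) \<in> I" using c(1) by (simp add: kchain_def ideal_vecs_def)
      then have "u + single m 1 \<in> exps I" using um in_monomial_ideal_iff[OF I] by blast
      moreover have "int (mdeg (u + single m 1)) = t - int p"
        using c(2) um unfolding khom_def vhom_def homogeneous_def by force
      then have "e \<le> mdeg u" using t by (simp add: mdeg_add)
      moreover have "\<sigma> k \<le> \<sigma> m" if "k \<in> keys u" for k
        unfolding m_def using that by (intro M(2) keys_khomotD(1)[OF u]) (simp add: in_keys_iff lookup_add)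
      ultimately show "u \<in> exps I" using bs unfolding bayer_stillman_def by blast
    qed
    then show ?thesis using free by (simp add: kchain_def ideal_vecs_def)
  qed
  ultimately show "\<exists>b. kchain (Suc p) (ideal_vecs I) b \<and> (\<forall>k. bd (b k) = c k)" by blast
qed

lemma X_times_mon: "X i * mon u = mon (single i 1 + u)"
  by (simp add: X_def mon_def mult_single)

text \<open>
  A violation \<open>w\<close> of the criterion at \<open>x_i\<close> has a multiple \<open>v\<close> in the variables \<open>T\<close> up to \<open>x_i\<close> that is
  maximal outside \<open>I\<close>. The boundary of \<open>x^v e_T\<close> has coefficients in \<open>I\<close>, but a chain with coefficients
  in \<open>I\<close> that bounds it would have to be \<open>x^v e_T\<close> itself at the exponent \<open>v + ind T\<close>.
\<close>

theorem not_bayer_stillman_not_koszul_exact: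
  fixes I :: "('n::{finite,linorder}, 'k::field) mpoly set"
  assumes I: "monomial_ideal I" and borel: "borel_exps \<sigma> (exps I)" and bs: "\<not> bayer_stillman \<sigma> (exps I) e"
  obtains p t where "t > int p + int e" "\<not> koszul_exact (\<lambda>_. 0) p t (ideal_vecs I)"
proof -
  note up = up_closedD[OF up_closed_exps[OF I]]
  note sub = subspace_monomial_ideal[OF I]
  obtain i w where w: "\<And>k. k \<in> keys w \<Longrightarrow> \<sigma> k \<le> \<sigma> i" "e \<le> mdeg w" "w + single i 1 \<in> exps I" "w \<notin> exps I"
    using bs unfolding bayer_stillman_def by blast
  define T where "T = {j. \<sigma> j \<le> \<sigma> i}"
  have iT: "i \<in> T" by (simp add: T_def)
  have "\<exists>l. j \<in> T \<longrightarrow> w + single j l \<in> exps I" for j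
    using borel w(3) unfolding borel_exps_def T_def by blast
  then obtain l where l: "\<And>j. j \<in> T \<Longrightarrow> w + single j (l j) \<in> exps I" by metis
  define W where "W v \<longleftrightarrow> w \<preceq> v \<and> keys v \<subseteq> T \<and> v \<notin> exps I" for v
  have bound: "mdeg v \<le> (\<Sum>j\<in>UNIV. lookup w j + l j)" if v: "W v" for v
    unfolding mdeg_conv_sum
  proof (intro sum_mono)
    fix j
    show "lookup v j \<le> lookup w j + l j"
    proof (rule ccontr)
      assume "\<not> lookup v j \<le> lookup w j + l j"
      then have gt: "lookup w j + l j < lookup v j" by simp
      then have "j \<in> T" using v by (auto simp: W_def in_keys_iff)
      moreover have "w + single j (l j) \<preceq> v"
        using v gt by (auto simp: W_def exp_dvd_def lookup_add lookup_single when_def)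
      ultimately show False using up[OF l] v by (auto simp: W_def)
    qed
  qed
  have "W w" using w by (auto simp: W_def T_def)
  \<comment> \<open>The candidates have bounded degree, as a power of each variable in \<open>T\<close> multiplies \<open>w\<close> into \<open>I\<close>.\<close>
  then obtain v where v: "W v" and vmax: "\<And>v'. W v' \<Longrightarrow> mdeg v' \<le> mdeg v"
    using ex_has_greatest_nat[of W w mdeg] bound by (metis le_imp_less_Suc)
  have v_in: "v + single j 1 \<in> exps I" if "j \<in> T" for j
  proof (rule ccontr)
    assume "v + single j 1 \<notin> exps I"
    moreover have "w \<preceq> v + single j 1" using v exp_dvd_trans[of w v] by (simp add: W_def)
    moreover have "keys (v + single j 1) \<subseteq> T"
      using v that keys_add[of v "single j 1"] by (auto simp: W_def)
    ultimately have "W (v + single j 1)" by (simp add: W_def)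
    from vmax[OF this] show False by (simp add: mdeg_add)
  qed
  have vI: "v \<notin> exps I" and vT: "keys v \<subseteq> T" and wv: "w \<preceq> v" using v by (auto simp: W_def)
  define p where "p = card T - 1"
  have cardT: "card T = Suc p" using iT by (simp add: p_def card_gt_0_iff) (metis Suc_pred card_gt_0_iff empty_iff finite)
  define t where "t = int (mdeg v) + int (card T)"
  define g where "g k \<tau> = (if k = (0::nat) \<and> \<tau> = T then mon v else 0 :: ('n, 'k) mpoly)" for k \<tau>
  have g: "kchain (Suc p) (free_mod 1) g" "khom (\<lambda>_. 0) (int (mdeg v)) g"
    using cardT by (auto simp: kchain_def free_mod_def g_def khom_def vhom_def mon_def homogeneous_single)
  have "kchain p (ideal_vecs I) (\<lambda>k. bd (g k))"
  proof -
    have "bd (g 0) \<tau> \<in> I" for \<tau>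
    proof -
      have "X i * g 0 (insert i \<tau>) \<in> I" for i
      proof (cases "insert i \<tau> = T")
        case True
        then show ?thesis using v_in[of i] by (auto simp: g_def X_times_mon exps_def add.commute)
      next
        case False
        then show ?thesis using idl.subspace_0[OF sub] by (simp add: g_def)
      qed
      then show ?thesis
        unfolding bd_def by (intro idl.subspace_sum[OF sub] idl.subspace_scale[OF sub, of "X _ * _"])
    qed
    then show ?thesis
      using kchain_bd[OF subspace_free_mod g(1)] by (simp add: kchain_def ideal_vecs_def)
  qed
  moreover have "khom (\<lambda>_. 0) (t - int p) (\<lambda>k. bd (g k))"
    using khom_bd[OF g(2)] cardT by (simp add: t_def)
  moreover have False if b: "kchain (Suc p) (ideal_vecs I) b" "\<And>k. bd (b k) = bd (g k)" for b
  proof -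
    define a where "a = v + ind T"
    have keys_a: "keys a = T"
    proof -
      have "keys a \<subseteq> keys v \<union> keys (ind T)" unfolding a_def by (rule keys_add)
      moreover have "T \<subseteq> keys a" by (auto simp: a_def in_keys_iff lookup_add lookup_ind)
      ultimately show ?thesis using vT by auto
    qed
    have "slice a (b 0) \<tau> = 0" for \<tau>
    proof (cases "\<tau> = T")
      case True
      have "b 0 T \<in> I" using b(1) by (simp add: kchain_def ideal_vecs_def)
      then have "v \<notin> keys (b 0 T)" using vI in_monomial_ideal_iff[OF I] by blast
      then show ?thesis using True by (simp add: slice_def a_def in_keys_iff)
    next
      case False
      then have "card \<tau> \<noteq> Suc p" if "\<tau> \<subseteq> T"
        using that cardT by (metis card_subset_eq finite)
      then show ?thesis using b(1) keys_a by (auto simp: slice_def kchain_def)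
    qed
    then have slice_b: "slice a (b 0) = (\<lambda>_. 0)" by auto
    have "kdiff (slice a (g 0)) = kdiff (slice a (b 0))"
      using b(2)[of 0] by (simp flip: slice_bd)
    then have "kdiff (slice a (g 0)) (T - {i}) = 0" by (simp add: slice_b)
    moreover have "kdiff (slice a (g 0)) (T - {i}) =
        (\<Sum>m\<in>-(T - {i}). if m = i then ksgn i (T - {i}) else 0)"
      unfolding kdiff_def
    proof (rule sum.cong)
      fix m assume m: "m \<in> - (T - {i})"
      show "ksgn m (T - {i}) * slice a (g 0) (insert m (T - {i})) = (if m = i then ksgn i (T - {i}) else 0)"
      proof (cases "m = i")
        case True
        then have "insert m (T - {i}) = T" using iT by auto
        then show ?thesis using True keys_a by (simp add: slice_def g_def a_def mon_def)
      next
        case False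
        then have "insert m (T - {i}) \<noteq> T" using iT by auto
        then show ?thesis using False by (simp add: slice_def g_def)
      qed
    qed simp
    ultimately have "ksgn i (T - {i}) = (0 :: 'k)" by simp
    then show False using ksgn_square[of i "T - {i}", where ?'a = 'k] by simp
  qed
  ultimately have "\<not> koszul_exact (\<lambda>_. 0) p t (ideal_vecs I)"
    unfolding koszul_exact_def using bd_bd by blast
  moreover have "t > int p + int e"
    using w(2) mdeg_mono[OF wv] cardT by (simp add: t_def)
  ultimately show thesis using that by blast
qed

lemma min_exps_not_koszul_exact:
  fixes I :: "('n::{finite,linorder}, 'k::field) mpoly set"
  assumes I: "monomial_ideal I" and g: "g \<in> min_exps (exps I)"
    and sub: "vecs.subspace (ideal_vecs I)"
  shows "\<not> koszul_exact (\<lambda>_. 0) 0 (int (mdeg g)) (ideal_vecs I)"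
proof
  assume ex: "koszul_exact (\<lambda>_. 0) 0 (int (mdeg g)) (ideal_vecs I)"
  define v where "v k = (if k = 0 then mon g else 0 :: ('n, 'k) mpoly)" for k :: nat
  have "v \<in> ideal_vecs I" using g by (auto simp: v_def ideal_vecs_def free_mod_def min_exps_def exps_def)
  moreover have "vhom (\<lambda>_. 0) (int (mdeg g)) v"
    by (simp add: vhom_def v_def mon_def homogeneous_single)
  ultimately obtain w where w: "\<And>i. w i \<in> ideal_vecs I" and vw: "v = (\<lambda>k. \<Sum>i\<in>UNIV. X i * w i k)"
    using ex unfolding koszul_exact_0_iff[OF sub] by blast
  have "(1 :: 'k) = lookup (v 0) g" by (simp add: v_def mon_def)
  also have "\<dots> = (\<Sum>i\<in>UNIV. lookup (X i * w i 0) g)" unfolding vw by (simp add: lookup_sum)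
  finally obtain i where "lookup (X i * w i 0) g \<noteq> 0"
    by (metis (mono_tags, lifting) sum.neutral zero_neq_one)
  then have i: "i \<in> keys g" "g - single i 1 \<in> keys (w i 0)"
    by (auto simp: lookup_X_times in_keys_iff split: if_splits)
  have "w i 0 \<in> I" using w[of i] by (simp add: ideal_vecs_def)
  then have "g - single i 1 \<in> exps I" using i(2) in_monomial_ideal_iff[OF I] by blast
  moreover have "g - single i 1 \<preceq> g" by (simp add: exp_dvd_def lookup_minus)
  ultimately have "g - single i 1 = g" using g by (simp add: min_exps_def)
  then show False using mdeg_Suc_diff_single[OF i(1)] by simp
qed

lemma koszul_exact_negative:
  fixes N :: "(nat \<Rightarrow> ('n::{finite,linorder}, 'k::field) mpoly) set"
  assumes N: "vecs.subspace N" and t: "t < int p"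
  shows "koszul_exact (\<lambda>_. 0) p t N"
  unfolding koszul_exact_def
proof (intro allI impI)
  fix c :: "nat \<Rightarrow> 'n set \<Rightarrow> ('n, 'k) mpoly"
  assume c: "khom (\<lambda>_. 0) (t - int p) c"
  have "keys (c k \<tau>) = {}" for k \<tau>
    using c t unfolding khom_def vhom_def homogeneous_def by force
  then have "c k = (\<lambda>_. 0)" for k by auto
  then have "bd ((\<lambda>_ _. 0) k) = c k" for k by simp
  moreover have "kchain (Suc p) N (\<lambda>_ _. 0)"
    using vecs.subspace_0[OF N] by (simp add: kchain_def zero_fun_def)
  ultimately show "\<exists>b. kchain (Suc p) N b \<and> (\<forall>k. bd (b k) = c k)" by blast
qed

lemma graded_ideal_vecs:
  fixes I :: "('n::{finite,linorder}, 'k::field) mpoly set"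
  assumes I: "monomial_ideal I"
  shows "graded_submodule (\<lambda>_. 0) 1 (ideal_vecs I)"
  unfolding graded_submodule_def
proof (intro conjI ballI allI)
  note sub = subspace_monomial_ideal[OF I]
  show "vecs.subspace (ideal_vecs I)"
    using subspace_free_mod[of 1] idl.subspace_0[OF sub] idl.subspace_add[OF sub] idl.subspace_scale[OF sub]
    unfolding vecs.subspace_def ideal_vecs_def by (auto simp: smul_def)
  show "ideal_vecs I \<subseteq> free_mod 1" by (auto simp: ideal_vecs_def)
  fix v t assume v: "v \<in> ideal_vecs I"
  then have "keys (hcomp t (v 0)) \<subseteq> exps I"
    using in_monomial_ideal_iff[OF I] by (auto simp: ideal_vecs_def hcomp_def keys_restr)
  then have "vcomp (\<lambda>_. 0) t v 0 \<in> I"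
    using in_monomial_ideal_iff[OF I] by (simp add: vcomp_def)
  moreover have "vcomp (\<lambda>_. 0) t v \<in> free_mod 1"
    using v by (intro vcomp_free_mod) (simp add: ideal_vecs_def)
  ultimately show "vcomp (\<lambda>_. 0) t v \<in> ideal_vecs I" by (simp add: ideal_vecs_def)
qed

text \<open>
  Both inequalities: the criterion at \<open>e\<close> bounds the regularity by \<open>e\<close>, and at the regularity itself
  the criterion must hold, since otherwise there would be Koszul homology of larger degree.
\<close>

theorem regularity_bayer_stillman:
  fixes I :: "('n::{finite,linorder}, 'k::field) mpoly set"
  assumes I: "monomial_ideal I" and nz: "I \<noteq> {0}" and borel: "borel_exps \<sigma> (exps I)"
  shows "regularity I = int (LEAST e. e \<ge> max_gen_degree I \<and> bayer_stillman \<sigma> (exps I) e)"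
proof -
  define e where "e = (LEAST e. e \<ge> max_gen_degree I \<and> bayer_stillman \<sigma> (exps I) e)"
  have e: "e \<ge> max_gen_degree I" "bayer_stillman \<sigma> (exps I) e"
    using borel_exps_bayer_stillman[OF I borel]
      LeastI_ex[of "\<lambda>e. e \<ge> max_gen_degree I \<and> bayer_stillman \<sigma> (exps I) e"]
    unfolding e_def by blast+
  have e_le: "e \<le> e'" if "e' \<ge> max_gen_degree I" "bayer_stillman \<sigma> (exps I) e'" for e'
    unfolding e_def using that by (intro Least_le) simp
  note gr = graded_ideal_vecs[OF I]
  have sub: "vecs.subspace (ideal_vecs I)" using gr by (simp add: graded_submodule_def)
  have exact: "koszul_exact (\<lambda>_. 0) p t (ideal_vecs I)" if "t > int p + int e" for p t
    using I e(2) that by (rule bayer_stillman_koszul_exact)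
  define S where "S = {t - int p | p t. \<not> koszul_exact (\<lambda>_. 0) p t (ideal_vecs I)}"
  have res: "\<exists>\<phi> d. minimal_graded_free_resolution I \<phi> d"
    using gr exact by (rule minimal_graded_free_resolution_exists)
  have reg: "regularity I = Max S"
    unfolding regularity_def betti_nonzero_iff[OF res] S_def by simp
  have S: "S \<subseteq> {0..int e}"
  proof
    fix s assume "s \<in> S"
    then obtain p t where s: "s = t - int p" "\<not> koszul_exact (\<lambda>_. 0) p t (ideal_vecs I)"
      by (auto simp: S_def)
    have "t \<ge> int p" using koszul_exact_negative[OF sub, of t p] s(2) by linarith
    moreover have "t \<le> int p + int e" using exact[of p t] s(2) by linarith
    ultimately show "s \<in> {0..int e}" by (simp add: s(1))
  qed
  then have fin: "finite S" by (rule finite_subset) simp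
  obtain g where g: "g \<in> min_exps (exps I)" "mdeg g = max_gen_degree I"
    by (rule max_gen_degree_attained[OF I nz])
  have "int (mdeg g) \<in> S"
    unfolding S_def using min_exps_not_koszul_exact[OF I g(1) sub] by force
  then have ge: "Max S \<ge> int (max_gen_degree I)" and ne: "S \<noteq> {}"
    using fin g(2) by auto
  define m where "m = nat (Max S)"
  have m: "Max S = int m" using ge by (simp add: m_def)
  have "bayer_stillman \<sigma> (exps I) m"
  proof (rule ccontr)
    assume "\<not> bayer_stillman \<sigma> (exps I) m"
    from not_bayer_stillman_not_koszul_exact[OF I borel this]
    obtain p t where pt: "t > int p + int m" "\<not> koszul_exact (\<lambda>_. 0) p t (ideal_vecs I)" by blast
    then have "t - int p \<in> S" by (auto simp: S_def)
    then have "t - int p \<le> Max S" using fin by simp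
    then show False using pt(1) m by simp
  qed
  then have "e \<le> m" using ge m by (intro e_le) simp_all
  moreover have "Max S \<le> int e" using Max_in[OF fin ne] S by auto
  ultimately show ?thesis unfolding reg m e_def[symmetric] using m by simp
qed

section \<open>Renumbering the variables\<close>

lemma exps_span_mon_up_closed: "up_closed B \<Longrightarrow> exps (idl.span (mon ` B :: ('n, 'k::field) mpoly set)) = B"
  unfolding exps_span_mon using up_closedD[of B] exp_dvd_refl by blast

lemma truncation_cong: "exps J = exps J' \<Longrightarrow> truncation J e = truncation J' e"
  unfolding truncation_def exps_def by (metis mem_Collect_eq)

context
  fixes \<sigma> :: "'n::{finite,linorder} \<Rightarrow> 'n"
  assumes bij: "bij \<sigma>"
begin

lemma lookup_map_key: "lookup (Poly_Mapping.map_key \<sigma> u) i = lookup u (\<sigma> i)"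
  using bij by (simp add: map_key.rep_eq bij_is_inj)

lemma map_key_surj: "\<exists>w'. w = Poly_Mapping.map_key \<sigma> w'" for w :: "'n \<Rightarrow>\<^sub>0 nat"
proof
  let ?\<tau> = "inv_into UNIV \<sigma>"
  have "inj ?\<tau>" using bij by (simp add: bij_imp_bij_inv bij_is_inj)
  then show "w = Poly_Mapping.map_key \<sigma> (Poly_Mapping.map_key ?\<tau> w)"
    using bij by (intro poly_mapping_eqI) (simp add: lookup_map_key map_key.rep_eq bij_is_inj)
qed

lemma inj_map_key: "inj (Poly_Mapping.map_key \<sigma> :: ('n \<Rightarrow>\<^sub>0 nat) \<Rightarrow> _)"
proof (rule injI)
  fix u v :: "'n \<Rightarrow>\<^sub>0 nat"
  assume "Poly_Mapping.map_key \<sigma> u = Poly_Mapping.map_key \<sigma> v"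
  then have "lookup u (\<sigma> i) = lookup v (\<sigma> i)" for i by (metis lookup_map_key)
  then show "u = v" using bij by (intro poly_mapping_eqI) (metis bij_pointE)
qed

lemma map_key_exp_dvd_iff:
  "Poly_Mapping.map_key \<sigma> u \<preceq> Poly_Mapping.map_key \<sigma> v \<longleftrightarrow> u \<preceq> v"
  unfolding exp_dvd_def lookup_map_key using bij by (metis bij_pointE)

lemma mdeg_map_key: "mdeg (Poly_Mapping.map_key \<sigma> u) = mdeg u"
  unfolding mdeg_conv_sum lookup_map_key using bij by (intro sum.reindex_bij_betw) (simp add: bij_def bij_betw_def)

lemma map_key_add_single:
  "Poly_Mapping.map_key \<sigma> (u + single (\<sigma> i) 1) = Poly_Mapping.map_key \<sigma> u + single i (1 :: nat)"
  using bij by (intro poly_mapping_eqI) (simp add: lookup_map_key lookup_add lookup_single when_def bij_is_inj inj_eq)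

lemma exps_rename_vars:
  fixes I :: "('n, 'k::field) mpoly set"
  shows "exps (rename_vars \<sigma> ` I) = {u. Poly_Mapping.map_key \<sigma> u \<in> exps I}"
proof -
  let ?\<kappa> = "Poly_Mapping.map_key \<sigma> :: ('n \<Rightarrow>\<^sub>0 nat) \<Rightarrow> _"
  have ren: "mon u = rename_vars \<sigma> p \<longleftrightarrow> p = mon (?\<kappa> u)" for u and p :: "('n, 'k) mpoly"
  proof
    assume "p = mon (?\<kappa> u)"
    then show "mon u = rename_vars \<sigma> p"
      using inj_map_key by (simp add: rename_vars_def mon_def map_key_single)
  next
    assume eq: "mon u = rename_vars \<sigma> p"
    show "p = mon (?\<kappa> u)"
    proof (rule poly_mapping_eqI)
      fix w :: "'n \<Rightarrow>\<^sub>0 nat"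
      obtain v where w: "w = ?\<kappa> v" using map_key_surj by blast
      have "lookup p w = lookup (rename_vars \<sigma> p) v"
        using inj_map_key by (simp add: rename_vars_def map_key.rep_eq w)
      also have "\<dots> = lookup (mon (?\<kappa> u)) w"
        using inj_map_key by (simp add: eq[symmetric] mon_def lookup_single w inj_eq)
      finally show "lookup p w = lookup (mon (?\<kappa> u)) w" .
    qed
  qed
  have "mon u \<in> rename_vars \<sigma> ` I \<longleftrightarrow> mon (?\<kappa> u) \<in> I" for u
    unfolding image_iff ren by simp
  then show ?thesis by (simp add: exps_def)
qed

text \<open>
  The renumbered ideal enters only through its exponents, hence it may be replaced by the monomial
  ideal \<open>J\<close> with the same exponents.
\<close>

theorem stable_truncation_rename_iff:
  fixes I :: "('n, 'k::field) mpoly set"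
  assumes I: "monomial_ideal I" and e: "max_gen_degree I \<le> e"
  shows "stable_ideal (truncation (rename_vars \<sigma> ` I) e) \<longleftrightarrow> bayer_stillman \<sigma> (exps I) e"
proof -
  let ?\<kappa> = "Poly_Mapping.map_key \<sigma> :: ('n \<Rightarrow>\<^sub>0 nat) \<Rightarrow> _"
  define B where "B = {u. ?\<kappa> u \<in> exps I}"
  define J :: "('n, 'k) mpoly set" where "J = idl.span (mon ` B)"
  have "up_closed B"
    using up_closedD[OF up_closed_exps[OF I]] by (auto simp: up_closed_def B_def map_key_exp_dvd_iff)
  then have exps_J: "exps J = B" by (simp add: J_def exps_span_mon_up_closed)
  have J: "monomial_ideal J" by (auto simp: J_def monomial_ideal_def)
  have gen: "mdeg u \<le> e" if u: "u \<in> min_exps (exps J)" for u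
  proof -
    have "?\<kappa> u \<in> exps I" using u by (simp add: min_exps_def exps_J B_def)
    then obtain g where g: "g \<in> min_exps (exps I)" "g \<preceq> ?\<kappa> u" by (rule min_exps_below)
    obtain g' where g': "g = ?\<kappa> g'" using map_key_surj by blast
    have "g' \<in> exps J" using g(1) by (simp add: g' exps_J B_def min_exps_def)
    moreover have "g' \<preceq> u" using g(2) by (simp add: g' map_key_exp_dvd_iff)
    ultimately have "g' = u" using u by (simp add: min_exps_def)
    then show ?thesis
      using mdeg_le_max_gen_degree[OF I g(1)] e by (simp add: g' mdeg_map_key)
  qed
  have "truncation (rename_vars \<sigma> ` I) e = truncation J e"
    by (rule truncation_cong) (simp add: exps_rename_vars exps_J B_def)
  then have "stable_ideal (truncation (rename_vars \<sigma> ` I) e) \<longleftrightarrow> bayer_stillman id B e"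
    using stable_truncation_iff[OF J gen] by (simp add: exps_J)
  also have "\<dots> \<longleftrightarrow> bayer_stillman \<sigma> (exps I) e"
  proof
    assume bs: "bayer_stillman id B e"
    show "bayer_stillman \<sigma> (exps I) e"
      unfolding bayer_stillman_def
    proof (intro allI impI)
      fix i w assume w: "\<forall>k\<in>keys w. \<sigma> k \<le> \<sigma> i" "e \<le> mdeg w" "w + single i 1 \<in> exps I"
      obtain v where v: "w = ?\<kappa> v" using map_key_surj by blast
      have "k \<le> \<sigma> i" if "k \<in> keys v" for k
      proof -
        obtain l where l: "k = \<sigma> l" using bij by (metis bij_pointE)
        then have "l \<in> keys w" using that by (simp add: v in_keys_iff lookup_map_key)
        then show ?thesis using w(1) l by blast
      qed
      moreover have "e \<le> mdeg v" using w(2) by (simp add: v mdeg_map_key)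
      moreover have "v + single (\<sigma> i) 1 \<in> B" using w(3) by (simp only: B_def mem_Collect_eq map_key_add_single v)
      ultimately have "v \<in> B" using bs unfolding bayer_stillman_def id_apply by blast
      then show "w \<in> exps I" by (simp add: B_def v)
    qed
  next
    assume bs: "bayer_stillman \<sigma> (exps I) e"
    show "bayer_stillman id B e"
      unfolding bayer_stillman_def id_apply
    proof (intro allI impI)
      fix i' v assume v: "\<forall>k\<in>keys v. k \<le> i'" "e \<le> mdeg v" "v + single i' 1 \<in> B"
      obtain i where i: "i' = \<sigma> i" using bij by (metis bij_pointE)
      have "\<sigma> k \<le> \<sigma> i" if "k \<in> keys (?\<kappa> v)" for k
        using that v(1) i by (simp add: in_keys_iff lookup_map_key)
      moreover have "?\<kappa> v + single i 1 \<in> exps I"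
        using v(3) by (simp only: B_def mem_Collect_eq i map_key_add_single)
      ultimately have "?\<kappa> v \<in> exps I"
        using bs v(2) unfolding bayer_stillman_def by (metis mdeg_map_key)
      then show "v \<in> B" by (simp add: B_def)
    qed
  qed
  finally show ?thesis .
qed

theorem regularity_stable_truncation:
  fixes I :: "('n, 'k::field) mpoly set"
  assumes I: "monomial_ideal I" and nz: "I \<noteq> {0}" and borel: "borel_exps \<sigma> (exps I)"
  shows "(\<exists>e. e \<ge> max_gen_degree I \<and> stable_ideal (truncation (rename_vars \<sigma> ` I) e)) \<and>
    regularity I = int (LEAST e. e \<ge> max_gen_degree I \<and> stable_ideal (truncation (rename_vars \<sigma> ` I) e))"
proof -
  have "e \<ge> max_gen_degree I \<and> stable_ideal (truncation (rename_vars \<sigma> ` I) e) \<longleftrightarrow>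
      e \<ge> max_gen_degree I \<and> bayer_stillman \<sigma> (exps I) e" for e
    using stable_truncation_rename_iff[OF I] by blast
  then show ?thesis
    using borel_exps_bayer_stillman[OF I borel] regularity_bayer_stillman[OF I nz borel] by simp
qed

end

lemma rename_vars_id: "rename_vars id ` I = I"
proof -
  have "Poly_Mapping.map_key id = (id :: ('a \<Rightarrow>\<^sub>0 nat) \<Rightarrow> _)"
    by (intro ext poly_mapping_eqI) (simp add: map_key.rep_eq)
  then have "rename_vars id p = p" for p :: "('a, 'b) mpoly"
    by (intro poly_mapping_eqI) (simp add: rename_vars_def map_key.rep_eq)
  then show ?thesis by simp
qed

section \<open>Ideals of Borel type\<close>

lemma X_power: "X i ^ k = mon (single i k)"
  by (induction k) (simp_all add: mon_def X_def mult_single single_add[symmetric] flip: single_one)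

lemma borel_type_borel_exps:
  fixes I :: "('n::{finite,linorder}, 'k::field) mpoly set"
  assumes borel: "borel_type I"
  shows "borel_exps id (exps I)"
  unfolding borel_exps_def id_apply
proof (intro allI impI)
  fix i j :: 'n and w k
  assume ji: "j \<le> i" and w: "w + single i k \<in> exps I"
  have I: "monomial_ideal I" and sat: "saturation I (idl.span {X i}) = saturation I (idl.span (X ` {..i}))"
    using borel by (auto simp: borel_type_def)
  have dvd: "x ^ m dvd f" if "f \<in> ideal_power (idl.span {x}) m" for f x :: "('n, 'k) mpoly" and m
    using that
  proof (induction m arbitrary: f)
    case (Suc m)
    have "idl.subspace {f. x ^ Suc m dvd f}"
      by (rule idl.subspaceI) auto
    moreover have "{a * b |a b. a \<in> idl.span {x} \<and> b \<in> ideal_power (idl.span {x}) m} \<subseteq> {f. x ^ Suc m dvd f}"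
    proof
      fix y assume "y \<in> {a * b |a b. a \<in> idl.span {x} \<and> b \<in> ideal_power (idl.span {x}) m}"
      then obtain a b where y: "y = a * b" "a \<in> idl.span {x}" "b \<in> ideal_power (idl.span {x}) m" by auto
      have "x dvd a" using y(2) by (auto simp: idl.span_singleton)
      then show "y \<in> {f. x ^ Suc m dvd f}" using Suc.IH[OF y(3)] by (simp add: y(1) mult_dvd_mono)
    qed
    ultimately have "idl.span {a * b |a b. a \<in> idl.span {x} \<and> b \<in> ideal_power (idl.span {x}) m} \<subseteq> {f. x ^ Suc m dvd f}"
      by (rule idl.span_minimal[rotated])
    then show ?case using Suc.prems by auto
  qed simp
  have "mon w \<in> colon I (ideal_power (idl.span {X i}) k)"
    unfolding colon_def
  proof (intro CollectI ballI)
    fix f :: "('n, 'k) mpoly" assume "f \<in> ideal_power (idl.span {X i}) k"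
    from dvd[OF this] obtain h where "f = X i ^ k * h" by (rule dvdE)
    then have "mon w * f = h * (mon w * mon (single i k))"
      by (simp only: X_power mult_ac)
    also have "mon w * mon (single i k) = (mon (w + single i k) :: ('n, 'k) mpoly)"
      by (simp add: mon_def mult_single)
    finally have "mon w * f = h * mon (w + single i k)" .
    moreover have "h * mon (w + single i k) \<in> I"
      using w by (intro idl.subspace_scale[OF subspace_monomial_ideal[OF I]]) (simp add: exps_def)
    ultimately show "mon w * f \<in> I" by simp
  qed
  then have "mon w \<in> saturation I (idl.span {X i})"
    unfolding saturation_def by (rule UN_I[OF UNIV_I])
  then have "mon w \<in> saturation I (idl.span (X ` {..i}))" by (simp only: sat)
  then obtain l where l: "mon w \<in> colon I (ideal_power (idl.span (X ` {..i})) l)"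
    unfolding saturation_def by (rule UN_E)
  have "(X j :: ('n, 'k) mpoly) ^ m \<in> ideal_power (idl.span (X ` {..i})) m" for m
  proof (induction m)
    case (Suc m)
    have "(X j :: ('n, 'k) mpoly) \<in> idl.span (X ` {..i})" using ji by (intro idl.span_base) auto
    then have "(X j :: ('n, 'k) mpoly) * X j ^ m \<in> {a * b |a b. a \<in> idl.span (X ` {..i}) \<and> b \<in> ideal_power (idl.span (X ` {..i})) m}"
      using Suc by blast
    then show ?case unfolding power_Suc ideal_power.simps by (rule idl.span_base)
  qed simp
  then have "mon w * X j ^ l \<in> I"
    using l unfolding colon_def mem_Collect_eq by (rule bspec[rotated])
  then have "w + single j l \<in> exps I" by (simp add: X_power exps_def mon_def mult_single)
  then show "\<exists>l. w + single j l \<in> exps I" by blast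
qed

section \<open>Totally ordered associated primes\<close>

lemma keys_add_nat: "keys (u + v) = keys u \<union> keys v" for u v :: "'n \<Rightarrow>\<^sub>0 nat"
  by (auto simp: in_keys_iff lookup_add)

text \<open>
  Let \<open>w\<close> be in the saturation of \<open>I\<close> by \<open>x_i\<close> but not by \<open>x_j\<close>. Multiply \<open>w\<close> by a high power of \<open>x_j\<close>,
  and then by further variables until the exponents, capped at the largest degree \<open>D\<close> of a minimal
  generator, cannot be increased without entering \<open>I\<close>. The annihilator of the resulting monomial \<open>u\<close>
  modulo \<open>I\<close> is generated by the variables \<open>x_l\<close> with \<open>x_l u\<close> in \<open>I\<close>; it contains \<open>x_i\<close> but not \<open>x_j\<close>.
\<close>

lemma associated_prime_separating:
  fixes I :: "('n::{finite,linorder}, 'k::field) mpoly set"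
  assumes I: "monomial_ideal I" and w: "w + single i k \<in> exps I" "\<And>l. w + single j l \<notin> exps I"
  obtains P where "P \<in> associated_primes I" "X i \<in> P" "X j \<notin> P"
proof -
  note up = up_closedD[OF up_closed_exps[OF I]]
  let ?D = "max_gen_degree I"
  define m where "m u = (\<Sum>l\<in>UNIV. min (lookup u l) ?D)" for u :: "'n \<Rightarrow>\<^sub>0 nat"
  define U where "U u \<longleftrightarrow> w + single j ?D \<preceq> u \<and> u \<notin> exps I" for u
  have "m u < Suc (CARD('n) * ?D)" for u
    using sum_bounded_above[of UNIV "\<lambda>l. min (lookup u l) ?D" ?D] by (simp add: m_def)
  moreover have "U (w + single j ?D)" using w(2) by (simp add: U_def)
  ultimately obtain u where u: "U u" and umax: "\<And>v. U v \<Longrightarrow> m v \<le> m u"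
    using ex_has_greatest_nat[of U "w + single j ?D" m "Suc (CARD('n) * ?D)"] by blast
  have uI: "u \<notin> exps I" and wu: "w + single j ?D \<preceq> u" using u by (auto simp: U_def)
  define V where "V = {l. u + single l 1 \<in> exps I}"
  have large: "?D \<le> lookup u l" if "l \<notin> V" for l
  proof (rule ccontr)
    assume small: "\<not> ?D \<le> lookup u l"
    have "U (u + single l 1)"
      using that wu exp_dvd_trans[OF wu] by (simp add: U_def V_def)
    from umax[OF this] have "m (u + single l 1) \<le> m u" .
    moreover have "m u < m (u + single l 1)"
      unfolding m_def
    proof (rule sum_strict_mono_ex1)
      show "\<exists>a\<in>UNIV. min (lookup u a) ?D < min (lookup (u + single l 1) a) ?D"
        using small by (intro bexI[of _ l]) (auto simp: lookup_add)
    qed (auto simp: lookup_add)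
    ultimately show False by simp
  qed
  have "lookup (w + single j ?D) j \<le> lookup u j" using wu by (simp add: exp_dvd_def)
  then have "?D \<le> lookup u j" by (simp add: lookup_add)
  then have jV: "j \<notin> V"
    using in_exps_of_large_exponent[OF I] uI by (auto simp: V_def)
  have iV: "i \<in> V"
  proof (rule ccontr)
    assume "i \<notin> V"
    have "w + single i k \<preceq> u + single i k"
      using wu by (auto simp: exp_dvd_def lookup_add intro: le_trans add_leD1)
    then have "u + single i k \<in> exps I" using up[OF w(1)] by simp
    then show False using in_exps_of_large_exponent[OF I _ large[OF \<open>i \<notin> V\<close>]] uI by blast
  qed
  define P where "P = {g. g * mon u \<in> I}"
  have avoid: "v + u \<notin> exps I" if v: "keys v \<inter> V = {}" for v
  proof
    assume "v + u \<in> exps I"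
    then obtain g where g: "g \<in> min_exps (exps I)" "g \<preceq> v + u" by (rule min_exps_below)
    have "lookup g l \<le> lookup u l" for l
    proof (cases "l \<in> keys v")
      case True
      have "lookup g l \<le> mdeg g"
        unfolding mdeg_conv_sum by (intro member_le_sum) auto
      also have "\<dots> \<le> ?D" by (rule mdeg_le_max_gen_degree[OF I g(1)])
      also have "\<dots> \<le> lookup u l" using True v by (intro large) auto
      finally show ?thesis .
    next
      case False
      have "lookup g l \<le> lookup (v + u) l" using g(2) by (simp add: exp_dvd_def)
      then show ?thesis using False by (simp add: lookup_add in_keys_iff)
    qed
    then have "g \<preceq> u" by (simp add: exp_dvd_def)
    then show False using up[of g u] g(1) uI by (auto simp: min_exps_def)
  qed
  have P_iff: "g \<in> P \<longleftrightarrow> (\<forall>v\<in>keys g. keys v \<inter> V \<noteq> {})" for g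
  proof
    assume "g \<in> P"
    then have gu: "keys (g * mon u) \<subseteq> exps I" using in_monomial_ideal_iff[OF I] by (simp add: P_def)
    show "\<forall>v\<in>keys g. keys v \<inter> V \<noteq> {}"
    proof
      fix v assume "v \<in> keys g"
      then have "v + u \<in> keys (g * mon u)"
        by (simp add: in_keys_iff mon_def lookup_single_times mult.commute[of g])
      then show "keys v \<inter> V \<noteq> {}" using gu avoid by blast
    qed
  next
    assume g: "\<forall>v\<in>keys g. keys v \<inter> V \<noteq> {}"
    have "keys (g * mon u) \<subseteq> exps I"
    proof
      fix x assume "x \<in> keys (g * mon u)"
      then obtain v where v: "v \<in> keys g" "x = v + u"
        using keys_mult[of g "mon u"] by (auto simp: mon_def split: if_splits)
      obtain l where l: "l \<in> keys v" "l \<in> V" using g v(1) by blast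
      have "u + single l 1 \<preceq> v + u"
        using l(1) by (auto simp: exp_dvd_def lookup_add lookup_single when_def in_keys_iff)
      then show "x \<in> exps I" using l(2) up by (auto simp: V_def v(2))
    qed
    then show "g \<in> P" using in_monomial_ideal_iff[OF I] by (simp add: P_def)
  qed
  have subP: "idl.subspace P"
    using subspace_monomial_ideal[OF I] unfolding P_def idl.subspace_def
    by (auto simp: distrib_right mult.assoc)
  have "prime_ideal P"
    unfolding prime_ideal_def
  proof (intro conjI allI impI)
    have "1 \<notin> P" by (simp add: P_iff)
    then show "P \<noteq> UNIV" by blast
    fix a b assume ab: "a * b \<in> P"
    \<comment> \<open>Modulo \<open>P\<close>, a polynomial equals its part in the variables outside \<open>V\<close>; these parts have no zero divisors.\<close>
    let ?r = "restr (\<lambda>v. keys v \<inter> V = {}) :: ('n, 'k) mpoly \<Rightarrow> _"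
    have diff: "a - ?r a \<in> P" for a
      by (auto simp: P_iff in_keys_iff lookup_minus lookup_restr)
    have "?r a * ?r b = a * b - (a - ?r a) * b - ?r a * (b - ?r b)"
      unfolding left_diff_distrib right_diff_distrib by simp
    also have "\<dots> \<in> P"
    proof (intro idl.subspace_diff[OF subP])
      show "a * b \<in> P" by (rule ab)
      show "(a - ?r a) * b \<in> P" by (subst mult.commute) (rule idl.subspace_scale[OF subP diff])
      show "?r a * (b - ?r b) \<in> P" by (rule idl.subspace_scale[OF subP diff])
    qed
    finally have "?r a * ?r b \<in> P" .
    then have hit: "\<forall>v\<in>keys (?r a * ?r b). keys v \<inter> V \<noteq> {}" by (rule P_iff[THEN iffD1])
    have "keys v \<inter> V = {}" if "v \<in> keys (?r a * ?r b)" for v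
    proof -
      have "v \<in> {x + y |x y. x \<in> keys (?r a) \<and> y \<in> keys (?r b)}"
        using keys_mult that by (rule subsetD)
      then show ?thesis by (auto simp add: keys_restr keys_add_nat Int_Un_distrib2)
    qed
    with hit have "keys (?r a * ?r b) = {}" by (meson equals0I)
    then have "?r a * ?r b = 0" by (simp only: keys_eq_empty)
    then have "?r a = 0 \<or> ?r b = 0" by (simp only: mult_eq_0_iff)
    then show "a \<in> P \<or> b \<in> P" using diff[of a] diff[of b] by auto
  qed (rule subP)
  then have "P \<in> associated_primes I" by (auto simp: associated_primes_def P_def)
  moreover have "X i \<in> P" "X j \<notin> P" using iV jV by (auto simp: P_iff X_def mon_def)
  ultimately show thesis by (rule that)
qed

text \<open>
  Sorting by a key function, as a renumbering.
\<close>

lemma bij_betw_sorting: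
  fixes f :: "'n::linorder \<Rightarrow> nat" and A B :: "'n set"
  assumes "finite A" "finite B" "card A = card B"
  shows "\<exists>\<sigma>. bij_betw \<sigma> A B \<and> (\<forall>i\<in>A. \<forall>j\<in>A. \<sigma> j \<le> \<sigma> i \<longrightarrow> f j \<le> f i)"
  using assms
proof (induction "card A" arbitrary: A B)
  case 0
  then show ?case by (intro exI[of _ id]) (auto simp: bij_betw_def)
next
  case (Suc n)
  have "Max (f ` A) \<in> f ` A" using Suc.hyps(2) Suc.prems by (intro Max_in) auto
  then obtain a where a: "a \<in> A" "f a = Max (f ` A)" by auto
  define b where "b = Max B"
  have "B \<noteq> {}" using Suc.hyps(2) Suc.prems by auto
  then have b: "b \<in> B" "\<And>x. x \<in> B \<Longrightarrow> x \<le> b" using Suc.prems by (auto simp: b_def)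
  have "n = card (A - {a})" "card (A - {a}) = card (B - {b})"
    using Suc.hyps(2) Suc.prems a(1) b(1) by simp_all
  then obtain \<sigma> where \<sigma>: "bij_betw \<sigma> (A - {a}) (B - {b})"
    "\<forall>i\<in>A - {a}. \<forall>j\<in>A - {a}. \<sigma> j \<le> \<sigma> i \<longrightarrow> f j \<le> f i"
    using Suc.hyps(1)[of "A - {a}" "B - {b}"] Suc.prems by auto
  define \<tau> where "\<tau> = \<sigma>(a := b)"
  have "bij_betw \<tau> A B"
  proof -
    have "bij_betw \<tau> (A - {a}) (B - {b})"
      using \<sigma>(1) by (rule bij_betw_cong[THEN iffD1, rotated]) (simp add: \<tau>_def)
    moreover have "bij_betw \<tau> {a} {b}" by (simp add: \<tau>_def bij_betw_def)
    ultimately have "bij_betw \<tau> ((A - {a}) \<union> {a}) ((B - {b}) \<union> {b})"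
      by (rule bij_betw_combine) auto
    then show ?thesis using a(1) b(1) by (simp add: insert_absorb)
  qed
  moreover have "f j \<le> f i" if ij: "i \<in> A" "j \<in> A" "\<tau> j \<le> \<tau> i" for i j
  proof (cases "i = a")
    case True
    then show ?thesis using a(2) ij(2) Suc.prems(1) by simp
  next
    case False
    then have "\<tau> i \<in> B - {b}" using \<sigma>(1) ij(1) by (auto simp: \<tau>_def bij_betw_def)
    then have "\<tau> i < b" using b(2)[of "\<tau> i"] by auto
    then have "j \<noteq> a" using ij(3) by (auto simp: \<tau>_def)
    then show ?thesis using \<sigma>(2) ij False by (simp add: \<tau>_def)
  qed
  ultimately show ?case by blast
qed

lemma chain_borel_exps:
  fixes I :: "('n::{finite,linorder}, 'k::field) mpoly set"
  assumes I: "monomial_ideal I"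
    and chain: "\<forall>P\<in>associated_primes I. \<forall>Q\<in>associated_primes I. P \<subseteq> Q \<or> Q \<subseteq> P"
  obtains \<sigma> where "bij \<sigma>" "borel_exps \<sigma> (exps I)"
proof -
  define R where "R j i \<longleftrightarrow> (\<forall>w k. w + single i k \<in> exps I \<longrightarrow> (\<exists>l. w + single j l \<in> exps I))" for i j :: 'n
  have sep: "\<exists>P\<in>associated_primes I. X i \<in> P \<and> X j \<notin> P" if "\<not> R j i" for i j
  proof -
    have "\<exists>w k. w + single i k \<in> exps I \<and> (\<forall>l. w + single j l \<notin> exps I)"
      using that unfolding R_def by blast
    then obtain w k where "w + single i k \<in> exps I" "\<And>l. w + single j l \<notin> exps I"
      by (elim exE conjE) simp
    then obtain P where "P \<in> associated_primes I" "X i \<in> P" "X j \<notin> P"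
      by (rule associated_prime_separating[OF I])
    then show ?thesis by blast
  qed
  have total: "R i j \<or> R j i" for i j
    using sep[of i j] sep[of j i] chain by blast
  have trans: "R i j \<Longrightarrow> R j k \<Longrightarrow> R i k" for i j k
    unfolding R_def by blast
  \<comment> \<open>A total preorder is described by the sizes of its initial segments.\<close>
  define f where "f i = card {j. R j i}" for i
  obtain \<sigma> :: "'n \<Rightarrow> 'n" where \<sigma>: "bij \<sigma>" "\<And>i j. \<sigma> j \<le> \<sigma> i \<Longrightarrow> f j \<le> f i"
    using bij_betw_sorting[of UNIV UNIV f] by auto
  have "R j i" if "\<sigma> j \<le> \<sigma> i" for i j
  proof (rule ccontr)
    assume no: "\<not> R j i"
    have "{k. R k i} \<subset> {k. R k j}"
      using total trans no by blast
    then have "f i < f j" unfolding f_def by (intro psubset_card_mono) auto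
    then show False using \<sigma>(2)[OF that] by simp
  qed
  then have "borel_exps \<sigma> (exps I)" unfolding borel_exps_def R_def by blast
  with \<sigma>(1) show thesis by (rule that)
qed

theorem corollary1p2p11:
  fixes I :: "('n::{finite,linorder}, 'k::field) mpoly set"
  assumes "infinite (UNIV :: 'k set)"
    and "CARD('n) \<ge> 2"
    and "monomial_ideal I"
    and "I \<noteq> {0}"
  shows "(borel_type I \<longrightarrow>
            (\<exists>e. e \<ge> max_gen_degree I \<and> stable_ideal (truncation I e)) \<and>
            regularity I = int (LEAST e. e \<ge> max_gen_degree I \<and> stable_ideal (truncation I e)))
       \<and> ((\<forall>P\<in>associated_primes I. \<forall>Q\<in>associated_primes I. P \<subseteq> Q \<or> Q \<subseteq> P) \<longrightarrow>
            (\<exists>\<sigma>. bij \<sigma> \<and>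
               (\<exists>e. e \<ge> max_gen_degree I \<and> stable_ideal (truncation (rename_vars \<sigma> ` I) e)) \<and>
               regularity I =
                 int (LEAST e. e \<ge> max_gen_degree I \<and> stable_ideal (truncation (rename_vars \<sigma> ` I) e))))"
proof (intro conjI impI)
  assume "borel_type I"
  \<comment> \<open>Here the renumbering is the identity.\<close>
  from regularity_stable_truncation[OF bij_id assms(3,4) borel_type_borel_exps[OF this]]
  show "\<exists>e. e \<ge> max_gen_degree I \<and> stable_ideal (truncation I e)"
    and "regularity I = int (LEAST e. e \<ge> max_gen_degree I \<and> stable_ideal (truncation I e))"
    unfolding rename_vars_id by blast+
next
  assume "\<forall>P\<in>associated_primes I. \<forall>Q\<in>associated_primes I. P \<subseteq> Q \<or> Q \<subseteq> P"
  then obtain \<sigma> where "bij \<sigma>" "borel_exps \<sigma> (exps I)"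
    using chain_borel_exps[OF assms(3)] by blast
  with regularity_stable_truncation[OF _ assms(3,4)]
  show "\<exists>\<sigma>. bij \<sigma> \<and>
      (\<exists>e. e \<ge> max_gen_degree I \<and> stable_ideal (truncation (rename_vars \<sigma> ` I) e)) \<and>
      regularity I =
        int (LEAST e. e \<ge> max_gen_degree I \<and> stable_ideal (truncation (rename_vars \<sigma> ` I) e))"
    by blast
qed

end
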